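(* Let $\{X^i_t : i\in I_t,\ t\ge 0\}$ be the branching process described in the context, started from one particle at $x_0\in\mathcal X$, with underlying right-continuous strong Markov process $X$ ($X_0=x_0$) and bounded branching rate $\lambda$, and suppose that the number of offspring is $N=2$ almost surely. Let $\mathcal M$ be the set of non-negative martingales with respect to the filtration generated by $X$. Given a measurable function $f:\mathcal X\to[0,1]$ and $t\ge0$, let $u=\mathbb E\big[\prod_{i\in I_t}f(X^i_t)\big]$. Then $$u=1-\max_{\zeta\in\mathcal M}\mathbb E\left[\frac{(1-f(X_t))\,\zeta_t\,e^{\int_0^t\lambda(X_s)\,ds}}{\zeta_t+(1-f(X_t))\int_0^t\zeta_s\,\lambda(X_s)\,e^{\int_s^t\lambda(X_r)\,dr}\,ds}\right].$$
   Context: Branching process: $\mathcal X$ is a Polish space. Initially there is one particle at $x_0\in\mathcal X$, which moves according to the law of a given right-continuous strong Markov process $X$ with $X_0=x_0$. At a random time $T>0$ the particle is killed and replaced with $N$ particles; each of these moves and branches as an independent copy of the initial particle, started from the final position $X_T$ of the initial particle. The law of $T$ given the process $X$ is $\mathbb P(T>t\mid X)=e^{-\int_0^t\lambda(X_s)\,ds}$ for all $t\ge0$, where $\lambda:\mathcal X\to[0,\infty)$ is a given bounded measurable function. $I_t$ denotes the set of particles alive at time $t$, and $X^i_t$ the position of particle $i\in I_t$. $X_t$ denotes the position at time $t$ of the initial particle if it were allowed to continue living after the branching event. All real-valued processes are assumed to have measurable sample paths, so pathwise integrals are well defined.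
   Formalization: The martingales in the maximum are required to be jointly measurable in time and chance, not merely to have measurable sample paths; with sample-path measurability alone the pathwise integrals need not be random variables and, under CH, the identity fails. *)

theory Defs
  imports "HOL-Probability.Probability"
begin

section \<open>Right-continuous strong Markov processes\<close>

text \<open>Time is \<open>[0,\<infinity>)\<close>, a subset of type \<^typ>\<open>real\<close>; paths carry no information at negative times.
  The sigma-algebra on path space is the trace of the product sigma-algebra, i.e. the one generated
  by the coordinate maps.\<close>

type_synonym 'a path = "real \<Rightarrow> 'a"

definition path_space :: "'a::polish_space path measure" where
  "path_space = restrict_space (PiM {0..} (\<lambda>_. borel)) {w. \<forall>t\<ge>0. continuous (at_right t) w}"

definition shift :: "real \<Rightarrow> 'a path \<Rightarrow> 'a path" where
  "shift s w = (\<lambda>t\<in>{0..}. w (s + t))"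

text \<open>The filtration generated by \<open>X\<close> (not completed, not made right-continuous). It is indexed by
  \<open>[0,\<infinity>]\<close>, the value at \<open>\<infinity>\<close> being generated by the whole process, so that stopping times may be
  infinite.\<close>

definition natural_filtration ::
    "'w measure \<Rightarrow> (real \<Rightarrow> 'w \<Rightarrow> 'a::topological_space) \<Rightarrow> ennreal \<Rightarrow> 'w measure" where
  "natural_filtration M X t =
     sigma (space M) {X s -` A \<inter> space M | s A. 0 \<le> s \<and> ennreal s \<le> t \<and> A \<in> sets borel}"

abbreviation path_filtration :: "ennreal \<Rightarrow> 'a::polish_space path measure" where
  "path_filtration \<equiv> natural_filtration path_space (\<lambda>s w. w s)"

text \<open>\<open>P x\<close> is the law of the process started from \<open>x\<close>. The last clause is the strong Markov property:
  on \<open>\<tau> < \<infinity>\<close>, the conditional law of the path after \<open>\<tau>\<close>, given the past of \<open>\<tau>\<close>, is \<open>P (w \<tau>)\<close>.\<close>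

definition strong_markov :: "('a::polish_space \<Rightarrow> 'a path measure) \<Rightarrow> bool" where
  "strong_markov P \<longleftrightarrow>
     P \<in> borel \<rightarrow>\<^sub>M prob_algebra path_space \<and>
     (\<forall>x. AE w in P x. w 0 = x) \<and>
     (\<forall>x \<tau>. \<forall>B\<in>sets path_space. stopping_time path_filtration \<tau> \<longrightarrow>
        (AE w in P x.
           real_cond_exp (P x) (filtration.pre_sigma (space path_space) path_filtration \<tau>)
             (indicator {w \<in> space path_space. \<tau> w < \<infinity> \<and> shift (enn2real (\<tau> w)) w \<in> B}) w =
           indicator {w. \<tau> w < \<infinity>} w * measure (P (w (enn2real (\<tau> w)))) B))"

section \<open>Branching processes\<close>

text \<open>A particle is described by its path, run forever as if it were never killed and started at time
  \<open>0\<close> on its own clock, its lifetime \<open>T\<close> (possibly \<open>\<infinity>\<close>) and its number \<open>N\<close> of offspring.\<close>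

type_synonym 'a particle = "'a path \<times> ennreal \<times> nat"

abbreviation path_of :: "'a particle \<Rightarrow> 'a path" where
  "path_of \<equiv> fst"

abbreviation lifetime :: "'a particle \<Rightarrow> ennreal" where
  "lifetime m \<equiv> fst (snd m)"

abbreviation offspring :: "'a particle \<Rightarrow> nat" where
  "offspring m \<equiv> snd (snd m)"

definition particle_space :: "'a::polish_space particle measure" where
  "particle_space = path_space \<Otimes>\<^sub>M (borel \<Otimes>\<^sub>M count_space UNIV)"

text \<open>The final position \<open>X\<^sub>T\<close>; irrelevant if \<open>T = \<infinity>\<close>, as then no child is ever born.\<close>

definition final_position :: "'a particle \<Rightarrow> 'a" where
  "final_position m = path_of m (enn2real (lifetime m))"

text \<open>\<open>K x\<close> is the law of a particle started at \<open>x\<close>: the path has law \<open>P x\<close>, and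
  \<open>P(T > t | X) = exp (- \<integral>\<^sub>0\<^sup>t lam(X\<^sub>s) ds)\<close> for all \<open>t \<ge> 0\<close> (at \<open>t = 0\<close> this yields \<open>T > 0\<close>
  almost surely). The offspring number may depend on path and lifetime.\<close>

definition particle_law ::
    "('a::polish_space \<Rightarrow> 'a path measure) \<Rightarrow> ('a \<Rightarrow> real) \<Rightarrow> ('a \<Rightarrow> 'a particle measure) \<Rightarrow> bool" where
  "particle_law P lam K \<longleftrightarrow>
     K \<in> borel \<rightarrow>\<^sub>M prob_algebra particle_space \<and>
     (\<forall>x. distr (K x) path_space path_of = P x) \<and>
     (\<forall>x. \<forall>t\<ge>0. AE m in K x.
        real_cond_exp (K x) (vimage_algebra (space particle_space) path_of path_space)
          (indicator {m \<in> space particle_space. ennreal t < lifetime m}) m =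
        exp (- (LINT s:{0..t}|lborel. lam (path_of m s))))"

text \<open>Particles carry Ulam-Harris labels: \<open>[]\<close> is the initial particle, and the children of \<open>l\<close> are
  \<open>l @ [j]\<close> with \<open>j < N\<^sub>l\<close>. Labels outside the actual genealogical tree also carry particles, which
  are ignored.\<close>

type_synonym 'a tree = "nat list \<Rightarrow> 'a particle"

definition tree_space :: "'a::polish_space tree measure" where
  "tree_space = PiM UNIV (\<lambda>_. particle_space)"

primrec graft :: "'a particle \<Rightarrow> (nat \<Rightarrow> 'a tree) \<Rightarrow> 'a tree" where
  "graft m S [] = m"
| "graft m S (j # l) = S j l"

text \<open>\<open>Q x\<close> is the law of the process started from one particle at \<open>x\<close>: given the initial particle,
  the subtrees of its children are independent copies of the whole process, started from its final
  position. These equations determine the laws of all generations inductively, hence \<open>Q\<close>.\<close>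

definition branching_law ::
    "('a::polish_space \<Rightarrow> 'a particle measure) \<Rightarrow> ('a \<Rightarrow> 'a tree measure) \<Rightarrow> bool" where
  "branching_law K Q \<longleftrightarrow>
     Q \<in> borel \<rightarrow>\<^sub>M prob_algebra tree_space \<and>
     (\<forall>x. Q x = bind (K x) (\<lambda>m.
        distr (PiM UNIV (\<lambda>_. Q (final_position m))) tree_space (graft m)))"

definition branching_process ::
    "'w measure \<Rightarrow> ('a::polish_space \<Rightarrow> 'a particle measure) \<Rightarrow> 'a \<Rightarrow> ('w \<Rightarrow> 'a tree) \<Rightarrow> bool" where
  "branching_process M K x Y \<longleftrightarrow>
     prob_space M \<and> Y \<in> M \<rightarrow>\<^sub>M tree_space \<and>
     (\<exists>Q. branching_law K Q \<and> distr M tree_space Y = Q x)"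

definition birth_time :: "'a tree \<Rightarrow> nat list \<Rightarrow> ennreal" where
  "birth_time y l = (\<Sum>k<length l. lifetime (y (take k l)))"

text \<open>Finite almost surely when the branching rate is bounded and \<open>N = 2\<close>.\<close>

definition alive :: "'a tree \<Rightarrow> real \<Rightarrow> nat list set" where
  "alive y t = {l. (\<forall>k<length l. l ! k < offspring (y (take k l))) \<and>
     birth_time y l \<le> ennreal t \<and> ennreal t < birth_time y l + lifetime (y l)}"

definition position :: "'a tree \<Rightarrow> real \<Rightarrow> nat list \<Rightarrow> 'a" where
  "position y t l = path_of (y l) (t - enn2real (birth_time y l))"

definition initial_motion :: "('w \<Rightarrow> 'a tree) \<Rightarrow> real \<Rightarrow> 'w \<Rightarrow> 'a" where
  "initial_motion Y t \<omega> = path_of (Y \<omega> []) t"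

section \<open>Martingales and the variational functional\<close>

text \<open>Processes are required to be jointly measurable in time and chance. This implies measurability
  of sample paths; the latter alone would not ensure that pathwise integrals are random
  variables.\<close>

definition nonneg_martingales :: "'w measure \<Rightarrow> (ennreal \<Rightarrow> 'w measure) \<Rightarrow> (real \<Rightarrow> 'w \<Rightarrow> real) set" where
  "nonneg_martingales M F = {\<zeta>.
     (\<lambda>(t, \<omega>). \<zeta> t \<omega>) \<in> borel_measurable (restrict_space borel {0..} \<Otimes>\<^sub>M M) \<and>
     (\<forall>t\<ge>0. \<zeta> t \<in> borel_measurable (F (ennreal t)) \<and> integrable M (\<zeta> t)) \<and>
     (\<forall>t\<ge>0. \<forall>\<omega>\<in>space M. 0 \<le> \<zeta> t \<omega>) \<and>
     (\<forall>s\<ge>0. \<forall>t\<ge>s. AE \<omega> in M. real_cond_exp M (F (ennreal s)) (\<zeta> t) \<omega> = \<zeta> s \<omega>)}"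

text \<open>The quotient is \<open>0\<close> where \<open>\<zeta>\<^sub>t = 0\<close>, also when the denominator vanishes. For a nonnegative
  martingale \<open>\<zeta>\<close> and bounded \<open>lam\<close>, almost every path of \<open>\<zeta>\<close> is integrable over \<open>[0,t]\<close>.\<close>

definition functional ::
    "'w measure \<Rightarrow> (real \<Rightarrow> 'w \<Rightarrow> 'a) \<Rightarrow> ('a \<Rightarrow> real) \<Rightarrow> ('a \<Rightarrow> real) \<Rightarrow> real \<Rightarrow> (real \<Rightarrow> 'w \<Rightarrow> real) \<Rightarrow> real"
  where
  "functional M X lam f t \<zeta> = (LINT \<omega>|M.
     ((1 - f (X t \<omega>)) * \<zeta> t \<omega> * exp (LINT s:{0..t}|lborel. lam (X s \<omega>))) /
     (\<zeta> t \<omega> + (1 - f (X t \<omega>)) *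
        (LINT s:{0..t}|lborel. \<zeta> s \<omega> * lam (X s \<omega>) * exp (LINT r:{s..t}|lborel. lam (X r \<omega>)))))"

end

theory Submission
  imports Defs
begin

text \<open>
Write \<open>v(t, x) = 1 - u(t, x)\<close> for the process started at \<open>x\<close>, and fix the horizon \<open>t\<close>. Along a path let
\<open>w\<^sub>s = v(t - s, X\<^sub>s)\<close>, \<open>g = 1 - f(X\<^sub>t) = w\<^sub>t\<close>, \<open>H\<^sub>s = \<integral>\<^sub>0\<^sup>s lam(X\<^sub>r) dr\<close> (\<open>hazard\<close>) and
\<open>A\<^sub>s = \<integral>\<^sub>0\<^sup>s lam(X\<^sub>r) w\<^sub>r dr\<close> (\<open>thinned_hazard\<close>).

Conditioning on the first branching event gives \<open>v(t, x)\<close> as the expectation of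
\<open>g exp (- H\<^sub>t) + \<integral>\<^sub>0\<^sup>t lam(X\<^sub>s) exp (- H\<^sub>s) w\<^sub>s (2 - w\<^sub>s) ds\<close> (\<open>mean_defect_equation\<close>); here
\<open>w (2 - w) = 1 - (1 - w)\<^sup>2\<close> is the effect of having two offspring. By the Markov property, and since \<open>2 - w = 1 + (1 - w)\<close>,
this becomes the Feynman-Kac statement that \<open>o\<^sub>s = w\<^sub>s exp (H\<^sub>s - A\<^sub>s)\<close>, \<open>0 \<le> s \<le> t\<close>, is a
martingale with mean \<open>v(t, x)\<close> (\<open>optimal_martingale_property\<close>).

Let \<open>\<beta>\<close> be the random probability measure on \<open>[0, t]\<close> with density \<open>a\<^sub>s = lam(X\<^sub>s) w\<^sub>s exp (- A\<^sub>s)\<close>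
(\<open>thinned_density\<close>) and an atom of mass \<open>exp (- A\<^sub>t)\<close> at \<open>t\<close>. For a nonnegative martingale \<open>\<zeta>\<close> put
\<open>R = \<zeta> / o\<close>. Rewriting the integrand of the functional in terms of \<open>\<beta>\<close> turns it into
\<open>o\<^sub>t R\<^sub>t / \<integral> R\<^sub>s \<beta>(ds)\<close>. For \<open>\<zeta> = o\<close> the ratio \<open>R\<close> is 1, so the value of the functional is \<open>E o\<^sub>t = v\<close>
(\<open>path_quotient_optimal\<close>). For general \<open>\<zeta>\<close>, convexity of \<open>1 / x\<close> bounds the integrand by
\<open>o\<^sub>t \<integral> R\<^sub>t / R\<^sub>s \<beta>(ds)\<close>, that is, by \<open>exp (- A\<^sub>t) o\<^sub>t + \<integral>\<^sub>0\<^sup>t (\<zeta>\<^sub>t / \<zeta>\<^sub>s) o\<^sub>s a\<^sub>s ds\<close> (\<open>path_quotient_le\<close>). As \<open>o\<^sub>s a\<^sub>s\<close> is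
known at time \<open>s\<close>, the martingale property of \<open>\<zeta>\<close> removes the factor \<open>\<zeta>\<^sub>t / \<zeta>\<^sub>s\<close> under the expectation and
that of \<open>o\<close> replaces \<open>o\<^sub>s\<close> by \<open>o\<^sub>t\<close> (\<open>expectation_ratio_le\<close>). Since \<open>\<beta>\<close> has mass 1, what remains is
\<open>E o\<^sub>t = v\<close> (\<open>functional_le\<close>).

Two technical points shape the development. The rate along a path is merely bounded and measurable
in time, so the chain and product rules are proved for Lipschitz primitives of such functions
(\<open>primitive_of\<close>). And the product over the living particles splits at the first branching only if
finitely many particles are alive, which therefore has to be shown to hold almost surely
(\<open>no_explosion\<close>).
\<close>

section \<open>Primitives of bounded measurable functions\<close>

text \<open>The derivative relation used along paths: \<open>F\<close> is an integral of \<open>k\<close>. As \<open>k\<close> is only measurable and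
locally bounded, \<open>F\<close> is locally Lipschitz but possibly not differentiable, and calculus rules for
derivatives do not apply to it.\<close>

definition primitive_of :: "(real \<Rightarrow> real) \<Rightarrow> (real \<Rightarrow> real) \<Rightarrow> bool" where
  "primitive_of k F \<longleftrightarrow>
     k \<in> borel_measurable borel \<and>
     (\<forall>a b. \<exists>C. \<forall>r\<in>{a..b}. \<bar>k r\<bar> \<le> C) \<and>
     (\<forall>a b. a \<le> b \<longrightarrow> F b - F a = (LINT r:{a..b}|lborel. k r))"

lemma set_integrable_bounded_interval:
  fixes k :: "real \<Rightarrow> real"
  assumes "k \<in> borel_measurable borel" "\<And>r. r \<in> {a..b} \<Longrightarrow> \<bar>k r\<bar> \<le> C"
  shows "set_integrable lborel {a..b} k"
proof -
  have "integrable lborel (\<lambda>r. indicator {a..b} r * C)"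
    by (intro integrable_mult_left integrable_real_indicator) (auto simp: emeasure_lborel_Icc_eq)
  then show ?thesis
    unfolding set_integrable_def
    by (rule Bochner_Integration.integrable_bound)
       (use assms in \<open>auto simp: indicator_def split: if_splits intro!: AE_I2 intro: order_trans[OF _ abs_ge_self]\<close>)
qed

lemma abs_set_integral_le:
  fixes k :: "real \<Rightarrow> real"
  assumes "k \<in> borel_measurable borel" "\<And>r. r \<in> {a..b} \<Longrightarrow> \<bar>k r\<bar> \<le> C" "a \<le> b"
  shows "\<bar>LINT r:{a..b}|lborel. k r\<bar> \<le> C * (b - a)"
proof -
  have i: "set_integrable lborel {a..b} k"
    using assms by (intro set_integrable_bounded_interval)
  have C: "\<bar>k r\<bar> \<le> \<bar>C\<bar>" if "r \<in> {a..b}" for r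
    using assms(2)[OF that] by linarith
  have "\<bar>LINT r:{a..b}|lborel. k r\<bar> \<le> (LINT r:{a..b}|lborel. \<bar>k r\<bar>)"
    using set_integral_norm_bound[OF i] by simp
  also have "\<dots> \<le> (LINT r:{a..b}|lborel. C)"
    using assms i by (intro set_integral_mono set_integrable_abs set_integrable_bounded_interval[of _ _ _ "\<bar>C\<bar>"])
      (auto intro: C)
  also have "\<dots> = C * (b - a)"
    using assms by (simp add: set_lebesgue_integral_def)
  finally show ?thesis .
qed

lemma primitive_of_integrable: "primitive_of k F \<Longrightarrow> set_integrable lborel {a..b} k"
  unfolding primitive_of_def by (meson set_integrable_bounded_interval)

lemma primitive_of_measurable: "primitive_of k F \<Longrightarrow> k \<in> borel_measurable borel"
  unfolding primitive_of_def by simp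

lemma primitive_of_diff:
  "primitive_of k F \<Longrightarrow> a \<le> b \<Longrightarrow> F b - F a = (LINT r:{a..b}|lborel. k r)"
  unfolding primitive_of_def by simp

lemma primitive_of_lipschitz:
  assumes "primitive_of k F"
  obtains C where "0 \<le> C" "\<And>r. r \<in> {a..b} \<Longrightarrow> \<bar>k r\<bar> \<le> C"
    "\<And>x y. a \<le> x \<Longrightarrow> x \<le> y \<Longrightarrow> y \<le> b \<Longrightarrow> \<bar>F y - F x\<bar> \<le> C * (y - x)"
proof -
  obtain C where C: "\<And>r. r \<in> {a..b} \<Longrightarrow> \<bar>k r\<bar> \<le> C"
    using assms unfolding primitive_of_def by meson
  show ?thesis
  proof (rule that[of "max 0 C"])
    fix x y assume "a \<le> x" "x \<le> y" "y \<le> b"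
    then show "\<bar>F y - F x\<bar> \<le> max 0 C * (y - x)"
      using primitive_of_measurable[OF assms] C
      by (subst primitive_of_diff[OF assms]) (auto intro!: abs_set_integral_le simp: le_max_iff_disj)
  qed (use C in \<open>auto simp: le_max_iff_disj\<close>)
qed

lemma primitive_of_continuous:
  assumes "primitive_of k F"
  shows "continuous_on UNIV F"
proof (rule continuous_at_imp_continuous_on, safe)
  fix x
  obtain C where C: "0 \<le> C" "\<And>u v. x - 1 \<le> u \<Longrightarrow> u \<le> v \<Longrightarrow> v \<le> x + 1 \<Longrightarrow> \<bar>F v - F u\<bar> \<le> C * (v - u)"
    by (rule primitive_of_lipschitz[OF assms, of "x - 1" "x + 1"]) (rule that; assumption)
  have *: "\<bar>F y - F x\<bar> \<le> C * \<bar>y - x\<bar>" if y: "\<bar>y - x\<bar> \<le> 1" for y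
  proof (cases "x \<le> y")
    case True
    have "\<bar>F y - F x\<bar> \<le> C * (y - x)"
      by (rule C(2)) (use True y in linarith)+
    then show ?thesis using True by (simp only: abs_of_nonneg diff_ge_0_iff_ge)
  next
    case False
    have "\<bar>F x - F y\<bar> \<le> C * (x - y)" 
      by (rule C(2)) (use False y in linarith)+
    then show ?thesis using False by (simp only: abs_minus_commute[of _ x] abs_minus_commute[of "F y"] abs_of_nonneg diff_ge_0_iff_ge not_le less_imp_le)
  qed
  have "\<forall>\<^sub>F y in at x. norm (F y - F x) \<le> C * \<bar>y - x\<bar>"
    unfolding eventually_at
    by (intro exI[of _ 1] conjI ballI impI) (simp_all only: zero_less_one dist_real_def real_norm_def * less_imp_le)
  moreover have "((\<lambda>y. C * \<bar>y - x\<bar>) \<longlongrightarrow> C * \<bar>x - x\<bar>) (at x)"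
    by (intro tendsto_intros)
  then have "((\<lambda>y. C * \<bar>y - x\<bar>) \<longlongrightarrow> 0) (at x)"
    by simp
  ultimately have "((\<lambda>y. F y - F x) \<longlongrightarrow> 0) (at x)"
    by (rule Lim_null_comparison)
  then show "isCont F x"
    by (simp add: isCont_def LIM_zero_iff)
qed

lemma primitive_of_borel: "primitive_of k F \<Longrightarrow> F \<in> borel_measurable borel"
  by (intro borel_measurable_continuous_onI primitive_of_continuous)

lemma primitive_of_bounded:
  assumes "primitive_of k F"
  shows "\<exists>C\<ge>0. \<forall>r\<in>{a..b}. \<bar>F r\<bar> \<le> C"
proof -
  have "compact (F ` {a..b})"
    by (intro compact_continuous_image continuous_on_subset[OF primitive_of_continuous[OF assms]]) auto
  then obtain C where C: "\<forall>z\<in>F ` {a..b}. norm z \<le> C"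
    using compact_imp_bounded bounded_iff by metis
  show ?thesis
    by (rule exI[of _ "max 0 C"]) (use C in \<open>auto simp: le_max_iff_disj\<close>)
qed

text \<open>Increments of second order force a vanishing derivative.\<close>

lemma constant_if_quadratic_increments:
  fixes \<phi> :: "real \<Rightarrow> real"
  assumes q: "\<And>x y. a \<le> x \<Longrightarrow> x \<le> y \<Longrightarrow> y \<le> b \<Longrightarrow> \<bar>\<phi> y - \<phi> x\<bar> \<le> C * (y - x)\<^sup>2" and "a \<le> b"
  shows "\<phi> b = \<phi> a"
proof -
  have "\<exists>c. \<forall>x\<in>{a..b}. \<phi> x = c"
  proof (rule has_derivative_zero_constant)
    fix x assume x: "x \<in> {a..b}"
    have le: "norm (\<phi> y - \<phi> x) / norm (y - x) \<le> C * \<bar>y - x\<bar>" if "y \<in> {a..b}" "y \<noteq> x" for y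
      using q[of x y] q[of y x] x that
      by (cases "x \<le> y") (auto simp: divide_simps power2_eq_square abs_minus_commute mult_ac abs_if split: if_splits)
    have "((\<lambda>y. norm (\<phi> y - \<phi> x) / norm (y - x)) \<longlongrightarrow> 0) (at x within {a..b})"
    proof (rule tendsto_sandwich[OF _ _ tendsto_const])
      have "((\<lambda>y. C * \<bar>y - x\<bar>) \<longlongrightarrow> C * \<bar>x - x\<bar>) (at x within {a..b})"
        by (intro tendsto_intros)
      then show "((\<lambda>y. C * \<bar>y - x\<bar>) \<longlongrightarrow> 0) (at x within {a..b})"
        by simp
      show "\<forall>\<^sub>F y in at x within {a..b}. norm (\<phi> y - \<phi> x) / norm (y - x) \<le> C * \<bar>y - x\<bar>"
        using le by (auto simp: eventually_at_filter)
    qed auto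
    then show "(\<phi> has_derivative (\<lambda>h. 0)) (at x within {a..b})"
      by (simp add: has_derivative_iff_norm)
  qed simp
  then show ?thesis
    using \<open>a \<le> b\<close> by auto
qed

lemma set_integral_interval_split:
  fixes k :: "real \<Rightarrow> real"
  assumes "set_integrable lborel {a..c} k" "a \<le> b" "b \<le> c"
  shows "(LINT r:{a..c}|lborel. k r) = (LINT r:{a..b}|lborel. k r) + (LINT r:{b..c}|lborel. k r)"
proof -
  have "(LINT r:{a..c}|lborel. k r) = (LINT r:{a..b} \<union> {b..c}|lborel. k r)"
    using assms by (simp add: ivl_disj_un)
  also have "\<dots> = (LINT r:{a..b}|lborel. k r) + (LINT r:{b..c}|lborel. k r)"
  proof (rule set_integral_Un_AE)
    show "AE r in lborel. \<not> (r \<in> {a..b} \<and> r \<in> {b..c})"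
      using AE_lborel_singleton[of b] by eventually_elim auto
  qed (use assms in \<open>auto intro: set_integrable_subset\<close>)
  finally show ?thesis .
qed

text \<open>To recognize a primitive, a first-order expansion suffices, with an error that is quadratic in the
length of the interval: the function and the integral then differ by a function with quadratic
increments.\<close>

lemma primitive_ofI:
  assumes k: "k \<in> borel_measurable borel" "\<And>a b. \<exists>C. \<forall>r\<in>{a..b}. \<bar>k r\<bar> \<le> C"
    and q: "\<And>a b. \<exists>C. \<forall>x y. a \<le> x \<longrightarrow> x \<le> y \<longrightarrow> y \<le> b \<longrightarrow>
              \<bar>F y - F x - (LINT r:{x..y}|lborel. k r)\<bar> \<le> C * (y - x)\<^sup>2"
  shows "primitive_of k F"
  unfolding primitive_of_def
proof (intro conjI allI impI k)
  fix a b :: real assume ab: "a \<le> b"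
  obtain C where C: "\<And>x y. a \<le> x \<Longrightarrow> x \<le> y \<Longrightarrow> y \<le> b \<Longrightarrow>
              \<bar>F y - F x - (LINT r:{x..y}|lborel. k r)\<bar> \<le> C * (y - x)\<^sup>2"
    using q by meson
  have i: "set_integrable lborel {u..v} k" for u v
    using k by (meson set_integrable_bounded_interval)
  have "(F b - (LINT r:{a..b}|lborel. k r)) = F a - (LINT r:{a..a}|lborel. k r)"
  proof (rule constant_if_quadratic_increments[OF _ ab])
    fix x y assume "a \<le> x" "x \<le> y" "y \<le> b"
    then show "\<bar>(F y - (LINT r:{a..y}|lborel. k r)) - (F x - (LINT r:{a..x}|lborel. k r))\<bar> \<le> C * (y - x)\<^sup>2"
      using C[of x y] set_integral_interval_split[OF i, of a x y] by simp
  qed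
  moreover have "(LINT r:{a..a}|lborel. k r) = 0"
  proof -
    have "(LINT r:{a..a}|lborel. k r) = (LINT r:{}|lborel. k r)"
      unfolding set_lebesgue_integral_def
      using AE_lborel_singleton[of a] k by (intro integral_cong_AE) (auto elim: eventually_mono)
    then show ?thesis by (simp add: set_lebesgue_integral_def)
  qed
  ultimately show "F b - F a = (LINT r:{a..b}|lborel. k r)"
    by simp
qed

text \<open>The error of the first-order expansion of \<open>F G\<close> consists of products of two increments of Lipschitz
functions.\<close>

lemma primitive_of_mult:
  assumes F: "primitive_of k F" and G: "primitive_of l G"
  shows "primitive_of (\<lambda>r. k r * G r + F r * l r) (\<lambda>r. F r * G r)"
proof (rule primitive_ofI)
  note [measurable] = primitive_of_borel[OF F] primitive_of_borel[OF G]
    primitive_of_measurable[OF F] primitive_of_measurable[OF G]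
  show "(\<lambda>r. k r * G r + F r * l r) \<in> borel_measurable borel"
    by measurable
  fix a b :: real
  obtain C where C: "0 \<le> C" "\<And>r. r \<in> {a..b} \<Longrightarrow> \<bar>k r\<bar> \<le> C"
    "\<And>x y. a \<le> x \<Longrightarrow> x \<le> y \<Longrightarrow> y \<le> b \<Longrightarrow> \<bar>F y - F x\<bar> \<le> C * (y - x)"
    by (rule primitive_of_lipschitz[OF F, of a b]) (rule that; assumption)
  obtain D where D: "0 \<le> D" "\<And>r. r \<in> {a..b} \<Longrightarrow> \<bar>l r\<bar> \<le> D"
    "\<And>x y. a \<le> x \<Longrightarrow> x \<le> y \<Longrightarrow> y \<le> b \<Longrightarrow> \<bar>G y - G x\<bar> \<le> D * (y - x)"
    by (rule primitive_of_lipschitz[OF G, of a b]) (rule that; assumption)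
  obtain C' where C': "0 \<le> C'" "\<And>r. r \<in> {a..b} \<Longrightarrow> \<bar>F r\<bar> \<le> C'"
    using primitive_of_bounded[OF F] by blast
  obtain D' where D': "0 \<le> D'" "\<And>r. r \<in> {a..b} \<Longrightarrow> \<bar>G r\<bar> \<le> D'"
    using primitive_of_bounded[OF G] by blast
  have bd: "\<bar>k r * G r + F r * l r\<bar> \<le> C * D' + C' * D" if "r \<in> {a..b}" for r
    using C(1,2) D(1,2) C' D' that
    by (intro order_trans[OF abs_triangle_ineq] add_mono) (auto simp: abs_mult intro!: mult_mono)
  then show "\<exists>C. \<forall>r\<in>{a..b}. \<bar>k r * G r + F r * l r\<bar> \<le> C"
    by blast
  show "\<exists>C. \<forall>x y. a \<le> x \<longrightarrow> x \<le> y \<longrightarrow> y \<le> b \<longrightarrow>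
      \<bar>F y * G y - F x * G x - (LINT r:{x..y}|lborel. k r * G r + F r * l r)\<bar> \<le> C * (y - x)\<^sup>2"
  proof (intro exI allI impI)
    fix x y assume xy: "a \<le> x" "x \<le> y" "y \<le> b"
    define h where "h r = k r * (G r - G x) + (F r - F x) * l r" for r
    have hb: "\<bar>h r\<bar> \<le> 2 * C * D * (y - x)" if "r \<in> {x..y}" for r
    proof -
      have "\<bar>G r - G x\<bar> \<le> D * (y - x)" "\<bar>F r - F x\<bar> \<le> C * (y - x)"
        using that xy C(1) C(3)[of x r] D(1) D(3)[of x r] 
          mult_left_mono[of "r - x" "y - x" C] mult_left_mono[of "r - x" "y - x" D] by auto
      then have "\<bar>h r\<bar> \<le> C * (D * (y - x)) + C * (y - x) * D"
        unfolding h_def using C(1) C(2)[of r] D(1) D(2)[of r] xy that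
        by (intro order_trans[OF abs_triangle_ineq] add_mono) (auto simp: abs_mult intro!: mult_mono)
      then show ?thesis by (simp add: algebra_simps)
    qed
    have ik: "set_integrable lborel {x..y} k" "set_integrable lborel {x..y} l"
      "set_integrable lborel {x..y} (\<lambda>r. k r * G r + F r * l r)"
      by (auto intro!: primitive_of_integrable[OF F] primitive_of_integrable[OF G] set_integrable_bounded_interval[OF _ bd])
        (use xy in auto)
    have "(LINT r:{x..y}|lborel. h r) = (LINT r:{x..y}|lborel. (k r * G r + F r * l r) - (G x * k r + F x * l r))"
      by (simp add: h_def algebra_simps)
    also have "\<dots> = (LINT r:{x..y}|lborel. k r * G r + F r * l r) - (G x * (F y - F x) + F x * (G y - G x))"
      using ik xy by (simp add: primitive_of_diff[OF F] primitive_of_diff[OF G])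
    finally have eq: "F y * G y - F x * G x - (LINT r:{x..y}|lborel. k r * G r + F r * l r)
        = (F y - F x) * (G y - G x) - (LINT r:{x..y}|lborel. h r)"
      by (simp add: algebra_simps)
    have "\<bar>LINT r:{x..y}|lborel. h r\<bar> \<le> (2 * C * D * (y - x)) * (y - x)"
      by (intro abs_set_integral_le hb) (use xy in \<open>auto simp: h_def\<close>)
    moreover have "\<bar>(F y - F x) * (G y - G x)\<bar> \<le> (C * (y - x)) * (D * (y - x))"
      using C(1) C(3)[of x y] D(3)[of x y] xy by (auto simp: abs_mult intro!: mult_mono)
    ultimately have "\<bar>(F y - F x) * (G y - G x) - (LINT r:{x..y}|lborel. h r)\<bar> \<le> 
        (C * (y - x)) * (D * (y - x)) + (2 * C * D * (y - x)) * (y - x)"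
      by linarith
    then show "\<bar>F y * G y - F x * G x - (LINT r:{x..y}|lborel. k r * G r + F r * l r)\<bar> \<le> (3 * C * D) * (y - x)\<^sup>2"
      unfolding eq by (simp add: algebra_simps power2_eq_square)
  qed
qed

text \<open>Both follow from convexity: the graph of \<open>exp\<close> lies above its tangents at \<open>a\<close> and at \<open>b\<close>.\<close>

lemma exp_second_order_bounds:
  fixes a b :: real
  assumes "\<bar>a\<bar> \<le> B" "\<bar>b\<bar> \<le> B"
  shows "\<bar>exp b - exp a\<bar> \<le> exp B * \<bar>b - a\<bar>"
    and "\<bar>exp b - exp a - exp a * (b - a)\<bar> \<le> exp B * (b - a)\<^sup>2"
proof -
  have l: "exp a * (b - a) \<le> exp b - exp a" for a b :: real
  proof -
    have "exp a * (1 + (b - a)) \<le> exp a * exp (b - a)"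
      by (intro mult_left_mono exp_ge_add_one_self) auto
    then show ?thesis by (simp add: algebra_simps flip: exp_add)
  qed
  have e: "exp a \<le> exp B" "exp b \<le> exp B"
    using assms by auto
  have L: "exp b - exp a \<le> exp B * \<bar>b - a\<bar>" if "\<bar>a\<bar> \<le> B" "\<bar>b\<bar> \<le> B" for a b :: real
  proof -
    have "exp b - exp a \<le> exp b * (b - a)" using l[of b a] by (simp add: algebra_simps)
    also have "\<dots> \<le> exp b * \<bar>b - a\<bar>" by (intro mult_left_mono) auto
    also have "\<dots> \<le> exp B * \<bar>b - a\<bar>" using that by (intro mult_right_mono) auto
    finally show ?thesis .
  qed
  show le: "\<bar>exp b - exp a\<bar> \<le> exp B * \<bar>b - a\<bar>"
    using L[of a b] L[of b a] assms by (auto simp: abs_le_iff abs_minus_commute)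
  have "\<bar>exp b - exp a - exp a * (b - a)\<bar> \<le> (exp b - exp a) * (b - a)"
    using l[of a b] l[of b a] by (simp add: algebra_simps)
  also have "\<dots> \<le> \<bar>exp b - exp a\<bar> * \<bar>b - a\<bar>"
    by (metis abs_ge_self abs_mult)
  also have "\<dots> \<le> (exp B * \<bar>b - a\<bar>) * \<bar>b - a\<bar>"
    by (intro mult_right_mono le) auto
  finally show "\<bar>exp b - exp a - exp a * (b - a)\<bar> \<le> exp B * (b - a)\<^sup>2"
    by (simp add: power2_eq_square mult.assoc flip: abs_mult)
qed

lemma primitive_of_exp:
  assumes F: "primitive_of k F"
  shows "primitive_of (\<lambda>r. k r * exp (F r)) (\<lambda>r. exp (F r))"
proof (rule primitive_ofI)
  note [measurable] = primitive_of_borel[OF F] primitive_of_measurable[OF F] 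
  show "(\<lambda>r. k r * exp (F r)) \<in> borel_measurable borel"
    by measurable
  fix a b :: real
  obtain C where C: "0 \<le> C" "\<And>r. r \<in> {a..b} \<Longrightarrow> \<bar>k r\<bar> \<le> C"
    "\<And>x y. a \<le> x \<Longrightarrow> x \<le> y \<Longrightarrow> y \<le> b \<Longrightarrow> \<bar>F y - F x\<bar> \<le> C * (y - x)"
    by (rule primitive_of_lipschitz[OF F, of a b]) (rule that; assumption)
  obtain B where B: "0 \<le> B" "\<And>r. r \<in> {a..b} \<Longrightarrow> \<bar>F r\<bar> \<le> B"
    using primitive_of_bounded[OF F] by blast
  have bd: "\<bar>k r * exp (F r)\<bar> \<le> C * exp B" if "r \<in> {a..b}" for r
    using C(1) C(2)[OF that] B(2)[OF that] by (auto simp: abs_mult intro!: mult_mono)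
  then show "\<exists>C. \<forall>r\<in>{a..b}. \<bar>k r * exp (F r)\<bar> \<le> C"
    by blast
  show "\<exists>C. \<forall>x y. a \<le> x \<longrightarrow> x \<le> y \<longrightarrow> y \<le> b \<longrightarrow>
      \<bar>exp (F y) - exp (F x) - (LINT r:{x..y}|lborel. k r * exp (F r))\<bar> \<le> C * (y - x)\<^sup>2"
  proof (intro exI allI impI)
    fix x y assume xy: "a \<le> x" "x \<le> y" "y \<le> b"
    define h where "h r = k r * (exp (F r) - exp (F x))" for r
    have hb: "\<bar>h r\<bar> \<le> C * (exp B * (C * (y - x)))" if "r \<in> {x..y}" for r
    proof -
      have "\<bar>exp (F r) - exp (F x)\<bar> \<le> exp B * \<bar>F r - F x\<bar>"
        using that xy by (intro exp_second_order_bounds B) auto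
      also have "\<dots> \<le> exp B * (C * (y - x))"
        using that xy C(1) C(3)[of x r] mult_left_mono[of "r - x" "y - x" C] by auto
      finally show ?thesis
        unfolding h_def using C(1) C(2)[of r] that xy by (auto simp: abs_mult intro!: mult_mono)
    qed
    have ik: "set_integrable lborel {x..y} k" 
      "set_integrable lborel {x..y} (\<lambda>r. k r * exp (F r))"
      by (auto intro!: primitive_of_integrable[OF F] set_integrable_bounded_interval[OF _ bd])
        (use xy in auto)
    have "(LINT r:{x..y}|lborel. h r) = (LINT r:{x..y}|lborel. k r * exp (F r) - exp (F x) * k r)"
      by (simp add: h_def algebra_simps)
    also have "\<dots> = (LINT r:{x..y}|lborel. k r * exp (F r)) - exp (F x) * (F y - F x)"
      using ik xy by (simp add: primitive_of_diff[OF F])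
    finally have eq: "exp (F y) - exp (F x) - (LINT r:{x..y}|lborel. k r * exp (F r))
        = (exp (F y) - exp (F x) - exp (F x) * (F y - F x)) - (LINT r:{x..y}|lborel. h r)"
      by (simp add: algebra_simps)
    have "\<bar>LINT r:{x..y}|lborel. h r\<bar> \<le> (C * (exp B * (C * (y - x)))) * (y - x)"
      by (intro abs_set_integral_le hb) (use xy in \<open>auto simp: h_def\<close>)
    moreover have "\<bar>exp (F y) - exp (F x) - exp (F x) * (F y - F x)\<bar> \<le> exp B * (C * (y - x))\<^sup>2"
    proof -
      have "\<bar>exp (F y) - exp (F x) - exp (F x) * (F y - F x)\<bar> \<le> exp B * (F y - F x)\<^sup>2"
        using xy by (intro exp_second_order_bounds B) auto
      also have "(F y - F x)\<^sup>2 \<le> (C * (y - x))\<^sup>2"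
        using C(3)[of x y] xy by (metis abs_ge_zero power2_abs power_mono)
      finally show ?thesis by simp
    qed
    ultimately have "\<bar>(exp (F y) - exp (F x) - exp (F x) * (F y - F x)) - (LINT r:{x..y}|lborel. h r)\<bar> \<le> 
        exp B * (C * (y - x))\<^sup>2 + (C * (exp B * (C * (y - x)))) * (y - x)"
      by linarith
    then show "\<bar>exp (F y) - exp (F x) - (LINT r:{x..y}|lborel. k r * exp (F r))\<bar> \<le> (2 * C\<^sup>2 * exp B) * (y - x)\<^sup>2"
      unfolding eq by (simp add: algebra_simps power2_eq_square)
  qed
qed

lemma primitive_of_integral_from_0:
  fixes k :: "real \<Rightarrow> real"
  assumes k: "k \<in> borel_measurable borel" "\<And>r. 0 \<le> r \<Longrightarrow> \<bar>k r\<bar> \<le> C" "\<And>r. r < 0 \<Longrightarrow> k r = 0"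
  shows "primitive_of k (\<lambda>s. LINT r:{0..s}|lborel. k r)"
  unfolding primitive_of_def
proof (intro conjI allI impI k(1))
  have C: "\<bar>k r\<bar> \<le> \<bar>C\<bar>" for r
    using k(2)[of r] k(3)[of r] by (cases "r < 0") auto
  then show "\<exists>C. \<forall>r\<in>{a..b}. \<bar>k r\<bar> \<le> C" for a b
    by blast
  fix a b :: real assume ab: "a \<le> b"
  have i: "set_integrable lborel {u..v} k" for u v
    using k(1) C by (intro set_integrable_bounded_interval)
  have e: "(LINT r:{0..s}|lborel. k r) = (LINT r:{min 0 a..s}|lborel. k r)" for s
    unfolding set_lebesgue_integral_def
    by (rule Bochner_Integration.integral_cong) (auto simp: indicator_def k(3))
  show "(LINT r:{0..b}|lborel. k r) - (LINT r:{0..a}|lborel. k r) = (LINT r:{a..b}|lborel. k r)"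
    unfolding e using set_integral_interval_split[OF i, of "min 0 a" a b] ab by simp
qed

lemma primitive_of_const: "primitive_of (\<lambda>_. 0) (\<lambda>_. c)"
  by (auto simp: primitive_of_def set_lebesgue_integral_def)

lemma primitive_of_add:
  assumes F: "primitive_of k F" and G: "primitive_of l G"
  shows "primitive_of (\<lambda>r. k r + l r) (\<lambda>r. F r + G r)"
  unfolding primitive_of_def
proof (intro conjI allI impI)
  note [measurable] = primitive_of_measurable[OF F] primitive_of_measurable[OF G]
  show "(\<lambda>r. k r + l r) \<in> borel_measurable borel" by measurable
  fix a b :: real
  obtain C where C: "\<And>r. r \<in> {a..b} \<Longrightarrow> \<bar>k r\<bar> \<le> C"
    using F unfolding primitive_of_def by meson
  obtain D where D: "\<And>r. r \<in> {a..b} \<Longrightarrow> \<bar>l r\<bar> \<le> D"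
    using G unfolding primitive_of_def by meson
  show "\<exists>C. \<forall>r\<in>{a..b}. \<bar>k r + l r\<bar> \<le> C"
    using C D by (intro exI[of _ "C + D"]) (fastforce intro: order_trans[OF abs_triangle_ineq] add_mono)
  assume "a \<le> b"
  then show "F b + G b - (F a + G a) = (LINT r:{a..b}|lborel. k r + l r)"
    using primitive_of_diff[OF F, of a b] primitive_of_diff[OF G, of a b]
      primitive_of_integrable[OF F, of a b] primitive_of_integrable[OF G, of a b] by simp
qed

lemma primitive_of_cmult:
  assumes F: "primitive_of k F"
  shows "primitive_of (\<lambda>r. c * k r) (\<lambda>r. c * F r)"
  using primitive_of_mult[OF primitive_of_const[of c] F] by simp

section \<open>Path space and integrals along paths\<close>

text \<open>Progressive measurability. The process at the next point of the grid of mesh \<open>1 / Suc n\<close>, stopped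
at \<open>s\<close>, takes countably many values of the time index, uses no information later than \<open>s\<close>, and converges
by right-continuity. Times outside \<open>[0,s]\<close> are moved to its end points, so that the map is defined for
all real times.\<close>

lemma measurable_right_continuous_process:
  fixes X :: "real \<Rightarrow> 'w \<Rightarrow> 'a::metric_space"
  assumes X[measurable]: "\<And>r. 0 \<le> r \<Longrightarrow> r \<le> s \<Longrightarrow> X r \<in> borel_measurable F"
    and rc: "\<And>r w. 0 \<le> r \<Longrightarrow> r < s \<Longrightarrow> w \<in> space F \<Longrightarrow> ((\<lambda>q. X q w) \<longlongrightarrow> X r w) (at_right r)"
    and "0 \<le> s"
  shows "(\<lambda>(r, w). X (max 0 (min s r)) w) \<in> borel_measurable (borel \<Otimes>\<^sub>M F)"
proof -
  \<comment> \<open>The grid point strictly after \<open>r\<close>: right-continuity concerns limits along later times only.\<close>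
  define d where "d n r = (of_int \<lfloor>r * Suc n\<rfloor> + 1) / real (Suc n)" for n and r :: real
  have d: "r < d n r" "d n r \<le> r + 1 / Suc n" for n r
  proof -
    have "r * Suc n < of_int \<lfloor>r * Suc n\<rfloor> + 1" "of_int \<lfloor>r * Suc n\<rfloor> \<le> r * Suc n"
      by linarith+
    moreover have "(r + 1 / Suc n) * Suc n = r * Suc n + 1"
      by (simp add: distrib_right)
    ultimately show "r < d n r" "d n r \<le> r + 1 / Suc n"
      unfolding d_def by (simp_all only: pos_less_divide_eq pos_divide_le_eq of_nat_0_less_iff zero_less_Suc add_le_cancel_right)
  qed
  have lim: "(\<lambda>n. d n r) \<longlonglongrightarrow> r" for r
  proof (rule tendsto_sandwich)
    show "\<forall>\<^sub>F n in sequentially. r \<le> d n r" "\<forall>\<^sub>F n in sequentially. d n r \<le> r + 1 / Suc n"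
      using d[where r=r] by (auto intro!: always_eventually less_imp_le)
    show "(\<lambda>n. r + 1 / Suc n) \<longlonglongrightarrow> r"
      using LIMSEQ_inverse_real_of_nat_add[of r] by (simp add: inverse_eq_divide)
  qed auto
  show ?thesis
  proof (rule borel_measurable_LIMSEQ_metric)
    fix n
    have "(\<lambda>z. (\<lambda>i z. X (max 0 (min s ((of_int i + 1) / real (Suc n)))) (snd z)) \<lfloor>fst z * real (Suc n)\<rfloor> z) \<in> borel_measurable (borel \<Otimes>\<^sub>M F)"
    proof (rule measurable_compose_countable[where g="\<lambda>z::real \<times> 'w. \<lfloor>fst z * real (Suc n)\<rfloor>"
          and f="\<lambda>i z. X (max 0 (min s ((of_int i + 1) / real (Suc n)))) (snd z)"])
      fix i :: int
      show "(\<lambda>z. X (max 0 (min s ((of_int i + 1) / real (Suc n)))) (snd z)) \<in> borel_measurable (borel \<Otimes>\<^sub>M F)"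
        using \<open>0 \<le> s\<close> by (rule_tac measurable_compose[OF measurable_snd], intro X) auto
      show "(\<lambda>z::real \<times> 'w. \<lfloor>fst z * real (Suc n)\<rfloor>) \<in> borel \<Otimes>\<^sub>M F \<rightarrow>\<^sub>M count_space UNIV"
        by (rule measurable_compose[OF _ measurable_real_floor]) simp
    qed
    then show "(\<lambda>(r, w). X (max 0 (min s (d n r))) w) \<in> borel_measurable (borel \<Otimes>\<^sub>M F)"
      by (simp add: d_def case_prod_beta')
  next
    fix z :: "real \<times> 'w" assume "z \<in> space (borel \<Otimes>\<^sub>M F)"
    then obtain r w where z: "z = (r, w)" and w: "w \<in> space F"
      by (auto simp: space_pair_measure)
    consider "r < 0" | "s \<le> r" | "0 \<le> r" "r < s" by linarith
    then have "(\<lambda>n. X (max 0 (min s (d n r))) w) \<longlonglongrightarrow> X (max 0 (min s r)) w"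
    proof cases
      case 1
      then have "\<forall>\<^sub>F n in sequentially. d n r < 0"
        using order_tendstoD(2)[OF lim] by auto
      then have "\<forall>\<^sub>F n in sequentially. X (max 0 (min s (d n r))) w = X (max 0 (min s r)) w"
        by eventually_elim (use 1 in \<open>auto simp: max_def min_def\<close>)
      then show ?thesis
        by (rule tendsto_eventually)
    next
      case 2
      then have "min s (d n r) = s" "min s r = s" for n
        using d(1)[of r n] by auto
      then show ?thesis by simp
    next
      case 3
      have "\<forall>\<^sub>F n in sequentially. d n r < s"
        using order_tendstoD(2)[OF lim] 3 by auto
      then have "\<forall>\<^sub>F n in sequentially. X (d n r) w = X (max 0 (min s (d n r))) w"
      proof eventually_elim
        case (elim n)
        then have "0 \<le> d n r" "min s (d n r) = d n r"
          using 3 d(1)[of r n] by linarith+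
        then show ?case by simp
      qed
      moreover have "filterlim (\<lambda>n. d n r) (at_right r) sequentially"
        unfolding filterlim_at using lim d(1)[of r] by (auto intro!: always_eventually simp: less_imp_neq[THEN not_sym])
      then have "(\<lambda>n. X (d n r) w) \<longlonglongrightarrow> X r w"
        by (rule filterlim_compose[OF rc[OF 3 w]])
      ultimately have "(\<lambda>n. X (max 0 (min s (d n r))) w) \<longlonglongrightarrow> X r w"
        by (rule Lim_transform_eventually[rotated])
      then show ?thesis using 3 by simp
    qed
    then show "(\<lambda>n. case z of (r, w) \<Rightarrow> X (max 0 (min s (d n r))) w) \<longlonglongrightarrow> (case z of (r, w) \<Rightarrow> X (max 0 (min s r)) w)"
      by (simp add: z)
  qed
qed

lemma path_spaceD:
  "w \<in> space path_space \<Longrightarrow> 0 \<le> t \<Longrightarrow> (w \<longlongrightarrow> w t) (at_right t)"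
  by (auto simp: path_space_def space_restrict_space continuous_within)

lemma measurable_path_eval[measurable]: "0 \<le> s \<Longrightarrow> (\<lambda>w. w s) \<in> borel_measurable path_space"
  unfolding path_space_def
  by (intro measurable_restrict_space1 measurable_component_singleton) auto

lemma space_path_filtration[simp]: "space (path_filtration s) = space path_space"
  unfolding natural_filtration_def by (rule space_measure_of) auto

lemma space_natural_filtration: "space (natural_filtration M X s) = space M"
  unfolding natural_filtration_def by (rule space_measure_of) auto

lemma sets_natural_filtration:
  "sets (natural_filtration M X s) =
    sigma_sets (space M) {X r -` A \<inter> space M | r A. 0 \<le> r \<and> ennreal r \<le> s \<and> A \<in> sets borel}"
  unfolding natural_filtration_def by (rule sets_measure_of) auto

lemma measurable_natural_filtration:
  fixes X :: "real \<Rightarrow> 'w \<Rightarrow> 'a::topological_space"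
  assumes "0 \<le> r" "r \<le> s"
  shows "X r \<in> borel_measurable (natural_filtration M X (ennreal s))"
proof (rule measurableI)
  fix A :: "'a set" assume "A \<in> sets borel"
  then show "X r -` A \<inter> space (natural_filtration M X (ennreal s)) \<in> sets (natural_filtration M X (ennreal s))"
    unfolding sets_natural_filtration space_natural_filtration using assms
    by (intro sigma_sets.Basic) (auto intro!: exI[of _ r] exI[of _ A] ennreal_leI)
qed auto

lemma sets_natural_filtration_subset:
  assumes "\<And>r. 0 \<le> r \<Longrightarrow> X r \<in> borel_measurable M"
  shows "sets (natural_filtration M X s) \<subseteq> sets M"
  unfolding sets_natural_filtration by (rule sets.sigma_sets_subset) (use assms in \<open>auto dest: measurable_sets\<close>)

lemma sets_natural_filtration_mono:
  assumes "s \<le> t"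
  shows "sets (natural_filtration M X s) \<subseteq> sets (natural_filtration M X t)"
  unfolding sets_natural_filtration by (rule sigma_sets_mono') (use assms in \<open>force intro: order_trans\<close>)

lemma subalgebra_natural_filtration:
  assumes "\<And>r. 0 \<le> r \<Longrightarrow> X r \<in> borel_measurable M"
  shows "subalgebra M (natural_filtration M X s)"
  using sets_natural_filtration_subset[OF assms] by (auto simp: subalgebra_def space_natural_filtration)

lemma measurable_path_eval_progressive:
  assumes "0 \<le> s"
  shows "(\<lambda>(r, w). w (max 0 (min s r))) \<in> borel_measurable (borel \<Otimes>\<^sub>M (path_filtration (ennreal s) :: 'a::polish_space path measure))"
  by (rule measurable_right_continuous_process[where X="\<lambda>s w. w s"])
     (use assms in \<open>auto intro: path_spaceD measurable_natural_filtration[where X="\<lambda>s w. w s"]\<close>)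

lemma measurable_path_eval_joint:
  "(\<lambda>(r, w). w (max 0 r)) \<in> borel_measurable (borel \<Otimes>\<^sub>M (path_space :: 'a::polish_space path measure))"
proof (rule borel_measurable_LIMSEQ_metric)
  show "(\<lambda>(r, w). w (max 0 (min (real n) r))) \<in> borel_measurable (borel \<Otimes>\<^sub>M (path_space :: 'a path measure))" for n
    by (rule measurable_right_continuous_process[where X="\<lambda>s w. w s"])
      (auto intro: path_spaceD simp del: space_path_filtration)
  fix z :: "real \<times> 'a path"
  have "\<forall>\<^sub>F n in sequentially. fst z \<le> real n"
    using filterlim_real_sequentially unfolding filterlim_at_top by blast
  then have "\<forall>\<^sub>F n in sequentially. (case z of (r, w) \<Rightarrow> w (max 0 (min (real n) r))) = (case z of (r, w) \<Rightarrow> w (max 0 r))"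
    by eventually_elim (auto simp: min_def split: prod.split)
  then show "(\<lambda>n. case z of (r, w) \<Rightarrow> w (max 0 (min (real n) r))) \<longlonglongrightarrow> (case z of (r, w) \<Rightarrow> w (max 0 r))"
    by (rule tendsto_eventually)
qed

lemma measurable_path_eval_compose:
  assumes "f \<in> borel_measurable M" "g \<in> M \<rightarrow>\<^sub>M (path_space :: 'a::polish_space path measure)"
  shows "(\<lambda>x. g x (max 0 (f x))) \<in> borel_measurable M"
  by (rule measurable_Pair_compose_split[OF measurable_path_eval_joint assms])

definition path_integral :: "(real \<Rightarrow> 'a \<Rightarrow> real) \<Rightarrow> 'a path \<Rightarrow> real \<Rightarrow> real" where
  "path_integral h w t = (LINT r:{0..t}|lborel. h r (w r))"

lemma path_integral_alt:
  "path_integral h w t = (LINT r|lborel. indicator {0..t} r * h r (w (max 0 r)))"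
  unfolding path_integral_def set_lebesgue_integral_def
  by (rule Bochner_Integration.integral_cong) (auto simp: indicator_def)

lemma measurable_path_integral:
  fixes h :: "real \<Rightarrow> 'a::polish_space \<Rightarrow> real"
  assumes h: "case_prod h \<in> borel_measurable (borel \<Otimes>\<^sub>M borel)"
    and f[measurable]: "f \<in> borel_measurable M" and g[measurable]: "g \<in> M \<rightarrow>\<^sub>M path_space"
  shows "(\<lambda>x. path_integral h (g x) (f x)) \<in> borel_measurable M"
proof -
  have [measurable]: "(\<lambda>z. g (fst z) (max 0 (snd z))) \<in> borel_measurable (M \<Otimes>\<^sub>M lborel)"
    by (rule measurable_path_eval_compose) measurable
  have [measurable]: "(\<lambda>z. h (snd z) (g (fst z) (max 0 (snd z)))) \<in> borel_measurable (M \<Otimes>\<^sub>M lborel)"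
    by (rule measurable_Pair_compose_split[OF h]) measurable
  have [measurable]: "Measurable.pred (M \<Otimes>\<^sub>M lborel) (\<lambda>z. snd z \<in> {0..f (fst z)})"
    by simp
  show ?thesis
    unfolding path_integral_alt
    by (intro lborel.borel_measurable_lebesgue_integral) (simp add: case_prod_beta')
qed

text \<open>The integral up to time \<open>s\<close> only sees the path up to time \<open>s\<close>, where evaluation is progressively
measurable.\<close>

lemma measurable_path_integral_adapted:
  fixes h :: "real \<Rightarrow> 'a::polish_space \<Rightarrow> real"
  assumes h: "case_prod h \<in> borel_measurable (borel \<Otimes>\<^sub>M borel)" and "0 \<le> s"
  shows "(\<lambda>w. path_integral h w s) \<in> borel_measurable (path_filtration (ennreal s))"
proof -
  let ?F = "path_filtration (ennreal s) :: 'a path measure"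
  have [measurable]: "(\<lambda>z. (fst z) (max 0 (min s (snd z)))) \<in> borel_measurable (?F \<Otimes>\<^sub>M lborel)"
    by (rule measurable_Pair_compose_split[OF measurable_path_eval_progressive[OF \<open>0 \<le> s\<close>]]) measurable
  have [measurable]: "(\<lambda>z. h (snd z) ((fst z) (max 0 (min s (snd z))))) \<in> borel_measurable (?F \<Otimes>\<^sub>M lborel)"
    by (rule measurable_Pair_compose_split[OF h]) measurable
  have eq: "path_integral h w s = (LINT r|lborel. indicator {0..s} r * h r (w (max 0 (min s r))))" for w
    unfolding path_integral_alt by (rule Bochner_Integration.integral_cong) (auto simp: indicator_def)
  show ?thesis
    unfolding eq
    by (intro lborel.borel_measurable_lebesgue_integral) (simp add: case_prod_beta')
qed

lemma measurable_path_integrand: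
  fixes h :: "real \<Rightarrow> 'a::polish_space \<Rightarrow> real"
  assumes h: "case_prod h \<in> borel_measurable (borel \<Otimes>\<^sub>M borel)" and w: "w \<in> space path_space"
  shows "(\<lambda>r. h r (w (max 0 r))) \<in> borel_measurable borel"
proof -
  have "(\<lambda>r. w (max 0 r)) \<in> borel_measurable borel"
    using measurable_path_eval_compose[of "\<lambda>r. r" borel "\<lambda>_. w"] w by simp
  then show ?thesis
    by (rule measurable_Pair_compose_split[OF h measurable_ident_sets[OF refl]])
qed

lemma primitive_of_path_integral:
  fixes h :: "real \<Rightarrow> 'a::polish_space \<Rightarrow> real"
  assumes h: "case_prod h \<in> borel_measurable (borel \<Otimes>\<^sub>M borel)" "\<And>r x. 0 \<le> r \<Longrightarrow> \<bar>h r x\<bar> \<le> C"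
    and w: "w \<in> space path_space"
  shows "primitive_of (\<lambda>r. if r < 0 then 0 else h r (w (max 0 r))) (path_integral h w)"
proof -
  note [measurable] = measurable_path_integrand[OF h(1) w]
  have "path_integral h w = (\<lambda>s. LINT r:{0..s}|lborel. if r < 0 then 0 else h r (w (max 0 r)))"
    unfolding path_integral_def set_lebesgue_integral_def
    by (intro ext Bochner_Integration.integral_cong) (auto simp: indicator_def)
  then show ?thesis
    using h(2) by (auto intro!: primitive_of_integral_from_0[where C=C])
qed

lemma path_integral_nonneg: "(\<And>r. 0 \<le> r \<Longrightarrow> r \<le> t \<Longrightarrow> 0 \<le> h r (w r)) \<Longrightarrow> 0 \<le> path_integral h w t"
  unfolding path_integral_def set_lebesgue_integral_def
  by (intro Bochner_Integration.integral_nonneg) (auto simp: indicator_def)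

lemma shift_apply: "0 \<le> r \<Longrightarrow> shift s w r = w (s + r)"
  by (simp add: shift_def)

lemma measurable_shift[measurable]:
  assumes "0 \<le> s"
  shows "shift s \<in> path_space \<rightarrow>\<^sub>M (path_space :: 'a::polish_space path measure)"
proof -
  have "shift s \<in> path_space \<rightarrow>\<^sub>M PiM {0..} (\<lambda>_. borel :: 'a measure)"
    unfolding shift_def using assms by (intro measurable_restrict measurable_path_eval) auto
  moreover have "continuous (at_right t) (shift s w)" if w: "w \<in> space path_space" and t: "0 \<le> t" for w :: "'a path" and t
  proof -
    have "filterlim (\<lambda>q. s + q) (at_right (s + t)) (at_right t)"
      unfolding filterlim_at by (auto intro!: tendsto_intros eventually_at_right_less simp: eventually_at_filter)
    then have "((\<lambda>q. w (s + q)) \<longlongrightarrow> w (s + t)) (at_right t)"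
      using path_spaceD[OF w, of "s + t"] assms t by (auto intro: filterlim_compose)
    moreover have "\<forall>\<^sub>F q in at_right t. w (s + q) = shift s w q"
      using t by (auto simp: eventually_at_filter shift_apply)
    ultimately have "(shift s w \<longlongrightarrow> w (s + t)) (at_right t)"
      by (rule Lim_transform_eventually)
    then show ?thesis
      using t by (simp add: continuous_within shift_apply)
  qed
  ultimately show ?thesis
    unfolding path_space_def by (intro measurable_restrict_space2) (auto simp: path_space_def)
qed

lemma set_integral_translate:
  fixes k :: "real \<Rightarrow> real"
  shows "(LINT r:{a..b}|lborel. k (s + r)) = (LINT r:{s + a..s + b}|lborel. k r)"
  unfolding set_lebesgue_integral_def
  by (subst lborel_integral_real_affine[where c=1 and t=s and f="\<lambda>r. indicator {s + a..s + b} r *\<^sub>R k r"])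
     (auto simp: indicator_def intro!: Bochner_Integration.integral_cong)

lemma path_integral_shift:
  assumes "0 \<le> s"
  shows "path_integral h (shift s w) u = (LINT r:{s..s + u}|lborel. h (r - s) (w r))"
proof -
  have "path_integral h (shift s w) u = (LINT r:{0..u}|lborel. h ((s + r) - s) (w (s + r)))"
    unfolding path_integral_def by (rule set_lebesgue_integral_cong) (auto simp: shift_apply)
  then show ?thesis
    using set_integral_translate[of 0 u "\<lambda>r. h (r - s) (w r)" s] by simp
qed

section \<open>The joint law of path and lifetime\<close>

abbreviation hazard :: "('a \<Rightarrow> real) \<Rightarrow> 'a path \<Rightarrow> real \<Rightarrow> real" where
  "hazard lam \<equiv> path_integral (\<lambda>_. lam)"

abbreviation lifetime_density :: "('a \<Rightarrow> real) \<Rightarrow> 'a path \<Rightarrow> real \<Rightarrow> real" where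
  "lifetime_density lam w s \<equiv> lam (w (max 0 s)) * exp (- hazard lam w s)"

lemma path_integral_0: "path_integral h w 0 = 0"
  unfolding path_integral_def set_lebesgue_integral_def
proof (rule integral_eq_zero_AE)
  show "AE r in lborel. indicator {0..0} r *\<^sub>R h r (w r) = 0"
    using AE_lborel_singleton[of "0::real"] by eventually_elim (simp add: indicator_def)
qed

text \<open>Given the path, the lifetime has density \<open>lifetime_density\<close>: the chain rule for \<open>exp (- hazard)\<close>.\<close>

lemma nn_integral_hazard_density:
  fixes lam :: "'a::polish_space \<Rightarrow> real"
  assumes lam: "lam \<in> borel_measurable borel" "\<And>x. 0 \<le> lam x" "\<And>x. lam x \<le> C"
    and w: "w \<in> space path_space" and u: "0 \<le> u"
  shows "(\<integral>\<^sup>+r. indicator {0..u} r * ennreal (lifetime_density lam w r) \<partial>lborel)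
    = ennreal (1 - exp (- hazard lam w u))"
proof -
  let ?k = "\<lambda>r. if r < 0 then 0 else lam (w (max 0 r))"
  have m: "case_prod (\<lambda>_::real. lam) \<in> borel_measurable (borel \<Otimes>\<^sub>M borel)"
    using lam(1) by (simp add: case_prod_beta')
  have "primitive_of ?k (hazard lam w)"
    by (rule primitive_of_path_integral[OF m _ w, of C]) (use lam in auto)
  from primitive_of_exp[OF primitive_of_cmult[OF this, of "-1"]]
  have p: "primitive_of (\<lambda>r. - ?k r * exp (- hazard lam w r)) (\<lambda>r. exp (- hazard lam w r))"
    by simp
  have i: "integrable lborel (\<lambda>r. indicator {0..u} r * lifetime_density lam w r)"
  proof -
    have "integrable lborel (\<lambda>r. - (indicator {0..u} r *\<^sub>R (- ?k r * exp (- hazard lam w r))))"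
      using primitive_of_integrable[OF p, of 0 u] unfolding set_integrable_def by (rule integrable_minus)
    also have "(\<lambda>r. - (indicator {0..u} r *\<^sub>R (- ?k r * exp (- hazard lam w r)))) =
       (\<lambda>r. indicator {0..u} r * lifetime_density lam w r)"
      by (auto simp: indicator_def)
    finally show ?thesis .
  qed
  have "exp (- hazard lam w u) - exp (- hazard lam w 0) = (LINT r:{0..u}|lborel. - ?k r * exp (- hazard lam w r))"
    by (rule primitive_of_diff[OF p u])
  also have "\<dots> = - (LINT r|lborel. indicator {0..u} r * lifetime_density lam w r)"
    unfolding set_lebesgue_integral_def
    by (subst Bochner_Integration.integral_minus[symmetric], rule Bochner_Integration.integral_cong) (auto simp: indicator_def)
  also have "hazard lam w 0 = 0"
    by (rule path_integral_0)
  finally have eq: "(LINT r|lborel. indicator {0..u} r * lifetime_density lam w r) = 1 - exp (- hazard lam w u)"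
    by simp
  have "(\<integral>\<^sup>+r. indicator {0..u} r * ennreal (lifetime_density lam w r) \<partial>lborel) =
     (\<integral>\<^sup>+r. ennreal (indicator {0..u} r * lifetime_density lam w r) \<partial>lborel)"
    by (intro nn_integral_cong) (auto simp: indicator_def)
  also have "\<dots> = ennreal (1 - exp (- hazard lam w u))"
    unfolding eq[symmetric] using lam by (intro nn_integral_eq_integral i) (auto simp: indicator_def)
  finally show ?thesis .
qed

lemma measurable_particle[measurable]:
  "path_of \<in> particle_space \<rightarrow>\<^sub>M path_space"
  "lifetime \<in> borel_measurable particle_space"
  "offspring \<in> particle_space \<rightarrow>\<^sub>M count_space UNIV"
  unfolding particle_space_def by measurable

lemma prob_space_kernel:
  assumes "K \<in> borel \<rightarrow>\<^sub>M prob_algebra N"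
  shows "prob_space (K x)" "sets (K x) = sets N" "space (K x) = space N"
proof -
  have "K x \<in> space (prob_algebra N)"
    by (rule measurable_space[OF assms]) simp
  then have *: "sets (K x) = sets N" "prob_space (K x)"
    by (simp_all add: space_prob_algebra)
  show "prob_space (K x)" "sets (K x) = sets N" "space (K x) = space N"
    by (fact *)+ (rule sets_eq_imp_space_eq[OF *(1)])
qed

lemma measurable_kernel:
  "K \<in> borel \<rightarrow>\<^sub>M prob_algebra N \<Longrightarrow> measurable (K x) L = measurable N L"
  by (rule measurable_cong_sets[OF prob_space_kernel(2) refl])

locale branching_particle =
  fixes P :: "'a::polish_space \<Rightarrow> 'a path measure"
    and lam :: "'a \<Rightarrow> real"
    and C :: real
    and K :: "'a \<Rightarrow> 'a particle measure"
  assumes P: "P \<in> borel \<rightarrow>\<^sub>M prob_algebra path_space"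
    and lam_measurable[measurable]: "lam \<in> borel_measurable borel"
    and lam_nonneg: "\<And>x. 0 \<le> lam x" and lam_le: "\<And>x. lam x \<le> C"
    and particle_law: "particle_law P lam K"
begin

lemma K: "K \<in> borel \<rightarrow>\<^sub>M prob_algebra particle_space"
  using particle_law by (simp add: particle_law_def)

lemma lam_joint_measurable: "case_prod (\<lambda>_::real. lam) \<in> borel_measurable (borel \<Otimes>\<^sub>M borel)"
  by (simp add: case_prod_beta')

lemma measurable_hazard[measurable (raw)]:
  "f \<in> borel_measurable M \<Longrightarrow> g \<in> M \<rightarrow>\<^sub>M path_space \<Longrightarrow> (\<lambda>x. hazard lam (g x) (f x)) \<in> borel_measurable M"
  by (rule measurable_path_integral[OF lam_joint_measurable])

lemma hazard_nonneg: "0 \<le> hazard lam w t"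
  by (rule path_integral_nonneg) (rule lam_nonneg)

lemma distr_path: "distr (K x) path_space path_of = P x"
  using particle_law by (simp add: particle_law_def)

text \<open>The conditional survival probability integrated over an event of the path.\<close>

lemma measure_path_and_survival:
  assumes B: "B \<in> sets path_space" and u: "0 \<le> u"
  shows "emeasure (K x) {m \<in> space particle_space. path_of m \<in> B \<and> ennreal u < lifetime m}
     = (\<integral>\<^sup>+w. indicator B w * ennreal (exp (- hazard lam w u)) \<partial>P x)"
proof -
  interpret K: prob_space "K x" by (rule prob_space_kernel[OF K])
  note [measurable_cong] = prob_space_kernel(2)[OF K]
  note sp = prob_space_kernel(3)[OF K]
  let ?F = "vimage_algebra (space particle_space) path_of (path_space :: 'a path measure)"
  have pr: "path_of \<in> space particle_space \<rightarrow> (space path_space :: 'a path set)"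
    using measurable_space[OF measurable_particle(1)] by auto
  have sub: "subalgebra (K x) ?F"
    unfolding subalgebra_def sets_vimage_algebra2[OF pr] 
    using measurable_sets[OF measurable_particle(1)] prob_space_kernel[OF K, of x] by (auto simp: sp)
  interpret finite_measure_subalgebra "K x" ?F
    using sub by unfold_locales
  let ?S = "{m \<in> space particle_space. ennreal u < lifetime m}"
  have [measurable]: "?S \<in> sets (K x)"
    unfolding prob_space_kernel(2)[OF K] by measurable
  let ?A = "path_of -` B \<inter> space particle_space"
  have AF: "?A \<in> sets ?F"
    unfolding sets_vimage_algebra2[OF pr] using B by auto
  have [measurable]: "?A \<in> sets (K x)"
    using sub AF by (auto simp: subalgebra_def)
  have ce: "AE m in K x. real_cond_exp (K x) ?F (indicator ?S) m = exp (- hazard lam (path_of m) u)"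
    using particle_law u unfolding particle_law_def path_integral_def by blast
  have "measure (K x) (?A \<inter> ?S) = (LINT m:?A|K x. indicator ?S m)"
    by (simp add: set_lebesgue_integral_def indicator_inter_arith[symmetric])
  also have "\<dots> = (LINT m:?A|K x. real_cond_exp (K x) ?F (indicator ?S) m)"
    by (intro real_cond_exp_intA AF K.integrable_const_bound[where B=1]) auto
  also have "\<dots> = (LINT m|K x. indicator B (path_of m) * exp (- hazard lam (path_of m) u))"
    unfolding set_lebesgue_integral_def
  proof (rule integral_cong_AE)
    show "AE m in K x. indicator ?A m *\<^sub>R real_cond_exp (K x) ?F (indicator ?S) m =
        indicator B (path_of m) * exp (- hazard lam (path_of m) u)"
      using ce AE_space by eventually_elim (auto simp: indicator_def sp)
  qed (use B in measurable)
  also have "\<dots> = (LINT w|P x. indicator B w * exp (- hazard lam w u))"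
    unfolding distr_path[symmetric] by (rule integral_distr[symmetric]) (use B in measurable)
  finally have m: "measure (K x) (?A \<inter> ?S) = (LINT w|P x. indicator B w * exp (- hazard lam w u))" .
  interpret P: prob_space "P x" by (rule prob_space_kernel[OF P])
  note [measurable_cong] = prob_space_kernel(2)[OF P]
  have "(\<integral>\<^sup>+w. indicator B w * ennreal (exp (- hazard lam w u)) \<partial>P x) =
      (\<integral>\<^sup>+w. ennreal (indicator B w * exp (- hazard lam w u)) \<partial>P x)"
    by (intro nn_integral_cong) (auto simp: indicator_def)
  also have "\<dots> = ennreal (LINT w|P x. indicator B w * exp (- hazard lam w u))"
    using B by (intro nn_integral_eq_integral P.integrable_const_bound[where B=1] AE_I2)
      (auto simp: indicator_def hazard_nonneg)
  finally show ?thesis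
    by (simp add: m[symmetric] K.emeasure_eq_measure) (auto intro!: arg_cong[where f="measure (K x)"])
qed

lemma nn_integral_survival:
  assumes [measurable]: "G \<in> borel_measurable path_space" and u: "0 \<le> u"
  shows "(\<integral>\<^sup>+m. G (path_of m) * indicator {m. ennreal u < lifetime m} m \<partial>K x)
     = (\<integral>\<^sup>+w. G w * ennreal (exp (- hazard lam w u)) \<partial>P x)"
proof -
  note [measurable_cong] = prob_space_kernel(2)[OF K] prob_space_kernel(2)[OF P]
  note sp = prob_space_kernel(3)[OF K] prob_space_kernel(3)[OF P]
  let ?S = "indicator {m. ennreal u < lifetime m} :: 'a particle \<Rightarrow> ennreal"
  have [measurable]: "Measurable.pred (K x) (\<lambda>m. m \<in> {m. ennreal u < lifetime m})"
    by simp
  have "{m \<in> space (K x). ennreal u < lifetime m} \<in> sets (K x)"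
    by measurable
  then have S: "?S \<in> borel_measurable (K x)"
    by (subst borel_measurable_indicator_iff) (simp add: Int_def conj_commute)
  have "distr (density (K x) ?S) path_space path_of = density (P x) (\<lambda>w. ennreal (exp (- hazard lam w u)))"
  proof (rule measure_eqI)
    fix B assume "B \<in> sets (distr (density (K x) ?S) path_space path_of)"
    then have B[measurable]: "B \<in> sets path_space" by simp
    have "emeasure (distr (density (K x) ?S) path_space path_of) B =
        emeasure (density (K x) ?S) (path_of -` B \<inter> space (K x))"
      by (subst emeasure_distr) auto
    also have "\<dots> = (\<integral>\<^sup>+m. ?S m * indicator (path_of -` B \<inter> space (K x)) m \<partial>K x)"
      by (rule emeasure_density) (rule S, rule measurable_sets[OF _ B], measurable)
    also have "\<dots> =
       (\<integral>\<^sup>+m. indicator {m \<in> space particle_space. path_of m \<in> B \<and> ennreal u < lifetime m} m \<partial>K x)"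
      by (intro nn_integral_cong) (auto simp: indicator_def sp)
    also have "\<dots> = emeasure (K x) {m \<in> space particle_space. path_of m \<in> B \<and> ennreal u < lifetime m}"
      by (rule nn_integral_indicator) (simp add: prob_space_kernel(2)[OF K])
    also have "\<dots> = emeasure (density (P x) (\<lambda>w. ennreal (exp (- hazard lam w u)))) B"
      unfolding measure_path_and_survival[OF B u]
      by (subst emeasure_density) (auto simp: prob_space_kernel(2)[OF P] mult.commute)
    finally show "emeasure (distr (density (K x) ?S) path_space path_of) B
      = emeasure (density (P x) (\<lambda>w. ennreal (exp (- hazard lam w u)))) B" .
  qed (simp add: prob_space_kernel(2)[OF P])
  then have "(\<integral>\<^sup>+w. G w \<partial>distr (density (K x) ?S) path_space path_of) =
     (\<integral>\<^sup>+w. G w \<partial>density (P x) (\<lambda>w. ennreal (exp (- hazard lam w u))))"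
    by simp
  then show ?thesis
    by (subst (asm) nn_integral_distr, simp, simp, subst (asm) (1 2) nn_integral_density)
      (auto simp: mult.commute)
qed

text \<open>The joint law of the path and the branching time. Both sides are integrals against finite measures
on pairs of a path and a time, and these agree on the rectangles \<open>A \<times> {..s}\<close> by the survival
probabilities; such rectangles generate and are stable under intersection.\<close>

lemma nn_integral_branching:
  assumes F: "case_prod F \<in> borel_measurable (path_space \<Otimes>\<^sub>M borel)" and t: "0 \<le> t"
  shows "(\<integral>\<^sup>+m. F (path_of m) (enn2real (lifetime m)) * indicator {m. lifetime m \<le> ennreal t} m \<partial>K x)
     = (\<integral>\<^sup>+w. (\<integral>\<^sup>+s. F w s * (indicator {0..t} s * ennreal (lifetime_density lam w s)) \<partial>lborel) \<partial>P x)"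
proof -
  note [measurable_cong] = prob_space_kernel(2)[OF K] prob_space_kernel(2)[OF P]
  note sp = prob_space_kernel(3)[OF K] prob_space_kernel(3)[OF P]
  interpret K: prob_space "K x" by (rule prob_space_kernel[OF K])
  interpret P: prob_space "P x" by (rule prob_space_kernel[OF P])
  let ?S = "indicator {m. lifetime m \<le> ennreal t} :: 'a particle \<Rightarrow> ennreal"
  have [measurable]: "Measurable.pred (K x) (\<lambda>m. m \<in> {m. lifetime m \<le> ennreal t})"
    by simp
  have "{m \<in> space (K x). lifetime m \<le> ennreal t} \<in> sets (K x)"
    by measurable
  then have S: "?S \<in> borel_measurable (K x)"
    by (subst borel_measurable_indicator_iff) (simp add: Int_def conj_commute)
  let ?T = "\<lambda>m. (path_of m, enn2real (lifetime m))"
  have T[measurable]: "?T \<in> K x \<rightarrow>\<^sub>M path_space \<Otimes>\<^sub>M borel"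
    by measurable
  define d where "d z = indicator {0..t} (snd z) * ennreal (lam ((fst z) (max 0 (snd z))) * exp (- hazard lam (fst z) (snd z)))" 
    for z :: "'a path \<times> real"
  have [measurable]: "(\<lambda>z. (fst z) (max 0 (snd z))) \<in> borel_measurable ((path_space :: 'a path measure) \<Otimes>\<^sub>M borel)"
    by (rule measurable_path_eval_compose) measurable
  have [measurable]: "d \<in> borel_measurable (path_space \<Otimes>\<^sub>M borel)"
    unfolding d_def by measurable
  have [measurable]: "d \<in> borel_measurable (P x \<Otimes>\<^sub>M lborel)"
    by measurable
  let ?\<mu> = "distr (density (K x) ?S) (path_space \<Otimes>\<^sub>M borel) ?T"
  let ?\<nu> = "density (P x \<Otimes>\<^sub>M lborel) d"
  let ?E = "{A \<times> B | A B. A \<in> sets (path_space :: 'a path measure) \<and> B \<in> range (\<lambda>s::real. {..s})}"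
  have mu: "emeasure ?\<mu> (A \<times> {..s}) = (\<integral>\<^sup>+m. indicator {m\<in>space particle_space. path_of m \<in> A \<and> enn2real (lifetime m) \<le> s \<and> lifetime m \<le> ennreal t} m \<partial>K x)"
    if [measurable]: "A \<in> sets path_space" for A s
  proof -
    have [measurable]: "A \<times> {..s} \<in> sets (path_space \<Otimes>\<^sub>M borel)"
      by (intro pair_measureI) auto
    have "emeasure ?\<mu> (A \<times> {..s}) = emeasure (density (K x) ?S) (?T -` (A \<times> {..s}) \<inter> space (K x))"
      using T by (subst emeasure_distr) auto
    also have "\<dots> = (\<integral>\<^sup>+m. ?S m * indicator (?T -` (A \<times> {..s}) \<inter> space (K x)) m \<partial>K x)"
      by (rule emeasure_density) (rule S, rule measurable_sets[OF T], measurable)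
    also have "\<dots> = (\<integral>\<^sup>+m. indicator {m\<in>space particle_space. path_of m \<in> A \<and> enn2real (lifetime m) \<le> s \<and> lifetime m \<le> ennreal t} m \<partial>K x)"
      by (intro nn_integral_cong) (auto simp: indicator_def sp)
    finally show ?thesis .
  qed
  have nu: "emeasure ?\<nu> (A \<times> {..s}) = (\<integral>\<^sup>+w. indicator A w * (\<integral>\<^sup>+r. indicator {..s} r * (indicator {0..t} r * ennreal (lifetime_density lam w r)) \<partial>lborel) \<partial>P x)"
    if [measurable]: "A \<in> sets path_space" for A s
  proof -
    have "emeasure ?\<nu> (A \<times> {..s}) = (\<integral>\<^sup>+z. d z * indicator (A \<times> {..s}) z \<partial>(P x \<Otimes>\<^sub>M lborel))"
      by (rule emeasure_density) (auto simp: prob_space_kernel(2)[OF P])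
    also have "\<dots> = (\<integral>\<^sup>+w. \<integral>\<^sup>+r. d (w, r) * indicator (A \<times> {..s}) (w, r) \<partial>lborel \<partial>P x)"
      by (rule lborel.nn_integral_fst[symmetric]) (auto simp: prob_space_kernel(2)[OF P])
    also have "\<dots> = (\<integral>\<^sup>+w. indicator A w * (\<integral>\<^sup>+r. indicator {..s} r * (indicator {0..t} r * ennreal (lifetime_density lam w r)) \<partial>lborel) \<partial>P x)"
      by (intro nn_integral_cong) (auto simp: d_def indicator_def mult_ac)
    finally show ?thesis .
  qed
  have eq: "?\<mu> = ?\<nu>"
  proof (rule measure_eqI_generator_eq[where E="?E" and \<Omega>="space path_space \<times> UNIV"
        and A="\<lambda>i. space path_space \<times> {..real i}"])
    show "Int_stable ?E"
    proof (rule Int_stableI, safe)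
      fix A B :: "'a path set" and a b :: real
      assume "A \<in> sets path_space" "B \<in> sets path_space"
      then show "\<exists>D E. A \<times> {..a} \<inter> B \<times> {..b} = D \<times> E \<and> D \<in> sets path_space \<and> E \<in> range atMost"
        by (intro exI[of _ "A \<inter> B"] exI[of _ "{..min a b}"]) auto
    qed
    show "?E \<subseteq> Pow (space path_space \<times> UNIV)"
      using sets.space_closed by fastforce
    have sE: "sets (path_space \<Otimes>\<^sub>M (borel :: real measure)) = sigma_sets (space (path_space :: 'a path measure) \<times> UNIV) ?E"
    proof -
      have "sets (path_space \<Otimes>\<^sub>M (borel :: real measure)) = sets (sigma (space (path_space :: 'a path measure) \<times> space borel) ?E)"
      proof (rule sets_pair_eq)
        show "sets (path_space :: 'a path measure) = sigma_sets (space path_space) (sets path_space)"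
          by (simp add: sets.sigma_sets_eq)
        show "sets (borel :: real measure) = sigma_sets (space borel) (range (\<lambda>s. {..s}))"
          unfolding borel_eq_atMost by simp
        show "countable {space path_space}" "{space path_space} \<subseteq> sets path_space" by auto
        show "countable ((\<lambda>n::nat. {..real n}) ` UNIV)" by simp
        show "\<Union> ((\<lambda>n::nat. {..real n}) ` UNIV) = space borel"
          by (auto intro: real_arch_simple)
      qed (use sets.space_closed in auto)
      also have "\<dots> = sigma_sets (space (path_space :: 'a path measure) \<times> UNIV) ?E"
        using \<open>?E \<subseteq> _\<close> by (simp add: sets_measure_of)
      finally show ?thesis .
    qed
    then show "sets ?\<mu> = sigma_sets (space path_space \<times> UNIV) ?E" by simp
    have "sets ?\<nu> = sets (path_space \<Otimes>\<^sub>M (borel :: real measure))"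
      by (simp add: prob_space_kernel(2)[OF P] cong: sets_pair_measure_cong)
    with sE show "sets ?\<nu> = sigma_sets (space path_space \<times> UNIV) ?E" by simp
    show "range (\<lambda>i. space path_space \<times> {..real i}) \<subseteq> ?E" by auto
    show "(\<Union>i. space path_space \<times> {..real i}) = space path_space \<times> UNIV"
      by (auto intro: real_arch_simple)
    show "emeasure ?\<mu> (space path_space \<times> {..real i}) \<noteq> \<infinity>" for i
      unfolding mu[OF sets.top]
      by (subst nn_integral_indicator) (auto simp: prob_space_kernel(2)[OF K] K.emeasure_eq_measure)
    fix X assume "X \<in> ?E"
    then obtain A s where X: "X = A \<times> {..s}" and A[measurable]: "A \<in> sets path_space" by auto
    show "emeasure ?\<mu> X = emeasure ?\<nu> X"
    proof (cases "0 \<le> s")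
      case False
      then have "\<not> enn2real l \<le> s" for l
        using enn2real_nonneg[of l] by linarith
      then have "emeasure ?\<mu> X = 0"
        unfolding X mu[OF A] by simp
      moreover have "emeasure ?\<nu> X = 0"
      proof -
        have "indicator {..s} r * (indicator {0..t} r * z) = 0" for r and z :: ennreal
          using False by (auto simp: indicator_def)
        then show ?thesis
          unfolding X nu[OF A] by (simp only: nn_integral_const mult_zero_left mult_zero_right)
      qed
      ultimately show ?thesis by simp
    next
      case True
      \<comment> \<open>Among the particles that branch before \<open>t\<close>, those with branching time at most \<open>s\<close> have died by \<open>u\<close>.\<close>
      define u where "u = min s t"
      have u: "0 \<le> u" using True t by (simp add: u_def)
      have iff: "enn2real l \<le> s \<and> l \<le> ennreal t \<longleftrightarrow> \<not> ennreal u < l" for l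
        using True t by (cases l) (auto simp: u_def not_less ennreal_le_iff2 min_def top_unique split: if_splits)
      let ?A = "{m\<in>space particle_space. path_of m \<in> A}"
      let ?B = "{m\<in>space particle_space. path_of m \<in> A \<and> ennreal u < lifetime m}"
      have [measurable]: "?A \<in> sets (K x)" "?B \<in> sets (K x)"
        by (simp_all add: prob_space_kernel(2)[OF K])
      have "emeasure ?\<mu> X = emeasure (K x) (?A - ?B)"
        unfolding X mu[OF A] iff
        by (subst nn_integral_indicator[symmetric], simp) (auto intro!: nn_integral_cong simp: indicator_def simp del: nn_integral_indicator)
      also have "\<dots> = emeasure (K x) ?A - emeasure (K x) ?B"
        by (rule emeasure_Diff) auto
      also have "emeasure (K x) ?A = emeasure (P x) A"
        unfolding distr_path[symmetric] by (subst emeasure_distr) (auto intro!: arg_cong[where f="emeasure (K x)"] simp: sp)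
      also have "emeasure (P x) A = (\<integral>\<^sup>+w. indicator A w \<partial>P x)"
        by (simp add: prob_space_kernel(2)[OF P])
      also have "emeasure (K x) ?B = (\<integral>\<^sup>+w. indicator A w * ennreal (exp (- hazard lam w u)) \<partial>P x)"
        by (rule measure_path_and_survival[OF A u])
      also have "(\<integral>\<^sup>+w. indicator A w \<partial>P x) - (\<integral>\<^sup>+w. indicator A w * ennreal (exp (- hazard lam w u)) \<partial>P x) =
          (\<integral>\<^sup>+w. indicator A w - indicator A w * ennreal (exp (- hazard lam w u)) \<partial>P x)"
      proof (rule nn_integral_diff[symmetric])
        have "(\<integral>\<^sup>+w. indicator A w * ennreal (exp (- hazard lam w u)) \<partial>P x) \<le> (\<integral>\<^sup>+w. 1 \<partial>P x)"
          by (intro nn_integral_mono) (auto simp: indicator_def hazard_nonneg)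
        then show "(\<integral>\<^sup>+w. indicator A w * ennreal (exp (- hazard lam w u)) \<partial>P x) \<noteq> \<infinity>"
          by (auto simp: P.emeasure_space_1 top_unique)
      qed (auto simp: prob_space_kernel(2)[OF P] indicator_def hazard_nonneg intro!: AE_I2)
      also have "\<dots> = (\<integral>\<^sup>+w. indicator A w * ennreal (1 - exp (- hazard lam w u)) \<partial>P x)"
        by (intro nn_integral_cong) (auto simp: indicator_def ennreal_minus[of "exp _" 1, simplified])
      also have "\<dots> = emeasure ?\<nu> X"
        unfolding X nu[OF A]
      proof (intro nn_integral_cong)
        fix w assume "w \<in> space (P x)"
        then have w: "w \<in> space path_space" by (simp add: sp)
        have "(\<integral>\<^sup>+r. indicator {..s} r * (indicator {0..t} r * ennreal (lifetime_density lam w r)) \<partial>lborel)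
          = (\<integral>\<^sup>+r. indicator {0..u} r * ennreal (lifetime_density lam w r) \<partial>lborel)"
          by (intro nn_integral_cong) (auto simp: indicator_def u_def)
        also have "\<dots> = ennreal (1 - exp (- hazard lam w u))"
          by (rule nn_integral_hazard_density[OF lam_measurable lam_nonneg lam_le w u])
        finally show "indicator A w * ennreal (1 - exp (- hazard lam w u)) = indicator A w *
          (\<integral>\<^sup>+r. indicator {..s} r * (indicator {0..t} r * ennreal (lifetime_density lam w r)) \<partial>lborel)"
          by simp
      qed
      finally show ?thesis .
    qed
  qed
  note [measurable] = F
  have F': "case_prod F \<in> borel_measurable (P x \<Otimes>\<^sub>M lborel)"
    using F by (simp cong: measurable_cong_sets sets_pair_measure_cong add: prob_space_kernel(2)[OF P])
  have "(\<integral>\<^sup>+m. F (path_of m) (enn2real (lifetime m)) * ?S m \<partial>K x) = (\<integral>\<^sup>+z. case_prod F z \<partial>?\<mu>)"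
    by (subst nn_integral_distr, simp, simp, subst nn_integral_density) (auto simp: mult.commute)
  also have "\<dots> = (\<integral>\<^sup>+z. case_prod F z \<partial>?\<nu>)"
    unfolding eq ..
  also have "\<dots> = (\<integral>\<^sup>+z. d z * case_prod F z \<partial>(P x \<Otimes>\<^sub>M lborel))"
    by (rule nn_integral_density) measurable
  also have "\<dots> = (\<integral>\<^sup>+w. \<integral>\<^sup>+s. d (w, s) * F w s \<partial>lborel \<partial>P x)"
    using F' by (subst lborel.nn_integral_fst[symmetric]) auto
  finally show ?thesis
    by (simp add: d_def mult.commute mult.left_commute)
qed

end

section \<open>The branching tree seen from its root\<close>

lemma birth_time_Nil [simp]: "birth_time y [] = 0"
  by (simp add: birth_time_def)

lemma birth_time_graft: "birth_time (graft m S) (j # l) = lifetime m + birth_time (S j) l"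
  by (simp add: birth_time_def sum.lessThan_Suc_shift del: sum.lessThan_Suc)

lemma alive_graft_before:
  assumes "ennreal t < lifetime m"
  shows "alive (graft m S) t = {[]}"
proof -
  have "l = []" if "birth_time (graft m S) l \<le> ennreal t" for l
  proof (cases l)
    case (Cons j l')
    then have "lifetime m + birth_time (S j) l' \<le> ennreal t"
      using that by (simp add: birth_time_graft)
    then have "lifetime m \<le> ennreal t"
      using order_trans[of "lifetime m" "lifetime m + birth_time (S j) l'"] by (simp add: le_iff_add)
    with assms show ?thesis by simp
  qed
  with assms show ?thesis
    by (auto simp: alive_def)
qed

text \<open>After the first branching the population is the disjoint union of those of the subtrees, whose clocks
start at the branching time.\<close>

lemma alive_graft_after:
  assumes T: "lifetime m \<le> ennreal t" and t: "0 \<le> t"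
  shows "alive (graft m S) t = (\<Union>j<offspring m. (#) j ` alive (S j) (t - enn2real (lifetime m)))"
proof -
  define r where "r = enn2real (lifetime m)"
  have lt: "lifetime m = ennreal r" and r: "0 \<le> r" "r \<le> t"
    using T t by (cases "lifetime m"; auto simp: r_def ennreal_le_iff2 top_unique)+
  have sum1: "ennreal r + b \<le> ennreal t \<longleftrightarrow> b \<le> ennreal (t - r)" for b
    using r by (cases b) (auto simp: top_unique ennreal_le_iff2 simp flip: ennreal_plus)
  have sum2: "ennreal t < ennreal r + b \<longleftrightarrow> ennreal (t - r) < b" for b
    using sum1[of b] by (simp add: not_le[symmetric])
  have Cons: "j # l \<in> alive (graft m S) t \<longleftrightarrow> j < offspring m \<and> l \<in> alive (S j) (t - r)" for j l
  proof -
    have "(\<forall>k<length (j # l). (j # l) ! k < offspring (graft m S (take k (j # l)))) \<longleftrightarrow>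
        j < offspring m \<and> (\<forall>k<length l. l ! k < offspring (S j (take k l)))"
      by (simp add: All_less_Suc2)
    then show ?thesis
      by (simp add: alive_def birth_time_graft lt add.assoc sum1 sum2 conj_assoc)
  qed
  have "[] \<notin> alive (graft m S) t"
    using T by (auto simp: alive_def)
  then have "l \<in> alive (graft m S) t \<longleftrightarrow> l \<in> (\<Union>j<offspring m. (#) j ` alive (S j) (t - r))" for l
    by (cases l) (auto simp: Cons)
  then show ?thesis
    unfolding r_def by blast
qed

lemma position_graft:
  assumes T: "lifetime m \<le> ennreal t" and t: "0 \<le> t"
    and l: "l \<in> alive (S j) (t - enn2real (lifetime m))"
  shows "position (graft m S) t (j # l) = position (S j) (t - enn2real (lifetime m)) l"
proof -
  have "birth_time (S j) l \<noteq> top" "lifetime m \<noteq> top"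
    using l T by (auto simp: alive_def top_unique)
  then have "enn2real (lifetime m + birth_time (S j) l) = enn2real (lifetime m) + enn2real (birth_time (S j) l)"
    by (intro enn2real_plus) (auto simp: less_top)
  then show ?thesis
    by (simp add: position_def birth_time_graft algebra_simps)
qed

text \<open>A product over an infinite set equals 1 by convention, so this is multiplicative over subtrees only as
long as they are finite.\<close>

definition population_product :: "('a \<Rightarrow> real) \<Rightarrow> 'a tree \<Rightarrow> real \<Rightarrow> real" where
  "population_product f y t = (\<Prod>i\<in>alive y t. f (position y t i))"

lemma population_product_before:
  assumes "ennreal t < lifetime m"
  shows "population_product f (graft m S) t = f (path_of m t)"
  by (simp add: population_product_def alive_graft_before[OF assms] position_def)

lemma population_product_after:
  assumes T: "lifetime m \<le> ennreal t" and t: "0 \<le> t" and two: "offspring m = 2"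
    and fin: "finite (alive (S 0) (t - enn2real (lifetime m)))" "finite (alive (S 1) (t - enn2real (lifetime m)))"
  shows "population_product f (graft m S) t =
    population_product f (S 0) (t - enn2real (lifetime m)) * population_product f (S 1) (t - enn2real (lifetime m))"
proof -
  let ?s = "t - enn2real (lifetime m)"
  have al: "alive (graft m S) t = (#) 0 ` alive (S 0) ?s \<union> (#) 1 ` alive (S 1) ?s"
    unfolding alive_graft_after[OF T t] two by (auto simp: numeral_2_eq_2 lessThan_Suc)
  have "population_product f (graft m S) t =
      (\<Prod>i\<in>(#) 0 ` alive (S 0) ?s. f (position (graft m S) t i)) * (\<Prod>i\<in>(#) 1 ` alive (S 1) ?s. f (position (graft m S) t i))"
    unfolding population_product_def al using fin by (intro prod.union_disjoint) auto
  also have "\<dots> = population_product f (S 0) ?s * population_product f (S 1) ?s"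
    by (simp add: prod.reindex population_product_def position_graft[OF T t])
  finally show ?thesis .
qed

lemma infinite_alive_graft:
  assumes "0 \<le> t" "offspring m = 2" "infinite (alive (graft m S) t)"
  shows "lifetime m \<le> ennreal t \<and> (infinite (alive (S 0) (t - enn2real (lifetime m))) \<or> infinite (alive (S 1) (t - enn2real (lifetime m))))"
proof -
  have "lifetime m \<le> ennreal t"
    using assms(3) alive_graft_before[of t m S] by (cases "ennreal t < lifetime m") auto
  moreover from alive_graft_after[OF this assms(1), of S] assms(2)
  have "alive (graft m S) t = (#) 0 ` alive (S 0) (t - enn2real (lifetime m)) \<union> (#) 1 ` alive (S 1) (t - enn2real (lifetime m))"
    by (auto simp: numeral_2_eq_2 lessThan_Suc)
  ultimately show ?thesis
    using assms(3) by auto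
qed

lemma population_product_bounds:
  assumes "\<And>x. 0 \<le> f x \<and> f x \<le> 1"
  shows "0 \<le> population_product f y t" "population_product f y t \<le> 1"
  unfolding population_product_def using assms by (auto intro!: prod_nonneg prod_le_1)

lemma measurable_tree_label[measurable_dest]:
  "g \<in> M \<rightarrow>\<^sub>M tree_space \<Longrightarrow> (\<lambda>x. g x l) \<in> M \<rightarrow>\<^sub>M particle_space"
  unfolding tree_space_def by (rule measurable_compose[OF _ measurable_component_singleton]) auto

lemma measurable_birth_time[measurable (raw)]:
  assumes [measurable]: "g \<in> M \<rightarrow>\<^sub>M tree_space"
  shows "(\<lambda>x. birth_time (g x) l) \<in> borel_measurable M"
  unfolding birth_time_def by measurable

lemma measurable_mem_alive:
  assumes [measurable]: "f \<in> borel_measurable M" "g \<in> M \<rightarrow>\<^sub>M tree_space"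
  shows "Measurable.pred M (\<lambda>x. l \<in> alive (g x) (f x))"
  unfolding alive_def mem_Collect_eq by measurable

lemma measurable_alive_eq:
  assumes [measurable]: "f \<in> borel_measurable M" "g \<in> M \<rightarrow>\<^sub>M tree_space"
  shows "Measurable.pred M (\<lambda>x. alive (g x) (f x) = F)"
proof -
  note [measurable] = measurable_mem_alive[OF assms]
  have "Measurable.pred M (\<lambda>x. \<forall>l. l \<in> alive (g x) (f x) \<longleftrightarrow> l \<in> F)"
    by measurable
  then show ?thesis by (simp add: set_eq_iff)
qed

lemma measurable_finite_alive:
  assumes [measurable]: "f \<in> borel_measurable M" "g \<in> M \<rightarrow>\<^sub>M tree_space"
  shows "Measurable.pred M (\<lambda>x. finite (alive (g x) (f x)))"
proof -
  note [measurable] = measurable_alive_eq[OF assms]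
  have c: "countable {F :: nat list set. finite F}"
    using countable_Collect_finite_subset[of "UNIV :: nat list set"] by simp
  have "(\<Union>F\<in>{F. finite F}. {x \<in> space M. alive (g x) (f x) = F}) \<in> sets M"
    by (intro sets.countable_UN'' c) measurable
  also have "(\<Union>F\<in>{F. finite F}. {x \<in> space M. alive (g x) (f x) = F}) = {x \<in> space M. finite (alive (g x) (f x))}"
    by auto
  finally show ?thesis by (simp add: pred_def)
qed

text \<open>There are countably many finite sets of labels. All infinite ones may be replaced by the set of all
labels, since the product is 1 for each of them.\<close>

lemma measurable_population_product:
  assumes h: "h \<in> borel_measurable borel"
    and f[measurable]: "f \<in> borel_measurable M" and g[measurable]: "g \<in> M \<rightarrow>\<^sub>M (tree_space :: 'a::polish_space tree measure)"
    and f0: "\<And>x. x \<in> space M \<Longrightarrow> 0 \<le> f x"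
  shows "(\<lambda>x. population_product h (g x) (f x)) \<in> borel_measurable M"
proof -
  let ?a = "\<lambda>x. if finite (alive (g x) (f x)) then alive (g x) (f x) else UNIV"
  let ?I = "insert UNIV {F :: nat list set. finite F}"
  let ?pos = "\<lambda>x i. path_of (g x i) (max 0 (f x - enn2real (birth_time (g x) i)))"
  have c: "countable ?I"
    using countable_Collect_finite_subset[of "UNIV :: nat list set"] by simp
  note [measurable] = measurable_alive_eq[OF f g] measurable_finite_alive[OF f g]
  have "(\<lambda>x. \<Prod>i\<in>?a x. h (?pos x i)) \<in> borel_measurable M"
  proof (rule measurable_compose_countable'[OF _ _ c, where f="\<lambda>F x. \<Prod>i\<in>F. h (?pos x i)"])
    show "?a \<in> M \<rightarrow>\<^sub>M count_space ?I"
      unfolding measurable_count_space_eq_countable[OF c]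
    proof (intro conjI ballI)
      fix F assume "F \<in> ?I"
      have "{x \<in> space M. (finite (alive (g x) (f x)) \<and> alive (g x) (f x) = F) \<or>
          (\<not> finite (alive (g x) (f x)) \<and> F = UNIV)} \<in> sets M" by measurable
      also have "{x \<in> space M. (finite (alive (g x) (f x)) \<and> alive (g x) (f x) = F) \<or>
          (\<not> finite (alive (g x) (f x)) \<and> F = UNIV)} = ?a -` {F} \<inter> space M" (is "?L = ?R")
      proof (rule set_eqI)
        fix x show "x \<in> ?L \<longleftrightarrow> x \<in> ?R"
          by (cases "finite (alive (g x) (f x))") (simp_all, blast+)
      qed
      finally show "?a -` {F} \<inter> space M \<in> sets M" .
    qed auto
    fix F
    show "(\<lambda>x. \<Prod>i\<in>F. h (?pos x i)) \<in> borel_measurable M"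
      by (intro borel_measurable_prod measurable_compose[OF measurable_path_eval_compose h]) measurable
  qed
  moreover have "(\<Prod>i\<in>?a x. h (?pos x i)) = population_product h (g x) (f x)" if "x \<in> space M" for x
  proof (cases "finite (alive (g x) (f x))")
    case True
    have "?pos x i = position (g x) (f x) i" if "i \<in> alive (g x) (f x)" for i
    proof -
      have "enn2real (birth_time (g x) i) \<le> enn2real (ennreal (f x))"
        using that by (intro enn2real_mono) (auto simp: alive_def)
      then show ?thesis
        using f0[OF \<open>x \<in> space M\<close>] by (simp add: position_def)
    qed
    then show ?thesis
      using True by (auto simp: population_product_def intro!: prod.cong)
  qed (simp add: population_product_def infinite_UNIV_listI)
  ultimately show ?thesis
    by (simp cong: measurable_cong)
qed

text \<open>Measurability needs to be checked on cylinder sets only, where the product measure is a finite product.\<close>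

lemma measurable_PiM_kernel:
  assumes q: "q \<in> M \<rightarrow>\<^sub>M prob_algebra N"
  shows "(\<lambda>x. PiM I (\<lambda>_. q x)) \<in> M \<rightarrow>\<^sub>M prob_algebra (PiM I (\<lambda>_. N))"
proof (rule measurable_prob_algebra_generated[OF sets_PiM Int_stable_prod_algebra prod_algebra_sets_into_space])
  fix x assume x: "x \<in> space M"
  have qx: "prob_space (q x)" "sets (q x) = sets N"
    using measurable_space[OF q x] by (auto simp: space_prob_algebra)
  show "prob_space (PiM I (\<lambda>_. q x))"
    by (rule prob_space_PiM) (rule qx)
  show "sets (PiM I (\<lambda>_. q x)) = sets (PiM I (\<lambda>_. N))"
    by (rule sets_PiM_cong) (auto simp: qx)
next
  fix A assume "A \<in> prod_algebra I (\<lambda>_. N)"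
  then obtain J X where A: "A = prod_emb I (\<lambda>_. N) J (Pi\<^sub>E J X)" and J: "finite J" "J \<subseteq> I"
    and X: "\<And>j. j \<in> J \<Longrightarrow> X j \<in> sets N"
    by (rule prod_algebraE) blast
  have "(\<lambda>x. \<Prod>j\<in>J. emeasure (q x) (X j)) \<in> borel_measurable M"
    using X by (intro borel_measurable_prod_ennreal measurable_compose[OF measurable_prob_algebraD[OF q]] measurable_emeasure_subprob_algebra)
  moreover have "emeasure (PiM I (\<lambda>_. q x)) A = (\<Prod>j\<in>J. emeasure (q x) (X j))" if x: "x \<in> space M" for x
  proof -
    have qx: "prob_space (q x)" "sets (q x) = sets N"
      using measurable_space[OF q x] by (auto simp: space_prob_algebra)
    then have "A = prod_emb I (\<lambda>_. q x) J (Pi\<^sub>E J X)"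
      unfolding A prod_emb_def by (simp add: sets_eq_imp_space_eq[OF qx(2)])
    then show ?thesis
      using J X qx by (simp add: emeasure_PiM_emb)
  qed
  ultimately show "(\<lambda>x. emeasure (PiM I (\<lambda>_. q x)) A) \<in> borel_measurable M"
    by (simp cong: measurable_cong)
qed

lemma measurable_final_position[measurable]: "final_position \<in> borel_measurable particle_space"
proof -
  have "(\<lambda>m. path_of m (max 0 (enn2real (lifetime m)))) \<in> borel_measurable particle_space"
    by (rule measurable_path_eval_compose) measurable
  then show ?thesis
    by (simp add: final_position_def[abs_def])
qed

lemma measurable_graft:
  "(\<lambda>(m, S). graft m S) \<in> particle_space \<Otimes>\<^sub>M PiM UNIV (\<lambda>_. tree_space) \<rightarrow>\<^sub>M (tree_space :: 'a::polish_space tree measure)"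
proof -
  have "(\<lambda>z. graft (fst z) (snd z) l) \<in> particle_space \<Otimes>\<^sub>M PiM UNIV (\<lambda>_. tree_space) \<rightarrow>\<^sub>M (particle_space :: 'a particle measure)" for l
  proof (cases l)
    case (Cons j l')
    have "(\<lambda>z. snd z j) \<in> (particle_space :: 'a particle measure) \<Otimes>\<^sub>M PiM UNIV (\<lambda>_. tree_space) \<rightarrow>\<^sub>M (tree_space :: 'a tree measure)"
      by measurable
    from measurable_tree_label[OF this, of l'] show ?thesis
      using Cons by simp
  qed simp
  note * = this[unfolded tree_space_def]
  show ?thesis
    unfolding tree_space_def case_prod_beta'
  proof (rule measurable_PiM_single'[OF *])
    show "(\<lambda>z. graft (fst z) (snd z)) \<in> space (particle_space \<Otimes>\<^sub>M PiM UNIV (\<lambda>_. PiM UNIV (\<lambda>_. particle_space))) \<rightarrow>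
        (\<Pi>\<^sub>E l\<in>UNIV. space (particle_space :: 'a particle measure))"
      unfolding PiE_UNIV_domain by (intro Pi_I measurable_space[OF *])
  qed
qed

text \<open>Independence of the first two coordinates, by splitting off one coordinate of the sequence.\<close>

lemma nn_integral_two_components:
  assumes Q: "prob_space Q" and [measurable]: "g \<in> borel_measurable Q" "h \<in> borel_measurable Q"
  shows "(\<integral>\<^sup>+S. g (S 0) * h (S (1::nat)) \<partial>PiM UNIV (\<lambda>_. Q)) = (\<integral>\<^sup>+y. g y \<partial>Q) * (\<integral>\<^sup>+y. h y \<partial>Q)"
proof -
  interpret Q: prob_space Q by fact
  interpret sequence_space Q ..
  have "(\<integral>\<^sup>+S. g (S 0) * h (S (1::nat)) \<partial>PiM UNIV (\<lambda>_. Q)) =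
     (\<integral>\<^sup>+S. g (S 0) * h (S 1) \<partial>distr (Q \<Otimes>\<^sub>M PiM UNIV (\<lambda>_. Q)) (PiM UNIV (\<lambda>_. Q)) (\<lambda>(s, S). case_nat s S))"
    unfolding PiM_iter ..
  also have "\<dots> = (\<integral>\<^sup>+z. g (fst z) * h (snd z (0::nat)) \<partial>(Q \<Otimes>\<^sub>M PiM UNIV (\<lambda>_. Q)))"
    by (subst nn_integral_distr) (auto simp: case_prod_beta')
  also have "\<dots> = (\<integral>\<^sup>+y. \<integral>\<^sup>+S. g y * h (S (0::nat)) \<partial>PiM UNIV (\<lambda>_. Q) \<partial>Q)"
    by (subst P.nn_integral_fst[symmetric]) auto
  also have "\<dots> = (\<integral>\<^sup>+y. g y * (\<integral>\<^sup>+S. h (S (0::nat)) \<partial>PiM UNIV (\<lambda>_. Q)) \<partial>Q)"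
    by (intro nn_integral_cong nn_integral_cmult) measurable
  also have "(\<integral>\<^sup>+S. h (S (0::nat)) \<partial>PiM UNIV (\<lambda>_. Q)) = (\<integral>\<^sup>+y. h y \<partial>distr (PiM UNIV (\<lambda>_. Q)) Q (\<lambda>S. S (0::nat)))"
    by (subst nn_integral_distr) auto
  also have "distr (PiM UNIV (\<lambda>_. Q)) Q (\<lambda>S. S (0::nat)) = Q"
    using distr_PiM_component[of UNIV "\<lambda>_. Q" 0] Q by simp
  finally show ?thesis
    by (simp add: nn_integral_multc)
qed

locale binary_branching = branching_particle P lam C K
  for P :: "'a::polish_space \<Rightarrow> 'a path measure" and lam C K +
  fixes Q :: "'a \<Rightarrow> 'a tree measure" and f :: "'a \<Rightarrow> real"
  assumes law: "branching_law K Q"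
    and binary: "\<And>x. AE m in K x. offspring m = 2"
    and f_measurable[measurable]: "f \<in> borel_measurable borel"
    and f_bounds: "\<And>x. 0 \<le> f x \<and> f x \<le> 1"
begin

lemma Q: "Q \<in> borel \<rightarrow>\<^sub>M prob_algebra tree_space"
  using law by (simp add: branching_law_def)

lemma subtree_kernel:
  "(\<lambda>m. distr (PiM UNIV (\<lambda>_. Q (final_position m))) tree_space (graft m)) \<in> particle_space \<rightarrow>\<^sub>M prob_algebra tree_space"
  by (rule measurable_distr_prob_space2[OF measurable_PiM_kernel[OF measurable_compose[OF measurable_final_position Q]] measurable_graft])

lemma nn_integral_Q:
  assumes H: "H \<in> borel_measurable tree_space"
  shows "(\<integral>\<^sup>+y. H y \<partial>Q x) = (\<integral>\<^sup>+m. \<integral>\<^sup>+S. H (graft m S) \<partial>PiM UNIV (\<lambda>_. Q (final_position m)) \<partial>K x)"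
proof -
  have kx: "(\<lambda>m. distr (PiM UNIV (\<lambda>_. Q (final_position m))) tree_space (graft m)) \<in> K x \<rightarrow>\<^sub>M subprob_algebra tree_space"
    using measurable_prob_algebraD[OF subtree_kernel] by (simp add: measurable_kernel[OF K])
  have "(\<integral>\<^sup>+y. H y \<partial>Q x) = (\<integral>\<^sup>+m. \<integral>\<^sup>+y. H y \<partial>distr (PiM UNIV (\<lambda>_. Q (final_position m))) tree_space (graft m) \<partial>K x)"
    using law unfolding branching_law_def by (metis nn_integral_bind[OF H kx])
  also have "\<dots> = (\<integral>\<^sup>+m. \<integral>\<^sup>+S. H (graft m S) \<partial>PiM UNIV (\<lambda>_. Q (final_position m)) \<partial>K x)"
  proof (intro nn_integral_cong nn_integral_distr H)
    fix m assume "m \<in> space (K x)"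
    then have "m \<in> space particle_space"
      using prob_space_kernel(3)[OF K] by simp
    then have "graft m \<in> PiM UNIV (\<lambda>_. tree_space) \<rightarrow>\<^sub>M tree_space"
      using measurable_compose[OF measurable_Pair1' measurable_graft] by simp
    then show "graft m \<in> PiM UNIV (\<lambda>_. Q (final_position m)) \<rightarrow>\<^sub>M tree_space"
      by (simp cong: measurable_cong_sets sets_PiM_cong add: prob_space_kernel(2)[OF Q])
  qed (simp add: H)
  finally show ?thesis .
qed

end

section \<open>The first-branching equation\<close>

text \<open>One step of a Picard iteration for the linear Volterra inequality with constant kernel \<open>c\<close>.\<close>

lemma nn_integral_power_step:
  assumes "0 \<le> c" "0 \<le> t"
  shows "(\<integral>\<^sup>+s. ennreal (c * ((c * (t - s)) ^ n / fact n)) * indicator {0..t} s \<partial>lborel) = ennreal ((c * t) ^ Suc n / fact (Suc n))"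
proof -
  have d: "((\<lambda>s. - ((c * (t - s)) ^ Suc n / fact (Suc n))) has_real_derivative c * ((c * (t - s)) ^ n / fact n)) (at s)" for s
  proof -
    have "((\<lambda>s. c * (t - s)) has_real_derivative - c) (at s)"
      by (auto intro!: derivative_eq_intros)
    from DERIV_minus[OF DERIV_cdivide[OF DERIV_power_Suc[OF this, of n], of "fact (Suc n)"]]
    show ?thesis
    proof (rule DERIV_cong)
      have "1 + real n \<noteq> 0" by linarith
      then show "- ((1 + of_nat n) * (- c * (c * (t - s)) ^ n) / fact (Suc n)) = c * ((c * (t - s)) ^ n / fact n)"
        by (simp only: fact_Suc of_nat_Suc of_nat_add of_nat_1 of_nat_mult mult_divide_mult_cancel_left) simp
    qed
  qed
  have "(\<integral>\<^sup>+s. ennreal (c * ((c * (t - s)) ^ n / fact n)) * indicator {0..t} s \<partial>lborel) =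
     ennreal (- ((c * (t - t)) ^ Suc n / fact (Suc n)) - - ((c * (t - 0)) ^ Suc n / fact (Suc n)))"
    by (rule nn_integral_FTC_Icc) (use assms d in \<open>auto intro: has_field_derivative_at_within\<close>)
  then show ?thesis by simp
qed

context binary_branching
begin

lemma C_nonneg: "0 \<le> C"
  using lam_nonneg lam_le order_trans by blast

definition explosion :: "'a \<Rightarrow> real \<Rightarrow> ennreal" where
  "explosion x t = (\<integral>\<^sup>+y. indicator {y. infinite (alive y t)} y \<partial>Q x)"

lemma measurable_infinite_alive:
  assumes "g \<in> borel_measurable M" "h \<in> M \<rightarrow>\<^sub>M tree_space"
  shows "(\<lambda>x. indicator {y. infinite (alive y (g x))} (h x) :: ennreal) \<in> borel_measurable M"
proof -
  note [measurable] = measurable_finite_alive[OF assms]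
  have "(\<lambda>x. if finite (alive (h x) (g x)) then 0 else 1 :: ennreal) \<in> borel_measurable M"
    by measurable
  then show ?thesis
    by (rule measurable_cong[THEN iffD1, rotated]) (auto simp: indicator_def)
qed

text \<open>A population that is infinite at time \<open>t\<close> has branched before \<open>t\<close>, and one of the two subtrees is
infinite at the remaining time.\<close>

lemma explosion_step:
  assumes t: "0 \<le> t"
  shows "explosion x t \<le> (\<integral>\<^sup>+m. indicator {m. lifetime m \<le> ennreal t} m * (2 * explosion (final_position m) (t - enn2real (lifetime m))) \<partial>K x)"
proof -
  have meas: "(\<lambda>y. indicator {y. infinite (alive y s)} y :: ennreal) \<in> borel_measurable tree_space" for s
    by (rule measurable_infinite_alive) auto
  have "explosion x t = (\<integral>\<^sup>+m. \<integral>\<^sup>+S. indicator {y. infinite (alive y t)} (graft m S) \<partial>PiM UNIV (\<lambda>_. Q (final_position m)) \<partial>K x)"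
    unfolding explosion_def by (rule nn_integral_Q[OF meas])
  also have "\<dots> \<le> (\<integral>\<^sup>+m. indicator {m. lifetime m \<le> ennreal t} m * (2 * explosion (final_position m) (t - enn2real (lifetime m))) \<partial>K x)"
  proof (rule nn_integral_mono_AE)
    show "AE m in K x. (\<integral>\<^sup>+S. indicator {y. infinite (alive y t)} (graft m S) \<partial>PiM UNIV (\<lambda>_. Q (final_position m))) \<le>
      indicator {m. lifetime m \<le> ennreal t} m * (2 * explosion (final_position m) (t - enn2real (lifetime m)))"
      using binary[of x]
    proof eventually_elim
      case (elim m)
      let ?s = "t - enn2real (lifetime m)" and ?Q = "Q (final_position m)"
      let ?i = "\<lambda>y. indicator {y. infinite (alive y ?s)} y :: ennreal"
      have Qp: "prob_space ?Q" by (rule prob_space_kernel[OF Q])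
      have i: "?i \<in> borel_measurable ?Q"
        using meas by (simp add: measurable_kernel[OF Q])
      have comp: "(\<integral>\<^sup>+S. ?i (S j) \<partial>PiM UNIV (\<lambda>_. ?Q)) = explosion (final_position m) ?s" for j :: nat
      proof -
        have "(\<integral>\<^sup>+S. ?i (S j) \<partial>PiM UNIV (\<lambda>_. ?Q)) = (\<integral>\<^sup>+y. ?i y \<partial>distr (PiM UNIV (\<lambda>_. ?Q)) ?Q (\<lambda>S. S j))"
          by (subst nn_integral_distr) (auto intro: i)
        also have "distr (PiM UNIV (\<lambda>_. ?Q)) ?Q (\<lambda>S. S j) = ?Q"
          using distr_PiM_component[of UNIV "\<lambda>_. ?Q" j] Qp by simp
        finally show ?thesis by (simp add: explosion_def)
      qed
      have im: "(\<lambda>S. ?i (S j)) \<in> borel_measurable (PiM UNIV (\<lambda>_. ?Q))" for j :: nat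
        by (rule measurable_compose[OF measurable_component_singleton[of j UNIV "\<lambda>_. ?Q"] i]) simp
      have "(\<integral>\<^sup>+S. indicator {y. infinite (alive y t)} (graft m S) \<partial>PiM UNIV (\<lambda>_. ?Q)) \<le>
        (\<integral>\<^sup>+S. indicator {m. lifetime m \<le> ennreal t} m * (?i (S 0) + ?i (S (1::nat))) \<partial>PiM UNIV (\<lambda>_. ?Q))"
        using infinite_alive_graft[OF t elim] by (intro nn_integral_mono) (auto simp: indicator_def)
      also have "\<dots> = indicator {m. lifetime m \<le> ennreal t} m * (2 * explosion (final_position m) ?s)"
        using im by (simp add: nn_integral_cmult nn_integral_add comp mult_2)
      finally show ?case .
    qed
  qed
  finally show ?thesis .
qed

text \<open>Iterating \<open>explosion_step\<close>: the branching density is at most \<open>C\<close> and there are two subtrees, so each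
step contributes an integration with the constant \<open>2 C\<close>.\<close>

lemma explosion_le: "0 \<le> t \<Longrightarrow> explosion x t \<le> ennreal ((2 * C * t) ^ n / fact n)"
proof (induction n arbitrary: x t)
  case 0
  interpret prob_space "Q x" by (rule prob_space_kernel[OF Q])
  have "explosion x t \<le> (\<integral>\<^sup>+y. 1 \<partial>Q x)"
    unfolding explosion_def by (intro nn_integral_mono) (auto simp: indicator_def)
  then show ?case by (simp add: emeasure_space_1)
next
  case (Suc n)
  let ?F = "\<lambda>s. ennreal (2 * ((2 * C * (t - s)) ^ n / fact n))"
  interpret P: prob_space "P x" by (rule prob_space_kernel[OF P])
  have "explosion x t \<le> (\<integral>\<^sup>+m. indicator {m. lifetime m \<le> ennreal t} m * (2 * explosion (final_position m) (t - enn2real (lifetime m))) \<partial>K x)"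
    by (rule explosion_step[OF Suc.prems])
  also have "\<dots> \<le> (\<integral>\<^sup>+m. ?F (enn2real (lifetime m)) * indicator {m. lifetime m \<le> ennreal t} m \<partial>K x)"
  proof (rule nn_integral_mono)
    fix m
    show "indicator {m. lifetime m \<le> ennreal t} m * (2 * explosion (final_position m) (t - enn2real (lifetime m)))
      \<le> ?F (enn2real (lifetime m)) * indicator {m. lifetime m \<le> ennreal t} m"
    proof (cases "lifetime m \<le> ennreal t")
      case True
      then have "enn2real (lifetime m) \<le> t"
        using Suc.prems by (metis enn2real_ennreal enn2real_mono ennreal_less_top)
      then have "explosion (final_position m) (t - enn2real (lifetime m)) \<le> ennreal ((2 * C * (t - enn2real (lifetime m))) ^ n / fact n)"
        by (intro Suc.IH) simp
      from mult_left_mono[OF this, of 2] 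
      have "2 * explosion (final_position m) (t - enn2real (lifetime m)) \<le> ?F (enn2real (lifetime m))"
        by (subst ennreal_mult') auto
      then show ?thesis
        using True by simp
    qed simp
  qed
  also have "\<dots> = (\<integral>\<^sup>+w. (\<integral>\<^sup>+s. ?F s * (indicator {0..t} s * ennreal (lifetime_density lam w s)) \<partial>lborel) \<partial>P x)"
    by (rule nn_integral_branching[where F="\<lambda>_. ?F"]) (use Suc.prems in auto)
  also have "\<dots> \<le> (\<integral>\<^sup>+w. ennreal ((2 * C * t) ^ Suc n / fact (Suc n)) \<partial>P x)"
  proof (rule nn_integral_mono)
    fix w
    have "(\<integral>\<^sup>+s. ?F s * (indicator {0..t} s * ennreal (lifetime_density lam w s)) \<partial>lborel) \<le>
       (\<integral>\<^sup>+s. ennreal ((2 * C) * (((2 * C) * (t - s)) ^ n / fact n)) * indicator {0..t} s \<partial>lborel)"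
    proof (rule nn_integral_mono)
      fix s
      have "lam (w (max 0 s)) * exp (- hazard lam w s) \<le> C * 1"
        using lam_le lam_nonneg C_nonneg hazard_nonneg by (intro mult_mono) auto
      moreover have "0 \<le> (2 * C * (t - s)) ^ n / fact n" if "s \<le> t"
        using C_nonneg that by simp
      ultimately have "s \<le> t \<Longrightarrow> 2 * ((2 * C * (t - s)) ^ n / fact n) * lifetime_density lam w s \<le> 2 * ((2 * C * (t - s)) ^ n / fact n) * (C * 1)"
        by (intro mult_left_mono) auto
      moreover have "s \<le> t \<Longrightarrow> 0 \<le> 2 * ((2 * C * (t - s)) ^ n / fact n)"
        using C_nonneg by simp
      moreover have "0 \<le> lam (w (max 0 s)) * exp (- hazard lam w s)"
        using lam_nonneg by simp
      ultimately have "s \<le> t \<Longrightarrow> ?F s * ennreal (lifetime_density lam w s)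
          \<le> ennreal (2 * ((2 * C * (t - s)) ^ n / fact n) * (C * 1))"
        by (subst ennreal_mult[symmetric]) (auto intro: ennreal_leI)
      then show "?F s * (indicator {0..t} s * ennreal (lifetime_density lam w s))
          \<le> ennreal ((2 * C) * (((2 * C) * (t - s)) ^ n / fact n)) * indicator {0..t} s"
        by (auto simp: indicator_def mult_ac)
    qed
    also have "\<dots> = ennreal ((2 * C * t) ^ Suc n / fact (Suc n))"
      using nn_integral_power_step[of "2 * C" t n] C_nonneg Suc.prems by simp
    finally show "(\<integral>\<^sup>+s. ?F s * (indicator {0..t} s * ennreal (lifetime_density lam w s)) \<partial>lborel)
      \<le> ennreal ((2 * C * t) ^ Suc n / fact (Suc n))" .
  qed
  finally show ?case
    by (simp add: P.emeasure_space_1)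
qed

lemma no_explosion:
  assumes t: "0 \<le> t"
  shows "AE y in Q x. finite (alive y t)"
proof -
  have "(\<lambda>n. (2 * C * t) ^ n / fact n) \<longlonglongrightarrow> 0"
    using summable_LIMSEQ_zero[OF summable_exp[of "2 * C * t"]] by (simp add: divide_inverse mult.commute)
  then have "(\<lambda>n. ennreal ((2 * C * t) ^ n / fact n)) \<longlonglongrightarrow> ennreal 0"
    by (rule tendsto_ennrealI)
  then have "explosion x t \<le> ennreal 0"
    by (rule LIMSEQ_le_const) (use explosion_le[OF t] in auto)
  moreover have "(\<lambda>y. indicator {y. infinite (alive y t)} y :: ennreal) \<in> borel_measurable (Q x)"
    using measurable_infinite_alive[of "\<lambda>_. t" tree_space "\<lambda>y. y"]
    by (simp add: measurable_kernel[OF Q])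
  ultimately have "AE y in Q x. indicator {y. infinite (alive y t)} y = (0 :: ennreal)"
    by (simp add: explosion_def nn_integral_0_iff_AE)
  then show ?thesis
    by eventually_elim (auto simp: indicator_def split: if_splits)
qed

text \<open>The function \<open>u(t, x)\<close>, extended to negative times by its value at 0 in order to be defined and
measurable for all real times.\<close>

definition mean_product :: "real \<Rightarrow> 'a \<Rightarrow> real" where
  "mean_product t x = (LINT y|Q x. population_product f y (max 0 t))"

lemma measurable_population_product_Q:
  assumes "0 \<le> t"
  shows "(\<lambda>y. population_product f y t) \<in> borel_measurable tree_space"
    "(\<lambda>y. population_product f y t) \<in> borel_measurable (Q x)"
proof -
  show "(\<lambda>y. population_product f y t) \<in> borel_measurable tree_space"
    by (rule measurable_population_product) (use assms in auto)
  then show "(\<lambda>y. population_product f y t) \<in> borel_measurable (Q x)"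
    by (simp add: measurable_kernel[OF Q])
qed

lemma ennreal_mean_product:
  assumes "0 \<le> t"
  shows "ennreal (mean_product t x) = (\<integral>\<^sup>+y. ennreal (population_product f y t) \<partial>Q x)"
proof -
  interpret prob_space "Q x" by (rule prob_space_kernel[OF Q])
  show ?thesis
    using assms population_product_bounds[of f, OF f_bounds] unfolding mean_product_def
    by (subst nn_integral_eq_integral)
      (auto intro!: integrable_const_bound[where B=1] measurable_population_product_Q simp: max_def)
qed

lemma mean_product_bounds: "0 \<le> mean_product t x" "mean_product t x \<le> 1"
proof -
  interpret prob_space "Q x" by (rule prob_space_kernel[OF Q])
  have i: "integrable (Q x) (\<lambda>y. population_product f y (max 0 t))"
    using population_product_bounds[of f, OF f_bounds]
    by (intro integrable_const_bound[where B=1] measurable_population_product_Q) auto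
  show "0 \<le> mean_product t x"
    unfolding mean_product_def using population_product_bounds[of f, OF f_bounds]
    by (intro Bochner_Integration.integral_nonneg) auto
  have "mean_product t x \<le> (LINT y|Q x. 1)"
    unfolding mean_product_def using population_product_bounds[of f, OF f_bounds]
    by (intro integral_mono i) auto
  then show "mean_product t x \<le> 1" by (simp add: prob_space)
qed

lemma measurable_mean_product: "case_prod mean_product \<in> borel_measurable (borel \<Otimes>\<^sub>M borel)"
proof -
  have "(\<lambda>z. population_product f (snd z) (max 0 (fst (fst z)))) \<in> borel_measurable ((borel \<Otimes>\<^sub>M borel) \<Otimes>\<^sub>M tree_space)"
    by (rule measurable_population_product) auto
  from measurable_compose[OF this measurable_ennreal]
  have "(\<lambda>z. ennreal (population_product f (snd z) (max 0 (fst (fst z))))) \<in> borel_measurable ((borel \<Otimes>\<^sub>M borel) \<Otimes>\<^sub>M tree_space)" .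
  moreover have "(\<lambda>z. Q (snd z)) \<in> (borel \<Otimes>\<^sub>M borel) \<rightarrow>\<^sub>M subprob_algebra tree_space"
    using measurable_prob_algebraD[OF Q] by (rule measurable_compose[rotated]) simp
  ultimately have "(\<lambda>z. \<integral>\<^sup>+y. ennreal (population_product f y (max 0 (fst z))) \<partial>Q (snd z)) \<in> borel_measurable (borel \<Otimes>\<^sub>M borel)"
    by (intro nn_integral_measurable_subprob_algebra2[where N=tree_space]) (simp_all add: case_prod_beta')
  moreover have "mean_product t x = enn2real (\<integral>\<^sup>+y. ennreal (population_product f y (max 0 t)) \<partial>Q x)" for t x
    using ennreal_mean_product[of "max 0 t" x] mean_product_bounds(1)[of t x]
    by (metis enn2real_ennreal max.cobounded1 max.left_idem mean_product_def)
  ultimately show ?thesis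
    by (simp add: case_prod_beta')
qed

text \<open>Either the initial particle survives until \<open>t\<close>, or it branches at some time \<open>s \<le> t\<close> and the two subtrees
contribute independent factors with mean \<open>u(t - s, X\<^sub>s)\<close>.\<close>

lemma ennreal_mean_product_equation:
  assumes t: "0 \<le> t"
  shows "ennreal (mean_product t x) =
    (\<integral>\<^sup>+w. ennreal (f (w t) * exp (- hazard lam w t)) +
      (\<integral>\<^sup>+s. indicator {0..t} s * ennreal ((mean_product (t - s) (w (max 0 s)))\<^sup>2 * lifetime_density lam w s) \<partial>lborel) \<partial>P x)"
proof -
  let ?u = mean_product
  let ?alone = "\<lambda>m. ennreal (f (path_of m t)) * indicator {m. ennreal t < lifetime m} m"
    and ?split = "\<lambda>m. ennreal ((mean_product (t - enn2real (lifetime m)) (path_of m (max 0 (enn2real (lifetime m)))))\<^sup>2) * indicator {m. lifetime m \<le> ennreal t} m"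
  let ?aloneP = "\<lambda>w. ennreal (f (w t)) * ennreal (exp (- hazard lam w t))"
    and ?splitP = "\<lambda>w. \<integral>\<^sup>+s. ennreal ((mean_product (t - s) (w (max 0 s)))\<^sup>2) * (indicator {0..t} s * ennreal (lifetime_density lam w s)) \<partial>lborel"
  note [measurable_cong] = prob_space_kernel(2)[OF K] prob_space_kernel(2)[OF P]
  have Hm: "(\<lambda>y. ennreal (population_product f y t)) \<in> borel_measurable tree_space"
    using measurable_population_product_Q[OF t] by measurable
  have "ennreal (?u t x) = (\<integral>\<^sup>+m. \<integral>\<^sup>+S. ennreal (population_product f (graft m S) t) \<partial>PiM UNIV (\<lambda>_. Q (final_position m)) \<partial>K x)"
    unfolding ennreal_mean_product[OF t] by (rule nn_integral_Q[OF Hm])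
  also have "\<dots> = (\<integral>\<^sup>+m. ?alone m + ?split m \<partial>K x)"
  proof (rule nn_integral_cong_AE)
    show "AE m in K x. (\<integral>\<^sup>+S. ennreal (population_product f (graft m S) t) \<partial>PiM UNIV (\<lambda>_. Q (final_position m))) =
      ?alone m + ?split m"
      using binary[of x]
    proof eventually_elim
      case (elim m)
      let ?s = "t - enn2real (lifetime m)" and ?Q = "Q (final_position m)"
      have Qp: "prob_space ?Q" by (rule prob_space_kernel[OF Q])
      interpret PQ: prob_space "PiM UNIV (\<lambda>_::nat. ?Q)"
        by (rule prob_space_PiM) (rule Qp)
      show ?case
      proof (cases "ennreal t < lifetime m")
        case True
        then show ?thesis
          by (simp add: population_product_before PQ.emeasure_space_1)
      next
        case False
        then have T: "lifetime m \<le> ennreal t" by simp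
        then have s: "0 \<le> ?s"
          using t by (metis diff_ge_0_iff_ge enn2real_ennreal enn2real_mono ennreal_less_top)
        have fin: "AE S in PiM UNIV (\<lambda>_. ?Q). finite (alive (S j) ?s)" for j :: nat
          using AE_PiM_component[of UNIV "\<lambda>_. ?Q" j "\<lambda>y. finite (alive y ?s)"] Qp no_explosion[OF s] by simp
        have "(\<integral>\<^sup>+S. ennreal (population_product f (graft m S) t) \<partial>PiM UNIV (\<lambda>_. ?Q)) =
           (\<integral>\<^sup>+S. ennreal (population_product f (S 0) ?s) * ennreal (population_product f (S (1::nat)) ?s) \<partial>PiM UNIV (\<lambda>_. ?Q))"
        proof (rule nn_integral_cong_AE)
          show "AE S in PiM UNIV (\<lambda>_. ?Q). ennreal (population_product f (graft m S) t) =
            ennreal (population_product f (S 0) ?s) * ennreal (population_product f (S 1) ?s)"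
            using fin[of 0] fin[of 1]
          proof eventually_elim
            case (elim S)
            then show ?case
              using population_product_bounds[of f, OF f_bounds]
              by (simp add: population_product_after[OF T t \<open>offspring m = 2\<close>] ennreal_mult)
          qed
        qed
        also have "\<dots> = ennreal (?u ?s (final_position m)) * ennreal (?u ?s (final_position m))"
          unfolding ennreal_mean_product[OF s]
          by (rule nn_integral_two_components[OF Qp]) (use measurable_population_product_Q[OF s] in measurable)
        also have "\<dots> = ennreal ((?u ?s (final_position m))\<^sup>2)"
          using mean_product_bounds(1) by (simp add: power2_eq_square ennreal_mult)
        finally show ?thesis
          using False by (simp add: final_position_def)
      qed
    qed
  qed
  also have "\<dots> = (\<integral>\<^sup>+m. ?alone m \<partial>K x) +
       (\<integral>\<^sup>+m. ?split m \<partial>K x)"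
  proof (rule nn_integral_add)
    have e: "(\<lambda>m. path_of m t) \<in> borel_measurable (K x)"
      using measurable_compose[OF measurable_particle(1) measurable_path_eval[OF t]]
      by (simp add: measurable_kernel[OF K])
    have "{m \<in> space (K x). ennreal t < lifetime m} \<in> sets (K x)"
      by measurable
    then have "(indicator {m. ennreal t < lifetime m} :: 'a particle \<Rightarrow> ennreal) \<in> borel_measurable (K x)"
      by (subst borel_measurable_indicator_iff) (simp add: Int_def conj_commute)
    moreover have "(\<lambda>m. ennreal (f (path_of m t))) \<in> borel_measurable (K x)"
      by (rule measurable_compose[OF measurable_compose[OF e f_measurable] measurable_ennreal])
    ultimately show "(\<lambda>m. ?alone m) \<in> borel_measurable (K x)"
      by (rule borel_measurable_times_ennreal[rotated])
    have [measurable]: "(\<lambda>m. path_of m (max 0 (enn2real (lifetime m)))) \<in> borel_measurable (K x)"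
      by (rule measurable_path_eval_compose) measurable
    have [measurable]: "(\<lambda>m. ?u (t - enn2real (lifetime m)) (path_of m (max 0 (enn2real (lifetime m))))) \<in> borel_measurable (K x)"
      by (rule measurable_Pair_compose_split[OF measurable_mean_product]) measurable
    show "(\<lambda>m. ?split m) \<in> borel_measurable (K x)"
      by measurable
  qed
  also have "(\<integral>\<^sup>+m. ?alone m \<partial>K x) =
     (\<integral>\<^sup>+w. ?aloneP w \<partial>P x)"
    by (rule nn_integral_survival[where G="\<lambda>w. ennreal (f (w t))"]) (use t in measurable)
  also have "(\<integral>\<^sup>+m. ?split m \<partial>K x) =
    (\<integral>\<^sup>+w. ?splitP w \<partial>P x)"
  proof (rule nn_integral_branching[where F="\<lambda>w s. ennreal ((?u (t - s) (w (max 0 s)))\<^sup>2)", OF _ t])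
    have [measurable]: "(\<lambda>z. (fst z) (max 0 (snd z))) \<in> borel_measurable (path_space \<Otimes>\<^sub>M borel :: ('a path \<times> real) measure)"
      by (rule measurable_path_eval_compose) measurable
    have [measurable]: "(\<lambda>z. ?u (t - snd z) ((fst z) (max 0 (snd z)))) \<in> borel_measurable (path_space \<Otimes>\<^sub>M borel :: ('a path \<times> real) measure)"
      by (rule measurable_Pair_compose_split[OF measurable_mean_product]) measurable
    show "(\<lambda>(w, s). ennreal ((?u (t - s) (w (max 0 s)))\<^sup>2)) \<in> borel_measurable (path_space \<Otimes>\<^sub>M borel :: ('a path \<times> real) measure)"
      unfolding case_prod_beta' by measurable
  qed
  also have "(\<integral>\<^sup>+w. ?aloneP w \<partial>P x) +
    (\<integral>\<^sup>+w. ?splitP w \<partial>P x) =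
    (\<integral>\<^sup>+w. ?aloneP w + ?splitP w \<partial>P x)"
  proof (rule nn_integral_add[symmetric])
    have [measurable]: "(\<lambda>w. w t) \<in> borel_measurable (P x)"
      using measurable_path_eval[OF t] by (simp add: measurable_kernel[OF P])
    show "(\<lambda>w. ?aloneP w) \<in> borel_measurable (P x)"
      by measurable
    have [measurable]: "(\<lambda>z. (fst z) (max 0 (snd z))) \<in> borel_measurable (P x \<Otimes>\<^sub>M lborel)"
      by (rule measurable_path_eval_compose) measurable
    have [measurable]: "(\<lambda>z. ?u (t - snd z) ((fst z) (max 0 (snd z)))) \<in> borel_measurable (P x \<Otimes>\<^sub>M lborel)"
      by (rule measurable_Pair_compose_split[OF measurable_mean_product]) measurable
    show "(\<lambda>w. ?splitP w) \<in> borel_measurable (P x)"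
      by (intro lborel.borel_measurable_nn_integral) (simp add: case_prod_beta')
  qed
  also have "\<dots> = (\<integral>\<^sup>+w. ennreal (f (w t) * exp (- hazard lam w t)) +
      (\<integral>\<^sup>+s. indicator {0..t} s * ennreal ((?u (t - s) (w (max 0 s)))\<^sup>2 * lifetime_density lam w s) \<partial>lborel) \<partial>P x)"
    using f_bounds lam_nonneg
    by (intro nn_integral_cong arg_cong2[where f="(+)"]) (auto simp: ennreal_mult mult_ac)
  finally show ?thesis .
qed

end

section \<open>The Markov property\<close>

lemma integral_set_integral_swap:
  fixes h :: "'w \<Rightarrow> real \<Rightarrow> real"
  assumes M: "prob_space M" and h[measurable]: "case_prod h \<in> borel_measurable (M \<Otimes>\<^sub>M borel)"
    and bd: "\<And>w r. w \<in> space M \<Longrightarrow> r \<in> {a..b} \<Longrightarrow> \<bar>h w r\<bar> \<le> D"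
  shows "(LINT w|M. (LINT r:{a..b}|lborel. h w r)) = (LINT r:{a..b}|lborel. (LINT w|M. h w r))"
proof -
  interpret M: prob_space M by fact
  interpret pair_sigma_finite M lborel ..
  have [measurable]: "case_prod h \<in> borel_measurable (M \<Otimes>\<^sub>M lborel)"
    using h by (simp cong: measurable_cong_sets sets_pair_measure_cong)
  have fin: "emeasure (M \<Otimes>\<^sub>M lborel) (space M \<times> {a..b}) < \<infinity>"
    by (subst lborel.emeasure_pair_measure_Times) (auto simp: M.emeasure_space_1 emeasure_lborel_Icc_eq)
  have "integrable (M \<Otimes>\<^sub>M lborel) (\<lambda>z. D * indicator (space M \<times> {a..b}) z)"
    using fin by (intro integrable_mult_right integrable_real_indicator) auto
  then have i: "integrable (M \<Otimes>\<^sub>M lborel) (\<lambda>(w, r). indicator {a..b} r * h w r)"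
    by (rule Bochner_Integration.integrable_bound)
       (auto simp: space_pair_measure indicator_def intro!: AE_I2 order_trans[OF bd])
  show ?thesis
    using Fubini_integral[OF i] by (simp add: set_lebesgue_integral_def)
qed

context branching_particle
begin

lemma filtration_path: "filtration (space (path_space :: 'a path measure)) path_filtration"
  by unfold_locales (auto intro: sets_natural_filtration_mono[THEN subsetD])

lemma sets_path_filtration_subset: "sets (path_filtration s :: 'a path measure) \<subseteq> sets path_space"
  by (rule sets_natural_filtration_subset) measurable

lemma measurable_from_path_filtration:
  "g \<in> borel_measurable (path_filtration s :: 'a path measure) \<Longrightarrow> g \<in> borel_measurable path_space"
  using sets_path_filtration_subset[of s] by (auto simp: measurable_def)

lemma subalgebra_path: "subalgebra (P x) (path_filtration s)"
  using sets_path_filtration_subset prob_space_kernel[OF P]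
  by (auto simp: subalgebra_def)

text \<open>The strong Markov property at the constant time \<open>r\<close>. The past of a constant stopping time is the
filtration at that time.\<close>

lemma markov_sets:
  assumes sm: "strong_markov P" and r: "0 \<le> r"
    and A: "A \<in> sets (path_filtration (ennreal r))" and B: "B \<in> sets path_space"
  shows "emeasure (P x) (A \<inter> {w \<in> space path_space. shift r w \<in> B}) = (\<integral>\<^sup>+w. indicator A w * emeasure (P (w r)) B \<partial>P x)"
proof -
  interpret P: prob_space "P x" by (rule prob_space_kernel[OF P])
  interpret F: filtration "space (path_space :: 'a path measure)" path_filtration by (rule filtration_path)
  let ?\<tau> = "\<lambda>_ :: 'a path. ennreal r"
  have st: "stopping_time path_filtration ?\<tau>" by (rule stopping_time_const)
  let ?G = "F.pre_sigma ?\<tau>"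
  have sG: "A \<in> sets (path_filtration (ennreal r))" if "A \<in> sets ?G" for A
    using F.sets_pre_sigmaD[OF st that, of "ennreal r"] by simp
  have CG: "A \<in> sets ?G"
  proof (rule F.sets_pre_sigmaI[OF st])
    fix u show "{\<omega> \<in> A. ennreal r \<le> u} \<in> sets (path_filtration u)"
      using A F.sets_F_mono[of "ennreal r" u] by (cases "ennreal r \<le> u") auto
  qed
  have sub: "subalgebra (P x) ?G"
    using sG sets_path_filtration_subset by (auto simp: subalgebra_def F.space_pre_sigma prob_space_kernel[OF P])
  interpret finite_measure_subalgebra "P x" ?G
    using sub by unfold_locales
  let ?S = "{w \<in> space path_space. shift r w \<in> B}"
  have S[measurable]: "?S \<in> sets (P x)"
    using measurable_sets[OF measurable_shift[OF r] B] by (simp add: prob_space_kernel(2)[OF P] vimage_def Int_def conj_commute)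
  have Cx[measurable]: "A \<in> sets (P x)"
    using A sets_path_filtration_subset by (auto simp: prob_space_kernel(2)[OF P])
  have ce: "AE w in P x. real_cond_exp (P x) ?G (indicator ?S) w = measure (P (w r)) B"
    using sm st B r unfolding strong_markov_def by (force simp: less_top[symmetric])
  have er: "(\<lambda>w. w r) \<in> borel_measurable (P x)"
    using measurable_path_eval[OF r] by (simp add: measurable_kernel[OF P])
  have PB: "(\<lambda>y. measure (P y) B) \<in> borel_measurable borel" "(\<lambda>y. emeasure (P y) B) \<in> borel_measurable borel"
    by (rule measurable_compose[OF measurable_prob_algebraD[OF P] measurable_measure_subprob_algebra[OF B]],
        rule measurable_compose[OF measurable_prob_algebraD[OF P] measurable_emeasure_subprob_algebra[OF B]])
  have mB[measurable]: "(\<lambda>w. measure (P (w r)) B) \<in> borel_measurable (P x)"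
    by (rule measurable_compose[OF er PB(1)])
  have "measure (P x) (A \<inter> ?S) = (LINT w:A|P x. indicator ?S w)"
    by (simp add: set_lebesgue_integral_def indicator_inter_arith[symmetric])
  also have "\<dots> = (LINT w:A|P x. real_cond_exp (P x) ?G (indicator ?S) w)"
    by (intro real_cond_exp_intA CG P.integrable_const_bound[where B=1]) auto
  also have "\<dots> = (LINT w|P x. indicator A w * measure (P (w r)) B)"
    unfolding set_lebesgue_integral_def
  proof (rule integral_cong_AE)
    show "AE w in P x. indicator A w *\<^sub>R real_cond_exp (P x) ?G (indicator ?S) w = indicator A w * measure (P (w r)) B"
      using ce by eventually_elim simp
  qed measurable
  finally have m: "measure (P x) (A \<inter> ?S) = (LINT w|P x. indicator A w * measure (P (w r)) B)" .
  have le1: "measure (P y) B \<le> 1" for y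
    using prob_space.prob_le_1[OF prob_space_kernel(1)[OF P]] .
  have "(\<integral>\<^sup>+w. indicator A w * emeasure (P (w r)) B \<partial>P x) = (\<integral>\<^sup>+w. ennreal (indicator A w * measure (P (w r)) B) \<partial>P x)"
    by (intro nn_integral_cong)
       (auto simp: indicator_def finite_measure.emeasure_eq_measure[OF prob_space.finite_measure[OF prob_space_kernel(1)[OF P]]])
  also have "\<dots> = ennreal (LINT w|P x. indicator A w * measure (P (w r)) B)"
    using le1 by (intro nn_integral_eq_integral P.integrable_const_bound[where B=1] AE_I2) (auto simp: indicator_def)
  finally show ?thesis
    by (simp add: m[symmetric] P.emeasure_eq_measure)
qed

text \<open>For a fixed event of the past, both sides are integrals of \<open>G\<close> against measures on path space, which
coincide by \<open>markov_sets\<close>.\<close>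

lemma markov_nn_integral:
  assumes sm: "strong_markov P" and r: "0 \<le> r"
    and A: "A \<in> sets (path_filtration (ennreal r))" and G[measurable]: "G \<in> borel_measurable path_space"
  shows "(\<integral>\<^sup>+w. indicator A w * G (shift r w) \<partial>P x) = (\<integral>\<^sup>+w. indicator A w * (\<integral>\<^sup>+w'. G w' \<partial>P (w r)) \<partial>P x)"
proof -
  let ?\<rho> = "density (P x) (indicator A)"
  note [measurable_cong] = prob_space_kernel(2)[OF P]
  have Cx[measurable]: "A \<in> sets (P x)"
    using A sets_path_filtration_subset by (auto simp: prob_space_kernel(2)[OF P])
  have er: "(\<lambda>w. w r) \<in> borel_measurable path_space"
    by (rule measurable_path_eval[OF r])
  have k: "(\<lambda>w. P (w r)) \<in> path_space \<rightarrow>\<^sub>M subprob_algebra path_space"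
    by (rule measurable_compose[OF er measurable_prob_algebraD[OF P]])
  have k': "(\<lambda>w. P (w r)) \<in> ?\<rho> \<rightarrow>\<^sub>M subprob_algebra path_space"
    using k by (simp add: measurable_kernel[OF P])
  have ne: "space ?\<rho> \<noteq> {}"
    using prob_space.not_empty[OF prob_space_kernel(1)[OF P]] by simp
  have sh: "shift r \<in> ?\<rho> \<rightarrow>\<^sub>M path_space" "shift r \<in> P x \<rightarrow>\<^sub>M path_space"
    using measurable_shift[OF r] by (simp_all cong: measurable_cong_sets add: prob_space_kernel(2)[OF P])
  have Gm: "(\<lambda>w. \<integral>\<^sup>+w'. G w' \<partial>P (w r)) \<in> borel_measurable (P x)"
    using measurable_compose[OF k nn_integral_measurable_subprob_algebra[OF G]]
    by (simp add: measurable_kernel[OF P])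
  have "distr ?\<rho> path_space (shift r) = ?\<rho> \<bind> (\<lambda>w. P (w r))"
  proof (rule measure_eqI)
    show "sets (distr ?\<rho> path_space (shift r)) = sets (?\<rho> \<bind> (\<lambda>w. P (w r)))"
      using ne by (simp add: sets_bind[OF prob_space_kernel(2)[OF P]])
    fix B assume "B \<in> sets (distr ?\<rho> path_space (shift r))"
    then have B[measurable]: "B \<in> sets path_space" by simp
    have Bm: "shift r -` B \<inter> space (P x) \<in> sets (P x)"
      by (rule measurable_sets[OF sh(2) B])
    have Pm: "(\<lambda>w. emeasure (P (w r)) B) \<in> borel_measurable (P x)"
      using measurable_compose[OF k measurable_emeasure_subprob_algebra[OF B]]
      by (simp add: measurable_kernel[OF P])
    have "emeasure (distr ?\<rho> path_space (shift r)) B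
        = emeasure ?\<rho> (shift r -` B \<inter> space (P x))"
      using sh by (subst emeasure_distr) auto
    also have "\<dots> = (\<integral>\<^sup>+w. indicator A w * indicator (shift r -` B \<inter> space (P x)) w \<partial>P x)"
      using Bm by (intro emeasure_density) auto
    also have "\<dots> = (\<integral>\<^sup>+w. indicator (A \<inter> {w \<in> space path_space. shift r w \<in> B}) w \<partial>P x)"
      by (intro nn_integral_cong) (auto simp: indicator_def prob_space_kernel(3)[OF P])
    also have "\<dots> = emeasure (P x) (A \<inter> {w \<in> space path_space. shift r w \<in> B})"
      using Bm by (intro nn_integral_indicator sets.Int Cx) (simp add: prob_space_kernel(3)[OF P] vimage_def Int_def conj_commute)
    also have "\<dots> = (\<integral>\<^sup>+w. indicator A w * emeasure (P (w r)) B \<partial>P x)"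
      by (rule markov_sets[OF sm r A B])
    also have "\<dots> = (\<integral>\<^sup>+w. emeasure (P (w r)) B \<partial>?\<rho>)"
      using Pm by (subst nn_integral_density) auto
    also have "\<dots> = emeasure (?\<rho> \<bind> (\<lambda>w. P (w r))) B"
      by (rule emeasure_bind[OF ne k' B, symmetric])
    finally show "emeasure (distr ?\<rho> path_space (shift r)) B
        = emeasure (?\<rho> \<bind> (\<lambda>w. P (w r))) B" .
  qed
  then have "(\<integral>\<^sup>+w. G w \<partial>distr ?\<rho> path_space (shift r)) =
      (\<integral>\<^sup>+w. G w \<partial>(?\<rho> \<bind> (\<lambda>w. P (w r))))"
    by simp
  moreover have "(\<integral>\<^sup>+w. G w \<partial>distr ?\<rho> path_space (shift r)) = (\<integral>\<^sup>+w. indicator A w * G (shift r w) \<partial>P x)"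
  proof -
    have "(\<lambda>w. G (shift r w)) \<in> borel_measurable (P x)"
      by (rule measurable_compose[OF sh(2) G])
    then show ?thesis
      using sh by (subst nn_integral_distr) (auto simp: nn_integral_density)
  qed
  moreover have "(\<integral>\<^sup>+w. G w \<partial>(?\<rho> \<bind> (\<lambda>w. P (w r)))) = (\<integral>\<^sup>+w. indicator A w * (\<integral>\<^sup>+w'. G w' \<partial>P (w r)) \<partial>P x)"
    unfolding nn_integral_bind[OF G k'] using Gm by (subst nn_integral_density) auto
  ultimately show ?thesis by simp
qed

text \<open>The form in which the Markov property is applied: \<open>Z\<close> is a bounded weight known at time \<open>r\<close>.\<close>

lemma markov_integral:
  fixes Z G :: "'a path \<Rightarrow> real"
  assumes sm: "strong_markov P" and r: "0 \<le> r"
    and Z[measurable]: "Z \<in> borel_measurable (path_filtration (ennreal r))" and Zb: "\<And>w. w \<in> space path_space \<Longrightarrow> \<bar>Z w\<bar> \<le> D"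
    and G: "G \<in> borel_measurable path_space" and Gb: "\<And>w. w \<in> space path_space \<Longrightarrow> 0 \<le> G w \<and> G w \<le> 1"
  shows "(LINT w|P x. Z w * G (shift r w)) = (LINT w|P x. Z w * (LINT w'|P (w r). G w'))"
proof -
  interpret P: prob_space "P x" by (rule prob_space_kernel[OF P])
  interpret finite_measure_subalgebra "P x" "path_filtration (ennreal r)"
    using subalgebra_path by unfold_locales
  note sp = prob_space_kernel(3)[OF P]
  have sh: "shift r \<in> P x \<rightarrow>\<^sub>M path_space"
    using measurable_shift[OF r] by (simp add: measurable_kernel[OF P])
  have Gs: "(\<lambda>w. G (shift r w)) \<in> borel_measurable (P x)"
    by (rule measurable_compose[OF sh G])
  have Gsb: "0 \<le> G (shift r w) \<and> G (shift r w) \<le> 1" if "w \<in> space (P x)" for w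
    using Gb measurable_space[OF sh that] by auto
  have Gi: "integrable (P y) G" for y
  proof -
    interpret Py: prob_space "P y" by (rule prob_space_kernel[OF P])
    show ?thesis
    proof (rule Py.integrable_const_bound[where B=1])
    show "AE w in P y. norm (G w) \<le> 1"
      using Gb by (auto simp: sp intro!: AE_I2)
    show "G \<in> borel_measurable (P y)"
      using G by (simp add: measurable_kernel[OF P])
    qed
  qed
  have hb: "0 \<le> (LINT w'|P y. G w') \<and> (LINT w'|P y. G w') \<le> 1" for y
  proof
    show "0 \<le> (LINT w'|P y. G w')"
      using Gb by (intro integral_nonneg_AE AE_I2) (auto simp: sp)
    have "(LINT w'|P y. G w') \<le> (LINT w'|P y. 1)"
      using Gb prob_space_kernel(1)[OF P] 
      by (intro integral_mono Gi finite_measure.integrable_const prob_space.finite_measure) (auto simp: sp)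
    then show "(LINT w'|P y. G w') \<le> 1"
      by (simp add: prob_space.prob_space[OF prob_space_kernel(1)[OF P]])
  qed
  have nnG: "(\<integral>\<^sup>+w'. ennreal (G w') \<partial>P y) = ennreal (LINT w'|P y. G w')" for y
    using Gb by (intro nn_integral_eq_integral Gi AE_I2) (auto simp: sp)
  have "(\<lambda>y. enn2real (\<integral>\<^sup>+w'. ennreal (G w') \<partial>P y)) \<in> borel_measurable borel"
    using measurable_compose[OF measurable_prob_algebraD[OF P] nn_integral_measurable_subprob_algebra[OF measurable_compose[OF G measurable_ennreal]]]
    by measurable
  then have hm: "(\<lambda>y. LINT w'|P y. G w') \<in> borel_measurable borel"
    using hb by (simp add: nnG)
  have hF: "(\<lambda>w. LINT w'|P (w r). G w') \<in> borel_measurable (path_filtration (ennreal r))"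
    by (rule measurable_compose[OF measurable_natural_filtration[where X="\<lambda>s w. w s", OF r order_refl] hm])
  have hP: "(\<lambda>w. LINT w'|P (w r). G w') \<in> borel_measurable (P x)"
    by (rule measurable_from_subalg[OF subalgebra_path hF])
  have ZP: "Z \<in> borel_measurable (P x)"
    by (rule measurable_from_subalg[OF subalgebra_path Z])
  have hi: "integrable (P x) (\<lambda>w. LINT w'|P (w r). G w')"
    using hP hb by (intro P.integrable_const_bound[where B=1]) auto
  have Gsi: "integrable (P x) (\<lambda>w. G (shift r w))"
    using Gs Gsb by (intro P.integrable_const_bound[where B=1] AE_I2) auto
  have ce: "AE w in P x. real_cond_exp (P x) (path_filtration (ennreal r)) (\<lambda>w. G (shift r w)) w = (LINT w'|P (w r). G w')"
  proof (rule real_cond_exp_charact[OF _ Gsi hi hF])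
    fix A assume A: "A \<in> sets (path_filtration (ennreal r) :: 'a path measure)"
    then have [measurable]: "A \<in> sets (P x)"
      using sets_path_filtration_subset by (auto simp: prob_space_kernel(2)[OF P])
    have "ennreal (LINT w:A|P x. G (shift r w)) = (\<integral>\<^sup>+w. ennreal (indicator A w * G (shift r w)) \<partial>P x)"
      unfolding set_lebesgue_integral_def using Gsb integrable_mult_indicator[OF \<open>A \<in> sets (P x)\<close> Gsi]
      by (subst nn_integral_eq_integral) (auto simp: indicator_def intro!: AE_I2)
    also have "\<dots> = (\<integral>\<^sup>+w. indicator A w * ennreal (G (shift r w)) \<partial>P x)"
      by (intro nn_integral_cong) (auto simp: indicator_def)
    also have "\<dots> = (\<integral>\<^sup>+w. indicator A w * (\<integral>\<^sup>+w'. ennreal (G w') \<partial>P (w r)) \<partial>P x)"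
      by (rule markov_nn_integral[OF sm r A measurable_compose[OF G measurable_ennreal]])
    also have "\<dots> = (\<integral>\<^sup>+w. ennreal (indicator A w * (LINT w'|P (w r). G w')) \<partial>P x)"
      by (intro nn_integral_cong) (auto simp: indicator_def nnG)
    also have "\<dots> = ennreal (LINT w:A|P x. (LINT w'|P (w r). G w'))"
      unfolding set_lebesgue_integral_def using hb integrable_mult_indicator[OF \<open>A \<in> sets (P x)\<close> hi]
      by (subst nn_integral_eq_integral) (auto simp: indicator_def intro!: AE_I2)
    finally show "(LINT w:A|P x. G (shift r w)) = (LINT w:A|P x. (LINT w'|P (w r). G w'))"
      using Gsb hb unfolding set_lebesgue_integral_def
      by (subst (asm) ennreal_inj) (auto intro!: integral_nonneg_AE AE_I2)
  qed
  have i: "integrable (P x) (\<lambda>w. Z w * G (shift r w))"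
  proof (rule P.integrable_const_bound[where B=D])
    show "AE w in P x. norm (Z w * G (shift r w)) \<le> D"
    proof (rule AE_I2)
      fix w assume w: "w \<in> space (P x)"
      then have "\<bar>Z w\<bar> * \<bar>G (shift r w)\<bar> \<le> D * 1"
        using Zb[of w] Gsb[OF w] by (intro mult_mono) (auto simp: sp)
      then show "norm (Z w * G (shift r w)) \<le> D" by (simp add: abs_mult)
    qed
  qed (use ZP Gs in measurable)
  have "(LINT w|P x. Z w * G (shift r w)) = (LINT w|P x. Z w * real_cond_exp (P x) (path_filtration (ennreal r)) (\<lambda>w. G (shift r w)) w)"
    by (rule real_cond_exp_intg(2)[OF i Z Gs, symmetric])
  also have "\<dots> = (LINT w|P x. Z w * (LINT w'|P (w r). G w'))"
    using ce ZP hP by (intro integral_cong_AE) (auto elim!: eventually_mono)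
  finally show ?thesis .
qed

end

section \<open>The optimal martingale\<close>

locale binary_branching_markov = binary_branching +
  assumes markov: "strong_markov P"
begin

text \<open>The function \<open>v = 1 - u\<close>.\<close>

definition mean_defect :: "real \<Rightarrow> 'a \<Rightarrow> real" where
  "mean_defect t x = 1 - mean_product t x"

lemma mean_defect_bounds: "0 \<le> mean_defect t x" "mean_defect t x \<le> 1"
  using mean_product_bounds[of t x] by (auto simp: mean_defect_def)

lemma measurable_mean_defect: "case_prod mean_defect \<in> borel_measurable (borel \<Otimes>\<^sub>M borel)"
  using measurable_mean_product unfolding mean_defect_def case_prod_beta' by measurable

text \<open>The process \<open>w\<^sub>s exp (- H\<^sub>s)\<close>.\<close>

definition discounted_defect :: "real \<Rightarrow> 'a path \<Rightarrow> real \<Rightarrow> real" where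
  "discounted_defect t w r = mean_defect (t - r) (w (max 0 r)) * exp (- hazard lam w r)"

text \<open>The factor \<open>2 - v\<close> comes from \<open>1 - (1 - v)\<^sup>2 = v (2 - v)\<close>, the defect produced by two offspring.\<close>

definition branching_gain :: "real \<Rightarrow> real \<Rightarrow> 'a \<Rightarrow> real" where
  "branching_gain t r x = lam x * (2 - mean_defect (t - r) x)"

definition gain_integral :: "real \<Rightarrow> 'a path \<Rightarrow> real \<Rightarrow> real" where
  "gain_integral t w s = (LINT r:{0..s}|lborel. branching_gain t r (w r) * discounted_defect t w r)"

lemma discounted_defect_bounds: "0 \<le> discounted_defect t w r" "discounted_defect t w r \<le> 1"
  unfolding discounted_defect_def using mean_defect_bounds[of "t - r" "w (max 0 r)"] hazard_nonneg[of w r]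
  by (auto intro!: mult_le_one)

lemma branching_gain_bounds: "0 \<le> branching_gain t r x" "branching_gain t r x \<le> 2 * C"
proof -
  have "lam x * (2 - mean_defect (t - r) x) \<le> C * 2"
    using mean_defect_bounds[of "t - r" x] lam_nonneg[of x] lam_le[of x] C_nonneg by (intro mult_mono) auto
  then show "0 \<le> branching_gain t r x" "branching_gain t r x \<le> 2 * C"
    unfolding branching_gain_def using mean_defect_bounds[of "t - r" x] lam_nonneg[of x] by auto
qed

lemma measurable_branching_gain: "case_prod (branching_gain t) \<in> borel_measurable (borel \<Otimes>\<^sub>M borel)"
proof -
  have [measurable]: "(\<lambda>z. mean_defect (t - fst z) (snd z)) \<in> borel_measurable (borel \<Otimes>\<^sub>M borel)"
    by (rule measurable_Pair_compose_split[OF measurable_mean_defect]) measurable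
  show ?thesis
    unfolding branching_gain_def case_prod_beta' by measurable
qed

lemma measurable_discounted_defect:
  assumes g[measurable]: "g \<in> borel_measurable M" and h[measurable]: "h \<in> M \<rightarrow>\<^sub>M path_space"
  shows "(\<lambda>x. discounted_defect t (h x) (g x)) \<in> borel_measurable M"
proof -
  have [measurable]: "(\<lambda>x. h x (max 0 (g x))) \<in> borel_measurable M"
    by (rule measurable_path_eval_compose) measurable
  have [measurable]: "(\<lambda>x. mean_defect (t - g x) (h x (max 0 (g x)))) \<in> borel_measurable M"
    by (rule measurable_Pair_compose_split[OF measurable_mean_defect]) measurable
  show ?thesis
    unfolding discounted_defect_def by measurable
qed

lemma gain_integral_alt:
  "gain_integral t w s = (LINT r|lborel. indicator {0..s} r * (branching_gain t r (w (max 0 r)) * discounted_defect t w r))"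
  unfolding gain_integral_def set_lebesgue_integral_def
  by (rule Bochner_Integration.integral_cong) (auto simp: indicator_def)

lemma measurable_gain_product:
  assumes g[measurable]: "g \<in> borel_measurable M" and h[measurable]: "h \<in> M \<rightarrow>\<^sub>M path_space"
  shows "(\<lambda>x. branching_gain t (g x) (h x (max 0 (g x)))) \<in> borel_measurable M"
  by (rule measurable_Pair_compose_split[OF measurable_branching_gain g measurable_path_eval_compose[OF g h]])

lemma measurable_gain_integral:
  assumes g[measurable]: "g \<in> borel_measurable M" and h[measurable]: "h \<in> M \<rightarrow>\<^sub>M path_space"
  shows "(\<lambda>x. gain_integral t (h x) (g x)) \<in> borel_measurable M"
proof -
  have [measurable]: "(\<lambda>z. branching_gain t (snd z) (h (fst z) (max 0 (snd z)))) \<in> borel_measurable (M \<Otimes>\<^sub>M lborel)"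
    by (rule measurable_gain_product) measurable
  have [measurable]: "(\<lambda>z. discounted_defect t (h (fst z)) (snd z)) \<in> borel_measurable (M \<Otimes>\<^sub>M lborel)"
    by (rule measurable_discounted_defect) measurable
  have [measurable]: "Measurable.pred (M \<Otimes>\<^sub>M lborel) (\<lambda>z. snd z \<in> {0..g (fst z)})"
    by simp
  show ?thesis
    unfolding gain_integral_alt
    by (intro lborel.borel_measurable_lebesgue_integral) (simp add: case_prod_beta')
qed

lemma primitive_hazard:
  assumes "w \<in> space path_space"
  shows "primitive_of (\<lambda>r. if r < 0 then 0 else lam (w (max 0 r))) (hazard lam w)"
  by (rule primitive_of_path_integral[OF lam_joint_measurable _ assms, of C])
     (use lam_nonneg lam_le in auto)

lemma primitive_gain:
  assumes "w \<in> space path_space"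
  shows "primitive_of (\<lambda>r. if r < 0 then 0 else branching_gain t r (w (max 0 r))) (path_integral (branching_gain t) w)"
  by (rule primitive_of_path_integral[OF measurable_branching_gain _ assms, of t "2 * C"])
     (use branching_gain_bounds in auto)

lemma primitive_gain_integral:
  assumes w: "w \<in> space path_space"
  shows "primitive_of (\<lambda>r. (if r < 0 then 0 else branching_gain t r (w (max 0 r))) * discounted_defect t w r) (gain_integral t w)"
proof -
  have [measurable]: "(\<lambda>r. discounted_defect t w r) \<in> borel_measurable borel"
    using w by (intro measurable_discounted_defect[where h="\<lambda>_. w"]) auto
  note [measurable] = primitive_of_measurable[OF primitive_gain[OF w, of t]]
  have "gain_integral t w = (\<lambda>s. LINT r:{0..s}|lborel. (if r < 0 then 0 else branching_gain t r (w (max 0 r))) * discounted_defect t w r)"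
    unfolding gain_integral_def set_lebesgue_integral_def
    by (intro ext Bochner_Integration.integral_cong) (auto simp: indicator_def)
  moreover have "\<bar>branching_gain t r x * discounted_defect t w r\<bar> \<le> 2 * C * 1" for r x
    using branching_gain_bounds[of t r x] discounted_defect_bounds[of t w r] C_nonneg
    unfolding abs_mult by (intro mult_mono) auto
  ultimately show ?thesis
    by (auto intro!: primitive_of_integral_from_0[where C="2 * C"])
qed

lemma gain_integral_bounds:
  assumes w: "w \<in> space path_space" and "0 \<le> a" "a \<le> b"
  shows "0 \<le> gain_integral t w b - gain_integral t w a" "gain_integral t w b - gain_integral t w a \<le> 2 * C * (b - a)"
proof -
  let ?k = "\<lambda>r. (if r < 0 then 0 else branching_gain t r (w (max 0 r))) * discounted_defect t w r"
  have eq: "gain_integral t w b - gain_integral t w a = (LINT r:{a..b}|lborel. ?k r)"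
    by (rule primitive_of_diff[OF primitive_gain_integral[OF w] assms(3)])
  have k0: "0 \<le> ?k r" for r
    using branching_gain_bounds[of t r "w (max 0 r)"] discounted_defect_bounds[of t w r] by auto
  then show "0 \<le> gain_integral t w b - gain_integral t w a"
    unfolding eq set_lebesgue_integral_def by (intro Bochner_Integration.integral_nonneg) (auto simp: indicator_def)
  have "\<bar>?k r\<bar> \<le> 2 * C * 1" for r
    using branching_gain_bounds[of t r "w (max 0 r)"] discounted_defect_bounds[of t w r] C_nonneg
    unfolding abs_mult by (intro mult_mono) auto
  then have "\<bar>LINT r:{a..b}|lborel. ?k r\<bar> \<le> 2 * C * (b - a)"
    using assms(3) primitive_of_measurable[OF primitive_gain_integral[OF w]]
    by (intro abs_set_integral_le) auto
  then show "gain_integral t w b - gain_integral t w a \<le> 2 * C * (b - a)"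
    unfolding eq by linarith
qed

lemma hazard_additive:
  assumes w: "w \<in> space path_space" and "0 \<le> r" "0 \<le> s"
  shows "hazard lam (shift r w) s = hazard lam w (r + s) - hazard lam w r"
proof -
  have "hazard lam (shift r w) s = (LINT q:{r..r + s}|lborel. lam (w q))"
    by (rule path_integral_shift[OF assms(2)])
  also have "\<dots> = (LINT q:{r..r + s}|lborel. if q < 0 then 0 else lam (w (max 0 q)))"
    by (rule set_lebesgue_integral_cong) (use assms in auto)
  also have "\<dots> = hazard lam w (r + s) - hazard lam w r"
    by (rule primitive_of_diff[OF primitive_hazard[OF w], symmetric]) (use assms in simp)
  finally show ?thesis .
qed

lemma gain_integral_0: "gain_integral t w 0 = 0"
  unfolding gain_integral_def using path_integral_0[of "\<lambda>r _. branching_gain t r (w r) * discounted_defect t w r" w]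
  by (simp add: path_integral_def)

text \<open>The first-branching equation subtracted from \<open>1 = exp (- H\<^sub>t) + \<integral>\<^sub>0\<^sup>t lam(X\<^sub>s) exp (- H\<^sub>s) ds\<close>.\<close>

lemma mean_defect_equation:
  assumes t: "0 \<le> t"
  defines "G \<equiv> \<lambda>w. (1 - f (w t)) * exp (- hazard lam w t) + gain_integral t w t"
  shows "mean_defect t x = (LINT w|P x. G w)"
    and "w \<in> space path_space \<Longrightarrow> 0 \<le> G w \<and> G w \<le> 1"
    and "G \<in> borel_measurable path_space"
proof -
  interpret P: prob_space "P x" by (rule prob_space_kernel[OF P])
  have [measurable]: "(\<lambda>w. w t) \<in> borel_measurable path_space"
    by (rule measurable_path_eval[OF t])
  have [measurable]: "(\<lambda>w. gain_integral t w t) \<in> borel_measurable path_space"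
    by (rule measurable_gain_integral) measurable
  show Gm: "G \<in> borel_measurable path_space"
    unfolding G_def by measurable
  let ?H = "\<lambda>w. \<integral>\<^sup>+s. indicator {0..t} s * ennreal ((mean_product (t - s) (w (max 0 s)))\<^sup>2 * lifetime_density lam w s) \<partial>lborel"
  have G: "G w \<ge> 0 \<and> G w \<le> 1 \<and> ennreal (f (w t) * exp (- hazard lam w t)) + ?H w = ennreal (1 - G w)"
    if w: "w \<in> space path_space" for w
  proof -
    let ?u = "\<lambda>s. mean_product (t - s) (w (max 0 s))"
    let ?l = "\<lambda>s. (if s < 0 then 0 else lam (w (max 0 s))) * exp (- hazard lam w s)"
    have pl: "primitive_of (\<lambda>s. - ?l s) (\<lambda>s. exp (- hazard lam w s))"
      using primitive_of_exp[OF primitive_of_cmult[OF primitive_hazard[OF w], of "-1"]] by simp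
    have ml[measurable]: "?l \<in> borel_measurable borel"
      using borel_measurable_uminus[OF primitive_of_measurable[OF pl]] by simp
    have ev: "(\<lambda>r. w (max 0 r)) \<in> borel_measurable borel"
      using measurable_path_eval_compose[of "\<lambda>r. r" borel "\<lambda>_. w"] w by simp
    have mu[measurable]: "?u \<in> borel_measurable borel"
      by (rule measurable_Pair_compose_split[OF measurable_mean_product _ ev]) simp
    have lb: "0 \<le> ?l s" "?l s \<le> C" for s
    proof -
      have "lam (w (max 0 s)) * exp (- hazard lam w s) \<le> C * 1"
        using lam_le lam_nonneg hazard_nonneg C_nonneg by (intro mult_mono) auto
      then show "0 \<le> ?l s" "?l s \<le> C"
        using lam_nonneg C_nonneg by auto
    qed
    have ub: "0 \<le> (?u s)\<^sup>2" "(?u s)\<^sup>2 \<le> 1" for s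
      using mean_product_bounds[of "t - s" "w (max 0 s)"] by (auto intro: power_le_one)
    have b: "0 \<le> (?u s)\<^sup>2 * ?l s" "(?u s)\<^sup>2 * ?l s \<le> C" for s
      using mult_mono[OF ub(2)[of s] lb(2)[of s]] ub[of s] lb[of s] by auto
    have i1: "set_integrable lborel {0..t} (\<lambda>s. (?u s)\<^sup>2 * ?l s)"
      by (rule set_integrable_bounded_interval[where C=C]) (measurable, simp only: abs_of_nonneg b)
    have i2: "set_integrable lborel {0..t} ?l"
      by (rule set_integrable_bounded_interval[where C=C]) (measurable, simp only: abs_of_nonneg lb)
    have "?H w = (\<integral>\<^sup>+s. ennreal (indicator {0..t} s *\<^sub>R ((?u s)\<^sup>2 * ?l s)) \<partial>lborel)"
      by (intro nn_integral_cong) (auto simp: indicator_def)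
    also have "\<dots> = ennreal (LINT s:{0..t}|lborel. (?u s)\<^sup>2 * ?l s)"
      using i1 b unfolding set_integrable_def set_lebesgue_integral_def
      by (intro nn_integral_eq_integral) (auto simp: indicator_def)
    finally have H: "?H w = ennreal (LINT s:{0..t}|lborel. (?u s)\<^sup>2 * ?l s)" .
    have h0: "0 \<le> (LINT s:{0..t}|lborel. (?u s)\<^sup>2 * ?l s)"
      unfolding set_lebesgue_integral_def using b by (intro Bochner_Integration.integral_nonneg) (auto simp: indicator_def)
    have "exp (- hazard lam w t) - exp (- hazard lam w 0) = - (LINT s:{0..t}|lborel. ?l s)"
      unfolding primitive_of_diff[OF pl t] by (simp add: set_lebesgue_integral_def)
    then have one: "exp (- hazard lam w t) + (LINT s:{0..t}|lborel. ?l s) = 1"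
      by (simp add: path_integral_0)
    have "gain_integral t w t = (LINT s:{0..t}|lborel. ?l s - (?u s)\<^sup>2 * ?l s)"
      unfolding gain_integral_def
      by (rule set_lebesgue_integral_cong)
        (auto simp: branching_gain_def discounted_defect_def mean_defect_def power2_eq_square algebra_simps)
    also have "\<dots> = (LINT s:{0..t}|lborel. ?l s) - (LINT s:{0..t}|lborel. (?u s)\<^sup>2 * ?l s)"
      by (rule set_integral_diff(2)[OF i2 i1])
    finally have gi: "gain_integral t w t = (LINT s:{0..t}|lborel. ?l s) - (LINT s:{0..t}|lborel. (?u s)\<^sup>2 * ?l s)" .
    have eq: "1 - G w = f (w t) * exp (- hazard lam w t) + (LINT s:{0..t}|lborel. (?u s)\<^sup>2 * ?l s)"
      using one by (simp add: G_def gi algebra_simps)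
    have g0: "0 \<le> G w"
    proof -
      have "0 \<le> gain_integral t w t"
        using gain_integral_bounds(1)[OF w order_refl t, of t] by (simp add: gain_integral_0)
      then show ?thesis
        unfolding G_def using f_bounds[of "w t"] by simp
    qed
    have "0 \<le> f (w t) * exp (- hazard lam w t)"
      using f_bounds[of "w t"] by simp
    with eq h0 have "G w \<le> 1" by linarith
    moreover have "ennreal (f (w t) * exp (- hazard lam w t)) + ?H w = ennreal (1 - G w)"
      unfolding eq H using h0 f_bounds[of "w t"] by (simp add: ennreal_plus)
    ultimately show ?thesis using g0 by simp
  qed
  then show "w \<in> space path_space \<Longrightarrow> 0 \<le> G w \<and> G w \<le> 1" by blast
  have GP: "G \<in> borel_measurable (P x)"
    using Gm by (simp add: measurable_kernel[OF P])
  have Gi: "integrable (P x) G"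
    using GP G by (intro P.integrable_const_bound[where B=1]) (auto simp: prob_space_kernel(3)[OF P] intro!: AE_I2)
  have "ennreal (mean_product t x) = (\<integral>\<^sup>+w. ennreal (1 - G w) \<partial>P x)"
    unfolding ennreal_mean_product_equation[OF t]
    by (intro nn_integral_cong) (simp add: G prob_space_kernel(3)[OF P])
  also have "\<dots> = ennreal (LINT w|P x. 1 - G w)"
    using G Gi by (intro nn_integral_eq_integral) (auto simp: prob_space_kernel(3)[OF P] intro!: AE_I2)
  finally have "mean_product t x = (LINT w|P x. 1 - G w)"
    using mean_product_bounds G by (subst (asm) ennreal_inj) (auto simp: prob_space_kernel(3)[OF P] intro!: integral_nonneg_AE AE_I2)
  also have "\<dots> = 1 - (LINT w|P x. G w)"
    using Gi by (simp add: P.prob_space)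
  finally show "mean_defect t x = (LINT w|P x. G w)"
    by (simp add: mean_defect_def)
qed

lemma mean_defect_0: "mean_defect 0 x = 1 - f x"
proof -
  interpret P: prob_space "P x" by (rule prob_space_kernel[OF P])
  have "mean_defect 0 x = (LINT w|P x. 1 - f (w 0))"
    using mean_defect_equation(1)[of 0 x] by (simp add: path_integral_0 gain_integral_0)
  also have "\<dots> = (LINT w|P x. 1 - f x)"
  proof (rule integral_cong_AE)
    have "AE w in P x. w 0 = x" using markov by (simp add: strong_markov_def)
    then show "AE w in P x. 1 - f (w 0) = 1 - f x" by eventually_elim simp
    have "(\<lambda>w. w 0) \<in> borel_measurable (P x)"
      using measurable_path_eval[of 0] by (simp add: measurable_kernel[OF P])
    from measurable_compose[OF this f_measurable] show "(\<lambda>w. 1 - f (w 0)) \<in> borel_measurable (P x)"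
      by measurable
  qed simp
  finally show ?thesis by (simp add: P.prob_space)
qed

text \<open>The equation for the remaining horizon \<open>t - r\<close>, started from the position at time \<open>r\<close>: by the Markov
property, \<open>w\<^sub>r exp (- H\<^sub>r)\<close> together with its accumulated gain is a martingale.\<close>

lemma discounted_defect_markov:
  assumes r: "0 \<le> r" "r \<le> t"
    and Z: "Z \<in> borel_measurable (path_filtration (ennreal r))" "\<And>w. w \<in> space path_space \<Longrightarrow> \<bar>Z w\<bar> \<le> D"
  shows "(LINT w|P x. Z w * (discounted_defect t w t + gain_integral t w t - gain_integral t w r)) =
     (LINT w|P x. Z w * discounted_defect t w r)"
proof -
  let ?G = "\<lambda>w. (1 - f (w (t - r))) * exp (- hazard lam w (t - r)) + gain_integral (t - r) w (t - r)"
  note sp = prob_space_kernel(3)[OF P]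
  have tr: "0 \<le> t - r" using r by simp
  have hm: "(\<lambda>w. hazard lam w r) \<in> borel_measurable (path_filtration (ennreal r))"
    by (rule measurable_path_integral_adapted[OF lam_joint_measurable r(1)])
  have Zm: "(\<lambda>w. Z w * exp (- hazard lam w r)) \<in> borel_measurable (path_filtration (ennreal r))"
    using Z(1) hm by measurable
  have Zb: "\<bar>Z w * exp (- hazard lam w r)\<bar> \<le> D" if "w \<in> space path_space" for w
  proof -
    have "\<bar>Z w\<bar> * exp (- hazard lam w r) \<le> D * 1"
      using Z(2)[OF that] hazard_nonneg[of w r] by (intro mult_mono) auto
    then show ?thesis by (simp add: abs_mult)
  qed
  have path: "exp (- hazard lam w r) * ?G (shift r w) = discounted_defect t w t + gain_integral t w t - gain_integral t w r"
    if w: "w \<in> space path_space" for w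
  proof -
    have a: "exp (- hazard lam w r) * ((1 - f (shift r w (t - r))) * exp (- hazard lam (shift r w) (t - r))) = discounted_defect t w t"
      using r by (simp add: hazard_additive[OF w r(1) tr] shift_apply[OF tr] discounted_defect_def mean_defect_0 mult_ac flip: exp_add)
    have "gain_integral (t - r) (shift r w) (t - r) =
        (LINT s:{0..t - r}|lborel. exp (hazard lam w r) * (branching_gain t (r + s) (w (r + s)) * discounted_defect t w (r + s)))"
      unfolding gain_integral_def
    proof (rule set_lebesgue_integral_cong, simp, intro allI impI)
      fix s assume s: "s \<in> {0..t - r}"
      have "discounted_defect (t - r) (shift r w) s = exp (hazard lam w r) * discounted_defect t w (r + s)"
        using s r by (simp add: discounted_defect_def hazard_additive[OF w r(1)] shift_apply exp_diff exp_minus field_simps)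
      then show "branching_gain (t - r) s (shift r w s) * discounted_defect (t - r) (shift r w) s =
          exp (hazard lam w r) * (branching_gain t (r + s) (w (r + s)) * discounted_defect t w (r + s))"
        using s by (simp add: branching_gain_def shift_apply algebra_simps)
    qed
    also have "\<dots> = exp (hazard lam w r) * (LINT s:{0..t - r}|lborel. branching_gain t (r + s) (w (r + s)) * discounted_defect t w (r + s))"
      by simp
    also have "(LINT s:{0..t - r}|lborel. branching_gain t (r + s) (w (r + s)) * discounted_defect t w (r + s)) =
        (LINT q:{r..t}|lborel. branching_gain t q (w q) * discounted_defect t w q)"
      using set_integral_translate[of 0 "t - r" "\<lambda>q. branching_gain t q (w q) * discounted_defect t w q" r] by simp
    also have "\<dots> = (LINT q:{r..t}|lborel. (if q < 0 then 0 else branching_gain t q (w (max 0 q))) * discounted_defect t w q)"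
      by (rule set_lebesgue_integral_cong) (use r in auto)
    also have "\<dots> = gain_integral t w t - gain_integral t w r"
      by (rule primitive_of_diff[OF primitive_gain_integral[OF w] r(2), symmetric])
    finally have "exp (- hazard lam w r) * gain_integral (t - r) (shift r w) (t - r) = gain_integral t w t - gain_integral t w r"
      by (simp add: exp_minus)
    then show ?thesis
      using a by (simp add: distrib_left)
  qed
  have "(LINT w|P x. Z w * (discounted_defect t w t + gain_integral t w t - gain_integral t w r)) =
      (LINT w|P x. (Z w * exp (- hazard lam w r)) * ?G (shift r w))"
    by (rule Bochner_Integration.integral_cong) (simp_all only: sp path[symmetric] mult.assoc)
  also have "\<dots> = (LINT w|P x. (Z w * exp (- hazard lam w r)) * (LINT w'|P (w r). ?G w'))"
    by (rule markov_integral[OF markov r(1) Zm Zb mean_defect_equation(3)[OF tr] mean_defect_equation(2)[OF tr]])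
  also have "\<dots> = (LINT w|P x. Z w * discounted_defect t w r)"
    unfolding mean_defect_equation(1)[OF tr, symmetric] using r
    by (simp add: discounted_defect_def mult_ac)
  finally show ?thesis .
qed

text \<open>The exponential of the integrated gain rate compensates the drift of \<open>discounted_defect\<close>. As that integral
equals \<open>2 H - A\<close>, this is the process \<open>w\<^sub>s exp (H\<^sub>s - A\<^sub>s)\<close>.\<close>

definition optimal_martingale :: "real \<Rightarrow> 'a path \<Rightarrow> real \<Rightarrow> real" where
  "optimal_martingale t w s = discounted_defect t w s * exp (path_integral (branching_gain t) w s)"

text \<open>An integrated product rule. Write \<open>d\<close> for \<open>discounted_defect\<close>, \<open>K\<close> for its accumulated gain, \<open>E\<close> for the
exponential of the integral of the gain rate \<open>k\<close>, and \<open>c = d\<^sub>t + K\<^sub>t\<close>. Pathwise, \<open>E\<^sub>t d\<^sub>t - E\<^sub>s (c - K\<^sub>s)\<close> is the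
integral over \<open>r\<close> from \<open>s\<close> to \<open>t\<close> of \<open>k\<^sub>r E\<^sub>r (c - K\<^sub>r - d\<^sub>r)\<close>. The weight \<open>k\<^sub>r E\<^sub>r\<close> is known at time \<open>r\<close>, so
\<open>discounted_defect_markov\<close> makes the expectation of the integrand vanish for each \<open>r\<close>; applied once more
at time \<open>s\<close>, it replaces \<open>c - K\<^sub>s\<close> by \<open>d\<^sub>s\<close>.\<close>

lemma optimal_martingale_property:
  assumes s: "0 \<le> s" "s \<le> t"
    and Z: "Z \<in> borel_measurable (path_filtration (ennreal s))" "\<And>w. w \<in> space path_space \<Longrightarrow> \<bar>Z w\<bar> \<le> D"
  shows "(LINT w|P x. Z w * optimal_martingale t w t) = (LINT w|P x. Z w * optimal_martingale t w s)"
proof -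
  interpret P: prob_space "P x" by (rule prob_space_kernel[OF P])
  note sp = prob_space_kernel(3)[OF P]
  note [measurable_cong] = prob_space_kernel(2)[OF P]
  let ?B = "path_integral (branching_gain t)"
  let ?K = "gain_integral t"
  let ?d = "discounted_defect t"
  let ?k = "\<lambda>w r. if r < 0 then 0 else branching_gain t r (w (max 0 r))"
  define c where "c w = ?d w t + ?K w t" for w
  define h where "h w r = ?k w r * exp (?B w r) * (c w - ?K w r) - ?k w r * exp (?B w r) * ?d w r" for w r
  have t: "0 \<le> t" using s by simp
  have kb: "0 \<le> ?k w r" "?k w r \<le> 2 * C" for w r
    using branching_gain_bounds[of t r "w (max 0 r)"] C_nonneg by auto
  have Bb: "0 \<le> ?B w r" for w r
    by (rule path_integral_nonneg) (rule branching_gain_bounds)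
  have Bt: "?B w r \<le> 2 * C * t" if w: "w \<in> space path_space" and r: "0 \<le> r" "r \<le> t" for w r
  proof -
    have "?B w r - ?B w 0 = (LINT q:{0..r}|lborel. ?k w q)"
      by (rule primitive_of_diff[OF primitive_gain[OF w] r(1)])
    moreover have "\<bar>LINT q:{0..r}|lborel. ?k w q\<bar> \<le> 2 * C * (r - 0)"
      by (rule abs_set_integral_le[OF primitive_of_measurable[OF primitive_gain[OF w]] _ r(1)])
        (simp only: abs_of_nonneg kb)
    moreover have "2 * C * r \<le> 2 * C * t"
      using C_nonneg r by (intro mult_left_mono) auto
    ultimately show ?thesis by (simp add: path_integral_0)
  qed
  have cb: "0 \<le> c w - ?K w r" "c w - ?K w r \<le> 1 + 2 * C * t" if w: "w \<in> space path_space" and r: "0 \<le> r" "r \<le> t" for w r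
  proof -
    have "2 * C * (t - r) \<le> 2 * C * t"
      using C_nonneg r by (intro mult_left_mono) auto
    then show "0 \<le> c w - ?K w r" "c w - ?K w r \<le> 1 + 2 * C * t"
      using gain_integral_bounds[OF w r, of t] discounted_defect_bounds[of t w t] by (auto simp: c_def)
  qed
  have cab: "\<bar>c w - ?K w r\<bar> \<le> 1 + 2 * C * t" if w: "w \<in> space path_space" and r: "0 \<le> r" "r \<le> t" for w r
    using cb[OF w r] by simp
  define D' where "D' = \<bar>D\<bar>"
  have ZD: "\<bar>Z w\<bar> \<le> D'" if "w \<in> space path_space" for w
    using Z(2)[OF that] by (simp add: D'_def)
  have ZP[measurable]: "Z \<in> borel_measurable (P x)"
    by (rule measurable_from_subalg[OF subalgebra_path Z(1)])
  have path: "Z w * ?d w t * exp (?B w t) - Z w * exp (?B w s) * (c w - ?K w s) = (LINT r:{s..t}|lborel. Z w * h w r)"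
    if w: "w \<in> space path_space" for w
  proof -
    have p1: "primitive_of (\<lambda>r. ?k w r * exp (?B w r)) (\<lambda>r. exp (?B w r))"
      by (rule primitive_of_exp[OF primitive_gain[OF w]])
    have p2: "primitive_of (\<lambda>r. - (?k w r * ?d w r)) (\<lambda>r. c w - ?K w r)"
      using primitive_of_add[OF primitive_of_const[of "c w"] primitive_of_cmult[OF primitive_gain_integral[OF w, of t], of "-1"]]
      by simp
    have "exp (?B w t) * (c w - ?K w t) - exp (?B w s) * (c w - ?K w s) =
       (LINT r:{s..t}|lborel. ?k w r * exp (?B w r) * (c w - ?K w r) + exp (?B w r) * - (?k w r * ?d w r))"
      by (rule primitive_of_diff[OF primitive_of_mult[OF p1 p2] s(2)])
    also have "\<dots> = (LINT r:{s..t}|lborel. h w r)"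
      by (simp add: h_def mult_ac)
    finally have "Z w * (exp (?B w t) * ?d w t - exp (?B w s) * (c w - ?K w s)) = Z w * (LINT r:{s..t}|lborel. h w r)"
      by (simp add: c_def)
    then show ?thesis
      by (simp add: algebra_simps)
  qed
  define E where "E = exp (2 * C * t)"
  have eb: "exp (?B w r) \<le> E" if "w \<in> space path_space" "0 \<le> r" "r \<le> t" for w r
    using Bt[OF that] by (simp add: E_def)
  have E0: "0 \<le> E" by (simp add: E_def)
  have cK: "(\<lambda>z. c (fst z)) \<in> borel_measurable (P x \<Otimes>\<^sub>M borel)"
    unfolding c_def by (intro borel_measurable_add measurable_discounted_defect measurable_gain_integral) measurable
  have meas: "(\<lambda>z. Z (fst z) * h (fst z) (snd z)) \<in> borel_measurable (P x \<Otimes>\<^sub>M borel)"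
  proof -
    have [measurable]: "(\<lambda>z. branching_gain t (snd z) ((fst z) (max 0 (snd z)))) \<in> borel_measurable (P x \<Otimes>\<^sub>M borel)"
      by (rule measurable_gain_product) measurable
    have [measurable]: "(\<lambda>z. ?d (fst z) (snd z)) \<in> borel_measurable (P x \<Otimes>\<^sub>M borel)"
      by (rule measurable_discounted_defect) measurable
    have [measurable]: "(\<lambda>z. ?K (fst z) (snd z)) \<in> borel_measurable (P x \<Otimes>\<^sub>M borel)"
      by (rule measurable_gain_integral) measurable
    have [measurable]: "(\<lambda>z. ?B (fst z) (snd z)) \<in> borel_measurable (P x \<Otimes>\<^sub>M borel)"
      by (rule measurable_path_integral[OF measurable_branching_gain]) measurable
    note [measurable] = cK
    show ?thesis
      unfolding h_def by measurable
  qed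
  have hb: "\<bar>Z w * h w r\<bar> \<le> D' * (2 * C * E * (1 + 2 * C * t) + 2 * C * E * 1)" if w: "w \<in> space path_space" and r: "r \<in> {s..t}" for w r
  proof -
    have r': "0 \<le> r" "r \<le> t" using r s by auto
    have "\<bar>?k w r * exp (?B w r) * (c w - ?K w r)\<bar> \<le> 2 * C * E * (1 + 2 * C * t)"
      using kb[of r w] eb[OF w r'] cb[OF w r'] C_nonneg E0 unfolding abs_mult by (intro mult_mono) auto
    moreover have "\<bar>?k w r * exp (?B w r) * ?d w r\<bar> \<le> 2 * C * E * 1"
      using kb[of r w] eb[OF w r'] discounted_defect_bounds[of t w r] C_nonneg E0 unfolding abs_mult by (intro mult_mono) auto
    ultimately have "\<bar>h w r\<bar> \<le> 2 * C * E * (1 + 2 * C * t) + 2 * C * E * 1"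
      unfolding h_def by linarith
    then show ?thesis
      unfolding abs_mult using ZD[OF w] by (intro mult_mono) auto
  qed
  have "(LINT w|P x. (LINT r:{s..t}|lborel. Z w * h w r)) = (LINT r:{s..t}|lborel. (LINT w|P x. Z w * h w r))"
    by (rule integral_set_integral_swap[OF P.prob_space_axioms _ hb]) (use meas in \<open>auto simp: case_prod_beta' sp\<close>)
  also have "\<dots> = (LINT r:{s..t}|lborel. 0)"
  proof (rule set_lebesgue_integral_cong, simp, intro allI impI)
    fix r assume r: "r \<in> {s..t}"
    then have r': "0 \<le> r" "r \<le> t" using s by auto
    let ?Y = "\<lambda>w. Z w * (?k w r * exp (?B w r))"
    have Zr: "Z \<in> borel_measurable (path_filtration (ennreal r))"
    proof (rule measurable_from_subalg[OF _ Z(1)])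
      show "subalgebra (path_filtration (ennreal r)) (path_filtration (ennreal s))"
        using r sets_natural_filtration_mono[of "ennreal s" "ennreal r" path_space "\<lambda>s w. w s"]
        by (auto simp: subalgebra_def ennreal_leI)
    qed
    have er: "(\<lambda>w. w r) \<in> borel_measurable (path_filtration (ennreal r))"
      by (rule measurable_natural_filtration[where X="\<lambda>s w. w s", OF r'(1) order_refl])
    have kr: "(\<lambda>w. ?k w r) \<in> borel_measurable (path_filtration (ennreal r))"
      using r' measurable_Pair_compose_split[OF measurable_branching_gain _ er, of "\<lambda>_. r"] by (simp add: max_def)
    have Br: "(\<lambda>w. ?B w r) \<in> borel_measurable (path_filtration (ennreal r))"
      by (rule measurable_path_integral_adapted[OF measurable_branching_gain r'(1)])
    have Ym: "?Y \<in> borel_measurable (path_filtration (ennreal r))"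
      by (intro borel_measurable_times Zr kr measurable_compose[OF Br borel_measurable_exp])
    have Yb: "\<bar>?Y w\<bar> \<le> D' * (2 * C * E)" if w: "w \<in> space path_space" for w
      using kb[of r w] eb[OF w r'] ZD[OF w] C_nonneg E0 unfolding abs_mult by (intro mult_mono) auto
    have YP[measurable]: "?Y \<in> borel_measurable (P x)"
      by (rule measurable_from_subalg[OF subalgebra_path Ym])
    have mK[measurable]: "(\<lambda>w. c w - ?K w r) \<in> borel_measurable (P x)" "(\<lambda>w. ?d w r) \<in> borel_measurable (P x)"
      unfolding c_def by (intro borel_measurable_add borel_measurable_diff measurable_discounted_defect measurable_gain_integral; measurable)+
    have i1: "integrable (P x) (\<lambda>w. ?Y w * (c w - ?K w r))"
    proof (rule P.integrable_const_bound[where B="D' * (2 * C * E) * (1 + 2 * C * t)"])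
      show "AE w in P x. norm (?Y w * (c w - ?K w r)) \<le> D' * (2 * C * E) * (1 + 2 * C * t)"
        unfolding real_norm_def using C_nonneg E0 t
        by (intro AE_I2, subst abs_mult, intro mult_mono Yb) (auto simp: sp D'_def intro: cab[OF _ r'])
    qed measurable
    have i2: "integrable (P x) (\<lambda>w. ?Y w * ?d w r)"
    proof (rule P.integrable_const_bound[where B="D' * (2 * C * E) * 1"])
      show "AE w in P x. norm (?Y w * ?d w r) \<le> D' * (2 * C * E) * 1"
        unfolding real_norm_def using C_nonneg E0 discounted_defect_bounds
        by (intro AE_I2, subst abs_mult, intro mult_mono Yb) (auto simp: sp D'_def)
    qed measurable
    have "(LINT w|P x. ?Y w * (c w - ?K w r)) = (LINT w|P x. ?Y w * ?d w r)"
      using discounted_defect_markov[OF r' Ym Yb] by (simp add: c_def)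
    moreover have "(LINT w|P x. Z w * h w r) = (LINT w|P x. ?Y w * (c w - ?K w r) - ?Y w * ?d w r)"
      by (rule Bochner_Integration.integral_cong) (simp_all add: h_def algebra_simps)
    ultimately show "(LINT w|P x. Z w * h w r) = 0"
      using Bochner_Integration.integral_diff[OF i1 i2] by simp
  qed
  finally have zero: "(LINT w|P x. (LINT r:{s..t}|lborel. Z w * h w r)) = 0" by simp
  let ?Y = "\<lambda>w. Z w * exp (?B w s)"
  have Ym: "?Y \<in> borel_measurable (path_filtration (ennreal s))"
    by (intro borel_measurable_times Z(1)
        measurable_compose[OF measurable_path_integral_adapted[OF measurable_branching_gain s(1)] borel_measurable_exp])
  have Yb: "\<bar>?Y w\<bar> \<le> D' * E" if w: "w \<in> space path_space" for w
    using eb[OF w s] ZD[OF w] unfolding abs_mult by (intro mult_mono) auto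
  have YP[measurable]: "?Y \<in> borel_measurable (P x)"
    by (rule measurable_from_subalg[OF subalgebra_path Ym])
  have mK[measurable]: "(\<lambda>w. c w - ?K w s) \<in> borel_measurable (P x)" "(\<lambda>w. ?d w t) \<in> borel_measurable (P x)"
    unfolding c_def by (intro borel_measurable_add borel_measurable_diff measurable_discounted_defect measurable_gain_integral; measurable)+
  have [measurable]: "(\<lambda>w. ?B w t) \<in> borel_measurable (P x)"
    by (rule measurable_path_integral[OF measurable_branching_gain]) measurable
  have i1: "integrable (P x) (\<lambda>w. Z w * ?d w t * exp (?B w t))"
  proof (rule P.integrable_const_bound[where B="D' * 1 * E"])
    show "AE w in P x. norm (Z w * ?d w t * exp (?B w t)) \<le> D' * 1 * E"
      unfolding real_norm_def using discounted_defect_bounds eb[OF _ t order_refl]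
      by (intro AE_I2, unfold abs_mult, intro mult_mono) (auto simp: sp D'_def ZD[unfolded D'_def])
  qed measurable
  have i2: "integrable (P x) (\<lambda>w. ?Y w * (c w - ?K w s))"
  proof (rule P.integrable_const_bound[where B="D' * E * (1 + 2 * C * t)"])
    show "AE w in P x. norm (?Y w * (c w - ?K w s)) \<le> D' * E * (1 + 2 * C * t)"
      unfolding real_norm_def using E0
      by (intro AE_I2, subst abs_mult, intro mult_mono Yb) (auto simp: sp D'_def intro: cab[OF _ s])
  qed measurable
  have "(LINT w|P x. Z w * ?d w t * exp (?B w t)) - (LINT w|P x. ?Y w * (c w - ?K w s)) =
      (LINT w|P x. Z w * ?d w t * exp (?B w t) - ?Y w * (c w - ?K w s))"
    by (rule Bochner_Integration.integral_diff[OF i1 i2, symmetric])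
  also have "\<dots> = (LINT w|P x. (LINT r:{s..t}|lborel. Z w * h w r))"
    by (rule Bochner_Integration.integral_cong) (simp_all only: sp path)
  finally have "(LINT w|P x. Z w * ?d w t * exp (?B w t)) = (LINT w|P x. ?Y w * (c w - ?K w s))"
    using zero by simp
  also have "\<dots> = (LINT w|P x. ?Y w * ?d w s)"
    using discounted_defect_markov[OF s Ym Yb] by (simp add: c_def)
  finally show ?thesis
    by (simp add: optimal_martingale_def mult_ac)
qed

end

section \<open>The quotient along a single path\<close>

lemma double_le_sum_if_square_eq:
  fixes p q z :: real
  assumes "0 \<le> p" "0 \<le> q" "z\<^sup>2 = p * q"
  shows "2 * z \<le> p + q"
proof (rule power2_le_imp_le)
  have "(p + q)\<^sup>2 - (2 * z)\<^sup>2 = (p - q)\<^sup>2"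
    using assms(3) by (simp add: power2_eq_square algebra_simps)
  then show "(2 * z)\<^sup>2 \<le> (p + q)\<^sup>2"
    by (metis diff_ge_0_iff_ge zero_le_power2)
qed (use assms in simp)

lemma ennreal_integral_le_nn_integral:
  fixes h :: "'w \<Rightarrow> real"
  assumes "integrable M h" "\<And>x. ennreal (h x) \<le> H x"
  shows "ennreal (LINT x|M. h x) \<le> (\<integral>\<^sup>+x. H x \<partial>M)"
proof -
  have i: "integrable M (\<lambda>x. max 0 (h x))"
    using assms(1) by (intro Bochner_Integration.integrable_max) auto
  have "ennreal (LINT x|M. h x) \<le> ennreal (LINT x|M. max 0 (h x))"
    by (intro ennreal_leI integral_mono assms(1) i) auto
  also have "\<dots> = (\<integral>\<^sup>+x. ennreal (max 0 (h x)) \<partial>M)"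
    by (rule nn_integral_eq_integral[symmetric]) (use i in auto)
  also have "\<dots> \<le> (\<integral>\<^sup>+x. H x \<partial>M)"
    using assms(2) by (intro nn_integral_mono) (auto simp: max_def)
  finally show ?thesis .
qed

lemma ennreal_plus_le: "ennreal (a + b) \<le> ennreal a + ennreal b"
proof -
  have "ennreal (a + b) \<le> ennreal (max 0 a + max 0 b)"
    by (intro ennreal_leI) auto
  also have "\<dots> = ennreal (max 0 a) + ennreal (max 0 b)"
    by (rule ennreal_plus) auto
  finally show ?thesis by simp
qed

context binary_branching_markov
begin

definition thinned_hazard :: "real \<Rightarrow> 'a path \<Rightarrow> real \<Rightarrow> real" where
  "thinned_hazard t = path_integral (\<lambda>r x. lam x * mean_defect (t - r) x)"

text \<open>The density of \<open>\<beta>\<close>, that is, of the first point of a Poisson process with rate \<open>lam(X\<^sub>s) w\<^sub>s\<close>.\<close>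

definition thinned_density :: "real \<Rightarrow> 'a path \<Rightarrow> real \<Rightarrow> real" where
  "thinned_density t w s = lam (w (max 0 s)) * mean_defect (t - s) (w (max 0 s)) * exp (- thinned_hazard t w s)"

lemma measurable_thinned_rate: "(\<lambda>(r, x). lam x * mean_defect (t - r) x) \<in> borel_measurable (borel \<Otimes>\<^sub>M borel)"
proof -
  have [measurable]: "(\<lambda>z. mean_defect (t - fst z) (snd z)) \<in> borel_measurable (borel \<Otimes>\<^sub>M borel)"
    by (rule measurable_Pair_compose_split[OF measurable_mean_defect]) measurable
  show ?thesis
    unfolding case_prod_beta' by measurable
qed

lemma thinned_rate_bounds: "0 \<le> lam x * mean_defect r x" "lam x * mean_defect r x \<le> C"
proof -
  have "lam x * mean_defect r x \<le> C * 1"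
    using mean_defect_bounds[of r x] lam_nonneg[of x] lam_le[of x] C_nonneg by (intro mult_mono) auto
  then show "0 \<le> lam x * mean_defect r x" "lam x * mean_defect r x \<le> C"
    using mean_defect_bounds[of r x] lam_nonneg[of x] by auto
qed

lemma thinned_hazard_nonneg: "0 \<le> thinned_hazard t w s"
  unfolding thinned_hazard_def by (rule path_integral_nonneg) (rule thinned_rate_bounds)

lemma primitive_thinned_hazard:
  assumes "w \<in> space path_space"
  shows "primitive_of (\<lambda>r. if r < 0 then 0 else lam (w (max 0 r)) * mean_defect (t - r) (w (max 0 r))) (thinned_hazard t w)"
  unfolding thinned_hazard_def
  using primitive_of_path_integral[OF measurable_thinned_rate[of t], of C w] thinned_rate_bounds assms by auto

lemma thinned_density_bounds: "0 \<le> thinned_density t w s" "thinned_density t w s \<le> C"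
proof -
  have "lam (w (max 0 s)) * mean_defect (t - s) (w (max 0 s)) * exp (- thinned_hazard t w s) \<le> C * 1"
    using thinned_rate_bounds thinned_hazard_nonneg C_nonneg by (intro mult_mono) auto
  then show "0 \<le> thinned_density t w s" "thinned_density t w s \<le> C"
    using thinned_rate_bounds by (auto simp: thinned_density_def)
qed

lemma measurable_thinned_density:
  assumes g[measurable]: "g \<in> borel_measurable M" and h[measurable]: "h \<in> M \<rightarrow>\<^sub>M path_space"
  shows "(\<lambda>x. thinned_density t (h x) (g x)) \<in> borel_measurable M"
proof -
  have [measurable]: "(\<lambda>x. h x (max 0 (g x))) \<in> borel_measurable M"
    by (rule measurable_path_eval_compose) measurable
  have [measurable]: "(\<lambda>x. mean_defect (t - g x) (h x (max 0 (g x)))) \<in> borel_measurable M"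
    by (rule measurable_Pair_compose_split[OF measurable_mean_defect]) measurable
  have [measurable]: "(\<lambda>x. thinned_hazard t (h x) (g x)) \<in> borel_measurable M"
    unfolding thinned_hazard_def by (rule measurable_path_integral[OF measurable_thinned_rate g h])
  show ?thesis
    unfolding thinned_density_def by measurable
qed

lemma thinned_density_integral:
  assumes w: "w \<in> space path_space" and t: "0 \<le> t"
  shows "set_integrable lborel {0..t} (thinned_density t w)"
    and "(LINT s:{0..t}|lborel. thinned_density t w s) = 1 - exp (- thinned_hazard t w t)"
proof -
  have m: "thinned_density t w \<in> borel_measurable borel"
    using w measurable_thinned_density[of "\<lambda>s. s" borel "\<lambda>_. w" t] by simp
  show "set_integrable lborel {0..t} (thinned_density t w)"
    by (rule set_integrable_bounded_interval[where C=C, OF m]) (simp only: abs_of_nonneg thinned_density_bounds)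
  let ?k = "\<lambda>r. if r < 0 then 0 else lam (w (max 0 r)) * mean_defect (t - r) (w (max 0 r))"
  have "primitive_of (\<lambda>s. - ?k s * exp (- thinned_hazard t w s)) (\<lambda>s. exp (- thinned_hazard t w s))"
    using primitive_of_exp[OF primitive_of_cmult[OF primitive_thinned_hazard[OF w, of t], of "-1"]] by simp
  from primitive_of_diff[OF this t]
  have "exp (- thinned_hazard t w t) - 1 = (LINT s:{0..t}|lborel. - ?k s * exp (- thinned_hazard t w s))"
    by (simp add: thinned_hazard_def path_integral_0)
  also have "\<dots> = (LINT s:{0..t}|lborel. - thinned_density t w s)"
    by (rule set_lebesgue_integral_cong) (auto simp: thinned_density_def)
  also have "\<dots> = - (LINT s:{0..t}|lborel. thinned_density t w s)"
    by (simp add: set_lebesgue_integral_def)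
  finally show "(LINT s:{0..t}|lborel. thinned_density t w s) = 1 - exp (- thinned_hazard t w t)"
    by simp
qed

lemma optimal_martingale_eq:
  assumes w: "w \<in> space path_space" and s: "0 \<le> s"
  shows "optimal_martingale t w s = mean_defect (t - s) (w s) * exp (hazard lam w s - thinned_hazard t w s)"
proof -
  have "path_integral (branching_gain t) w s - path_integral (branching_gain t) w 0 =
      (LINT r:{0..s}|lborel. (if r < 0 then 0 else branching_gain t r (w (max 0 r))))"
    by (rule primitive_of_diff[OF primitive_gain[OF w] s])
  also have "\<dots> = (LINT r:{0..s}|lborel. 2 * (if r < 0 then 0 else lam (w (max 0 r))) +
      - 1 * (if r < 0 then 0 else lam (w (max 0 r)) * mean_defect (t - r) (w (max 0 r))))"
    by (rule set_lebesgue_integral_cong) (auto simp: branching_gain_def algebra_simps)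
  also have "\<dots> = (2 * hazard lam w s + - 1 * thinned_hazard t w s) - (2 * hazard lam w 0 + - 1 * thinned_hazard t w 0)"
    by (rule primitive_of_diff[OF primitive_of_add[OF primitive_of_cmult[OF primitive_hazard[OF w]]
        primitive_of_cmult[OF primitive_thinned_hazard[OF w]]] s, symmetric])
  finally have "path_integral (branching_gain t) w s = 2 * hazard lam w s - thinned_hazard t w s"
    by (simp add: path_integral_0 thinned_hazard_def)
  then show ?thesis
    using s by (simp add: optimal_martingale_def discounted_defect_def mult.assoc flip: exp_add)
qed

lemma optimal_martingale_bounds:
  assumes w: "w \<in> space path_space" and s: "0 \<le> s" "s \<le> t"
  shows "0 \<le> optimal_martingale t w s" "optimal_martingale t w s \<le> exp (C * t)"
proof -
  have "hazard lam w s - hazard lam w 0 = (LINT r:{0..s}|lborel. (if r < 0 then 0 else lam (w (max 0 r))))"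
    by (rule primitive_of_diff[OF primitive_hazard[OF w] s(1)])
  moreover have "\<bar>LINT r:{0..s}|lborel. (if r < 0 then 0 else lam (w (max 0 r)))\<bar> \<le> C * (s - 0)"
    by (rule abs_set_integral_le[OF primitive_of_measurable[OF primitive_hazard[OF w]] _ s(1)])
       (use lam_nonneg lam_le C_nonneg in auto)
  moreover have "C * s \<le> C * t" using C_nonneg s by (intro mult_left_mono) auto
  ultimately have "hazard lam w s \<le> C * t" by (simp add: path_integral_0)
  then have "exp (hazard lam w s - thinned_hazard t w s) \<le> exp (C * t)"
    using thinned_hazard_nonneg[of t w s] by simp
  then have "mean_defect (t - s) (w s) * exp (hazard lam w s - thinned_hazard t w s) \<le> 1 * exp (C * t)"
    using mean_defect_bounds by (intro mult_mono) auto
  then show "0 \<le> optimal_martingale t w s" "optimal_martingale t w s \<le> exp (C * t)"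
    unfolding optimal_martingale_eq[OF w s(1)] using mean_defect_bounds[of "t - s" "w s"] by auto
qed

lemma measurable_optimal_martingale:
  assumes g[measurable]: "g \<in> borel_measurable M" and h[measurable]: "h \<in> M \<rightarrow>\<^sub>M path_space"
  shows "(\<lambda>x. optimal_martingale t (h x) (g x)) \<in> borel_measurable M"
proof -
  note [measurable] = measurable_discounted_defect[OF g h] measurable_path_integral[OF measurable_branching_gain g h]
  show ?thesis
    unfolding optimal_martingale_def by measurable
qed

lemma mean_defect_adapted:
  assumes r: "0 \<le> r"
  shows "(\<lambda>w. mean_defect q (w (max 0 r))) \<in> borel_measurable (path_filtration (ennreal r))"
    "(\<lambda>w. lam (w (max 0 r))) \<in> borel_measurable (path_filtration (ennreal r))"
proof -
  have er: "(\<lambda>w. w (max 0 r)) \<in> borel_measurable (path_filtration (ennreal r))"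
    using measurable_natural_filtration[where X="\<lambda>s w. w s", OF r order_refl] r by (simp add: max_def)
  show "(\<lambda>w. mean_defect q (w (max 0 r))) \<in> borel_measurable (path_filtration (ennreal r))"
    using measurable_Pair_compose_split[OF measurable_mean_defect _ er, of "\<lambda>_. q"] by simp
  show "(\<lambda>w. lam (w (max 0 r))) \<in> borel_measurable (path_filtration (ennreal r))"
    by (rule measurable_compose[OF er lam_measurable])
qed

lemma optimal_martingale_adapted:
  assumes r: "0 \<le> r"
  shows "(\<lambda>w. optimal_martingale t w r) \<in> borel_measurable (path_filtration (ennreal r))"
  unfolding optimal_martingale_def discounted_defect_def
  by (intro borel_measurable_times mean_defect_adapted[OF r] measurable_compose[OF _ borel_measurable_exp]
      borel_measurable_uminus measurable_path_integral_adapted[OF measurable_branching_gain r]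
      measurable_path_integral_adapted[OF lam_joint_measurable r])

lemma thinned_density_adapted:
  assumes r: "0 \<le> r"
  shows "(\<lambda>w. thinned_density t w r) \<in> borel_measurable (path_filtration (ennreal r))"
  unfolding thinned_density_def thinned_hazard_def
  by (intro borel_measurable_times mean_defect_adapted[OF r] measurable_compose[OF _ borel_measurable_exp]
      borel_measurable_uminus measurable_path_integral_adapted[OF measurable_thinned_rate r])

lemma hazard_increment:
  assumes w: "w \<in> space path_space" and s: "0 \<le> s" "s \<le> t"
  shows "(LINT r:{s..t}|lborel. lam (w r)) = hazard lam w t - hazard lam w s"
proof -
  have "(LINT r:{s..t}|lborel. lam (w r)) = (LINT r:{s..t}|lborel. if r < 0 then 0 else lam (w (max 0 r)))"
    by (rule set_lebesgue_integral_cong) (use s in auto)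
  then show ?thesis
    using primitive_of_diff[OF primitive_hazard[OF w] s(2)] by simp
qed

text \<open>The integrand of the functional for the motion path \<open>w\<close> and the path \<open>z\<close> of a martingale.\<close>

definition path_quotient :: "real \<Rightarrow> 'a path \<Rightarrow> (real \<Rightarrow> real) \<Rightarrow> real" where
  "path_quotient t w z = ((1 - f (w t)) * z t * exp (LINT s:{0..t}|lborel. lam (w s))) /
     (z t + (1 - f (w t)) * (LINT s:{0..t}|lborel. z s * lam (w s) * exp (LINT r:{s..t}|lborel. lam (w r))))"

lemma path_quotient_eq:
  assumes w: "w \<in> space path_space" and t: "0 \<le> t"
  shows "path_quotient t w z = (1 - f (w t)) * z t * exp (hazard lam w t) /
     (z t + (1 - f (w t)) * (exp (hazard lam w t) * (LINT s:{0..t}|lborel. z s * (lam (w s) * exp (- hazard lam w s)))))"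
proof -
  have "(LINT s:{0..t}|lborel. z s * lam (w s) * exp (LINT r:{s..t}|lborel. lam (w r))) =
      (LINT s:{0..t}|lborel. exp (hazard lam w t) * (z s * (lam (w s) * exp (- hazard lam w s))))"
    by (rule set_lebesgue_integral_cong) (auto simp: hazard_increment[OF w] exp_diff exp_minus field_simps)
  then show ?thesis
    by (simp add: path_quotient_def path_integral_def)
qed

text \<open>For the optimal martingale the integral in the denominator is
\<open>exp (H\<^sub>t) \<integral>\<^sub>0\<^sup>t a\<^sub>s ds = exp (H\<^sub>t) (1 - exp (- A\<^sub>t))\<close>, and the denominator collapses to \<open>g exp (H\<^sub>t)\<close>. If \<open>g = 0\<close>, both sides
vanish.\<close>

lemma path_quotient_optimal:
  assumes w: "w \<in> space path_space" and t: "0 \<le> t" and z: "\<And>s. 0 \<le> s \<Longrightarrow> s \<le> t \<Longrightarrow> z s = optimal_martingale t w s"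
  shows "path_quotient t w z = optimal_martingale t w t"
proof -
  let ?g = "1 - f (w t)" and ?L = "hazard lam w t" and ?A = "thinned_hazard t w t"
  have zt: "z t = ?g * exp (?L - ?A)"
    using z[OF t order_refl] optimal_martingale_eq[OF w t, of t] by (simp add: mean_defect_0)
  have "(LINT s:{0..t}|lborel. z s * (lam (w s) * exp (- hazard lam w s))) = (LINT s:{0..t}|lborel. thinned_density t w s)"
    by (rule set_lebesgue_integral_cong)
      (auto simp: z optimal_martingale_eq[OF w] thinned_density_def exp_diff exp_minus field_simps)
  then have int: "(LINT s:{0..t}|lborel. z s * (lam (w s) * exp (- hazard lam w s))) = 1 - exp (- ?A)"
    using thinned_density_integral(2)[OF w t] by simp
  have D: "z t + ?g * (exp ?L * (1 - exp (- ?A))) = ?g * exp ?L"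
    by (simp add: zt exp_diff exp_minus field_simps)
  show ?thesis
    unfolding path_quotient_eq[OF w t] int D
    using z[OF t order_refl] zt by (cases "?g = 0") auto
qed

text \<open>The convexity bound, in a form that needs no division by \<open>o\<close>. With \<open>D\<close> the denominator divided by
\<open>g exp (H\<^sub>t)\<close>, the quotient is \<open>\<zeta>\<^sub>t / D\<close>, and \<open>D\<close> is itself an integral against \<open>\<beta>\<close>. Under the integral, \<open>1 / x\<close> is
replaced by its tangent \<open>2 / D - x / D\<^sup>2\<close> at \<open>D\<close>, after multiplication by the densities; each instance is an
inequality of arithmetic and geometric means. Where \<open>\<zeta>\<^sub>s = 0 < \<zeta>\<^sub>t\<close> the integrand on the right is \<open>\<infinity>\<close> unless
the density vanishes, so the inequality holds there as well.\<close>

lemma path_quotient_le: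
  fixes z :: "real \<Rightarrow> real"
  assumes w: "w \<in> space path_space" and t: "0 \<le> t" and z: "\<And>s. 0 \<le> s \<Longrightarrow> 0 \<le> z s"
    and int: "set_integrable lborel {0..t} (\<lambda>s. z s * (lam (w s) * exp (- hazard lam w s)))"
  shows "ennreal (path_quotient t w z) \<le> ennreal (exp (- thinned_hazard t w t) * optimal_martingale t w t) +
    (\<integral>\<^sup>+s. indicator {0..t} s * (ennreal (optimal_martingale t w s * thinned_density t w s) * inverse (ennreal (z (max 0 s))) * ennreal (z t)) \<partial>lborel)"
    (is "_ \<le> _ + ?R")
proof (cases "f (w t) = 1 \<or> z t = 0")
  case True
  then show ?thesis by (auto simp: path_quotient_def)
next
  case False
  let ?c = "exp (- thinned_hazard t w t)" and ?o = "optimal_martingale t w"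
  define g where "g = 1 - f (w t)"
  have g: "0 < g" using False f_bounds[of "w t"] by (auto simp: g_def less_le)
  have zt: "0 < z t" using False z[OF t] by simp
  let ?L = "hazard lam w"
  let ?y = "\<lambda>s. z s * (lam (w s) * exp (- ?L s))"
  define Y where "Y = (LINT s:{0..t}|lborel. ?y s)"
  have Y0: "0 \<le> Y"
    unfolding Y_def set_lebesgue_integral_def using z lam_nonneg
    by (intro Bochner_Integration.integral_nonneg) (auto simp: indicator_def)
  define y0 where "y0 = z t * exp (- ?L t) / g"
  \<comment> \<open>The contributions of the atom and of the density to \<open>D\<close>.\<close>
  define D where "D = y0 + Y"
  have y0: "0 < y0" using zt g by (simp add: y0_def)
  have D: "0 < D" using y0 Y0 by (simp add: D_def)
  have quotient: "path_quotient t w z = z t / D"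
  proof -
    have "z t + g * (exp (?L t) * Y) = g * exp (?L t) * D"
      using g by (simp add: D_def y0_def exp_minus field_simps)
    then show ?thesis
      unfolding path_quotient_eq[OF w t] g_def[symmetric] Y_def[symmetric] using g D by simp
  qed
  \<comment> \<open>The tangent inequality, multiplied by \<open>z t\<close>: for the atom at \<open>t\<close>, and for the density of \<open>\<beta>\<close>.\<close>
  let ?h = "\<lambda>s. z t * (2 * thinned_density t w s / D - ?y s / D\<^sup>2)"
  have ot: "?o t = g * exp (?L t) * ?c"
    using optimal_martingale_eq[OF w t, of t] by (simp add: mean_defect_0 g_def exp_diff exp_minus field_simps)
  have atom: "z t * (2 * ?c / D - y0 / D\<^sup>2) \<le> ?c * ?o t"
  proof -
    have "2 * (?c / D) \<le> ?c * ?o t / z t + y0 / D\<^sup>2"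
    proof (rule double_le_sum_if_square_eq)
      show "(?c / D)\<^sup>2 = ?c * ?o t / z t * (y0 / D\<^sup>2)"
        using g zt by (simp add: ot y0_def exp_minus power2_eq_square field_simps)
    qed (use g zt y0 D in \<open>auto simp: ot\<close>)
    then have "2 * ?c / D - y0 / D\<^sup>2 \<le> ?c * ?o t / z t"
      by simp
    from mult_left_mono[OF this, of "z t"] zt show ?thesis
      by simp
  qed
  have density: "ennreal (?h s) \<le> ennreal (?o s * thinned_density t w s) * inverse (ennreal (z s)) * ennreal (z t)"
    if s: "0 \<le> s" "s \<le> t" for s
  proof -
    have sq: "(thinned_density t w s)\<^sup>2 = (?o s * thinned_density t w s) * (lam (w s) * exp (- ?L s))"
      using s by (simp add: thinned_density_def optimal_martingale_eq[OF w] exp_diff exp_minus power2_eq_square field_simps)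
    have oa: "0 \<le> ?o s * thinned_density t w s"
      using optimal_martingale_bounds(1)[OF w s] thinned_density_bounds(1) by simp
    show ?thesis
    proof (cases "z s = 0")
      case True
      show ?thesis
      proof (cases "thinned_density t w s = 0")
        case False
        then have "?o s * thinned_density t w s \<noteq> 0"
          using sq by auto
        then have "0 < ?o s * thinned_density t w s"
          using oa by linarith
        then have p: "0 < ennreal (?o s * thinned_density t w s)"
          by (simp only: ennreal_less_zero_iff)
        have "e * inverse (ennreal 0) * ennreal (z t) = top" if "0 < e" for e
          using that zt by (simp add: ennreal_mult_top ennreal_top_mult)
        from this[OF p] show ?thesis
          unfolding True by simp
      qed (use True in simp)
    next
      case False
      then have zs: "0 < z s" using z[OF s(1)] by simp
      have "2 * (thinned_density t w s / D) \<le> ?o s * thinned_density t w s / z s + ?y s / D\<^sup>2"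
      proof (rule double_le_sum_if_square_eq)
        show "(thinned_density t w s / D)\<^sup>2 = ?o s * thinned_density t w s / z s * (?y s / D\<^sup>2)"
          using zs by (simp add: power_divide sq)
      qed (use oa zs lam_nonneg in auto)
      from mult_left_mono[OF this, of "z t"] zt have "?h s \<le> ?o s * thinned_density t w s / z s * z t"
        by (simp add: field_simps)
      then have "ennreal (?h s) \<le> ennreal (?o s * thinned_density t w s / z s * z t)"
        by (rule ennreal_leI)
      also have "\<dots> = ennreal (?o s * thinned_density t w s) * inverse (ennreal (z s)) * ennreal (z t)"
        using oa zs zt by (simp add: divide_inverse ennreal_mult inverse_ennreal)
      finally show ?thesis .
    qed
  qed
  have hi: "set_integrable lborel {0..t} ?h"
    using int thinned_density_integral(1)[OF w t] by (intro set_integrable_mult_right set_integral_diff set_integrable_divide) auto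
  have hint: "(LINT s:{0..t}|lborel. ?h s) = z t * (2 * (1 - ?c) / D - Y / D\<^sup>2)"
    using int thinned_density_integral[OF w t] by (simp add: Y_def)
  have "ennreal (LINT s:{0..t}|lborel. ?h s) \<le> ?R"
    unfolding set_lebesgue_integral_def
  proof (rule ennreal_integral_le_nn_integral)
    show "integrable lborel (\<lambda>s. indicator {0..t} s *\<^sub>R ?h s)"
      using hi by (simp add: set_integrable_def)
    fix s
    show "ennreal (indicator {0..t} s *\<^sub>R ?h s) \<le>
      indicator {0..t} s * (ennreal (?o s * thinned_density t w s) * inverse (ennreal (z (max 0 s))) * ennreal (z t))"
      using density[of s] by (auto simp: indicator_def max_def)
  qed
  moreover have "z t / D = z t * (2 * ?c / D - y0 / D\<^sup>2) + (LINT s:{0..t}|lborel. ?h s)"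
  proof -
    have "z t * (2 * ?c / D - y0 / D\<^sup>2) + z t * (2 * (1 - ?c) / D - Y / D\<^sup>2) = z t * (2 / D - D / D\<^sup>2)"
      unfolding D_def[symmetric] using D
      by (simp add: D_def add_divide_distrib diff_divide_distrib algebra_simps)
    also have "\<dots> = z t / D"
      using D by (simp add: power2_eq_square field_simps)
    finally show ?thesis unfolding hint by (rule sym)
  qed
  then have "z t / D \<le> ?c * ?o t + (LINT s:{0..t}|lborel. ?h s)"
    using atom by linarith
  then have "ennreal (z t / D) \<le> ennreal (?c * ?o t) + ennreal (LINT s:{0..t}|lborel. ?h s)"
    by (meson ennreal_leI ennreal_plus_le order_trans)
  ultimately show ?thesis
    unfolding quotient by (meson add_left_mono order_trans)
qed

end

section \<open>The maximum\<close>

text \<open>The densities \<open>f\<close> and \<open>g\<close> define the same measure on \<open>F\<close>, so their integrals against any \<open>Z\<close> agree, even one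
that takes the value \<open>\<infinity>\<close>.\<close>

lemma nn_integral_mult_cond_exp:
  assumes M: "prob_space M" and sub: "subalgebra M F"
    and f: "integrable M f" "\<And>x. x \<in> space M \<Longrightarrow> 0 \<le> f x"
    and g: "integrable M g" "\<And>x. x \<in> space M \<Longrightarrow> 0 \<le> g x"
    and ce: "AE x in M. real_cond_exp M F f x = g x"
    and Z: "Z \<in> borel_measurable F"
  shows "(\<integral>\<^sup>+x. Z x * ennreal (f x) \<partial>M) = (\<integral>\<^sup>+x. Z x * ennreal (g x) \<partial>M)"
proof -
  interpret prob_space M by fact
  interpret finite_measure_subalgebra M F using sub by unfold_locales
  have fm[measurable]: "(\<lambda>x. ennreal (f x)) \<in> borel_measurable M" "(\<lambda>x. ennreal (g x)) \<in> borel_measurable M"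
    using f(1) g(1) by auto
  let ?\<mu> = "density M (\<lambda>x. ennreal (f x))" and ?\<nu> = "density M (\<lambda>x. ennreal (g x))"
  have sub': "subalgebra ?\<mu> F" "subalgebra ?\<nu> F"
    using sub by (auto simp: subalgebra_def)
  have eq: "restr_to_subalg ?\<mu> F = restr_to_subalg ?\<nu> F"
  proof (rule measure_eqI)
    show "sets (restr_to_subalg ?\<mu> F) = sets (restr_to_subalg ?\<nu> F)"
      using sub' by (simp add: sets_restr_to_subalg)
    fix A assume "A \<in> sets (restr_to_subalg ?\<mu> F)"
    then have A: "A \<in> sets F" using sub' by (simp add: sets_restr_to_subalg)
    then have AM[measurable]: "A \<in> sets M" using sub by (auto simp: subalgebra_def)
    have dens: "emeasure (density M (\<lambda>x. ennreal (h x))) A = ennreal (LINT x:A|M. h x)"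
      if h: "integrable M h" "\<And>x. x \<in> space M \<Longrightarrow> 0 \<le> h x" for h
    proof -
      have "emeasure (density M (\<lambda>x. ennreal (h x))) A = (\<integral>\<^sup>+x. ennreal (h x) * indicator A x \<partial>M)"
        using h by (intro emeasure_density) auto
      also have "\<dots> = (\<integral>\<^sup>+x. ennreal (indicator A x *\<^sub>R h x) \<partial>M)"
        by (intro nn_integral_cong) (auto simp: indicator_def)
      also have "\<dots> = ennreal (LINT x:A|M. h x)"
        unfolding set_lebesgue_integral_def using h integrable_mult_indicator[OF AM h(1)]
        by (intro nn_integral_eq_integral) (auto simp: indicator_def intro!: AE_I2)
      finally show ?thesis .
    qed
    have "(LINT x:A|M. f x) = (LINT x:A|M. real_cond_exp M F f x)"
      by (rule real_cond_exp_intA[OF f(1) A])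
    also have "\<dots> = (LINT x:A|M. g x)"
      unfolding set_lebesgue_integral_def using ce borel_measurable_integrable[OF g(1)]
      by (intro integral_cong_AE) (auto elim!: eventually_mono)
    finally show "emeasure (restr_to_subalg ?\<mu> F) A = emeasure (restr_to_subalg ?\<nu> F) A"
      using sub' A by (simp add: emeasure_restr_to_subalg dens f g)
  qed
  have ZM: "Z \<in> borel_measurable M"
    by (rule measurable_from_subalg[OF sub Z])
  have "(\<integral>\<^sup>+x. Z x * ennreal (f x) \<partial>M) = (\<integral>\<^sup>+x. Z x \<partial>?\<mu>)"
    using ZM by (subst nn_integral_density) (auto simp: mult.commute)
  also have "\<dots> = (\<integral>\<^sup>+x. Z x \<partial>restr_to_subalg ?\<mu> F)"
    by (rule nn_integral_subalgebra2[OF sub'(1) Z, symmetric])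
  also have "\<dots> = (\<integral>\<^sup>+x. Z x \<partial>?\<nu>)"
    unfolding eq by (rule nn_integral_subalgebra2[OF sub'(2) Z])
  also have "\<dots> = (\<integral>\<^sup>+x. Z x * ennreal (g x) \<partial>M)"
    using ZM by (subst nn_integral_density) (auto simp: mult.commute)
  finally show ?thesis .
qed

lemma measurable_root_path: "(\<lambda>y. path_of (y [])) \<in> tree_space \<rightarrow>\<^sub>M (path_space :: 'a::polish_space path measure)"
  by (rule measurable_compose[OF measurable_tree_label[OF measurable_ident_sets[OF refl]] measurable_particle(1)])

text \<open>The initial particle is the root of the tree, whatever the subtrees are.\<close>

lemma (in binary_branching) distr_initial_path: "distr (Q x) path_space (\<lambda>y. path_of (y [])) = P x"
proof (rule measure_eqI)
  show "sets (distr (Q x) path_space (\<lambda>y. path_of (y []))) = sets (P x)"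
    by (simp add: prob_space_kernel(2)[OF P])
  fix B assume "B \<in> sets (distr (Q x) path_space (\<lambda>y. path_of (y [])))"
  then have B[measurable]: "B \<in> sets path_space" by simp
  note m = measurable_root_path[where 'a='a]
  have mQ: "(\<lambda>y. path_of (y [])) \<in> Q x \<rightarrow>\<^sub>M path_space"
    using m by (simp add: measurable_kernel[OF Q])
  have pK: "path_of \<in> K x \<rightarrow>\<^sub>M path_space"
    using measurable_particle(1) by (simp add: measurable_kernel[OF K])
  have ind: "(\<lambda>y. indicator B (path_of (y [])) :: ennreal) \<in> borel_measurable tree_space"
    by (rule measurable_compose[OF m]) simp
  have "emeasure (distr (Q x) path_space (\<lambda>y. path_of (y []))) B = (\<integral>\<^sup>+y. indicator B (path_of (y [])) \<partial>Q x)"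
    using mQ by (subst nn_integral_indicator[OF B[folded sets_distr[of "Q x" path_space "\<lambda>y. path_of (y [])"]], symmetric], subst nn_integral_distr) auto
  also have "\<dots> = (\<integral>\<^sup>+m. \<integral>\<^sup>+S. indicator B (path_of (graft m S [])) \<partial>PiM UNIV (\<lambda>_. Q (final_position m)) \<partial>K x)"
    by (rule nn_integral_Q[OF ind])
  also have "\<dots> = (\<integral>\<^sup>+m. indicator B (path_of m) \<partial>K x)"
    using prob_space.emeasure_space_1[OF prob_space_PiM[of UNIV "\<lambda>_::nat. Q _"]] prob_space_kernel(1)[OF Q]
    by simp
  also have "\<dots> = emeasure (distr (K x) path_space path_of) B"
    using pK by (subst nn_integral_indicator[OF B[folded sets_distr[of "K x" path_space path_of]], symmetric], subst nn_integral_distr) auto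
  finally show "emeasure (distr (Q x) path_space (\<lambda>y. path_of (y []))) B = emeasure (P x) B"
    by (simp add: distr_path)
qed

text \<open>A path-valued random variable with the law of the motion started at \<open>x0\<close>, on an arbitrary probability
space: martingales live on that space, not on path space.\<close>

locale observed_motion = binary_branching_markov +
  fixes M :: "'w measure" and \<pi> :: "'w \<Rightarrow> 'a path" and x0 :: 'a
  assumes prob: "prob_space M" and \<pi>[measurable]: "\<pi> \<in> M \<rightarrow>\<^sub>M path_space"
    and distr_\<pi>: "distr M path_space \<pi> = P x0"
begin

abbreviation F :: "ennreal \<Rightarrow> 'w measure" where
  "F \<equiv> natural_filtration M (\<lambda>s \<omega>. \<pi> \<omega> s)"

lemma space_\<pi>: "\<omega> \<in> space M \<Longrightarrow> \<pi> \<omega> \<in> space path_space"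
  by (rule measurable_space[OF \<pi>])

lemma measurable_motion: "0 \<le> r \<Longrightarrow> (\<lambda>\<omega>. \<pi> \<omega> r) \<in> borel_measurable M"
  by (rule measurable_compose[OF \<pi> measurable_path_eval])

lemma subalgebra_F: "subalgebra M (F s)"
  by (rule subalgebra_natural_filtration) (rule measurable_motion)

lemma \<pi>_filtration: "\<pi> \<in> F s \<rightarrow>\<^sub>M path_filtration s"
  unfolding natural_filtration_def[of path_space]
proof (rule measurable_measure_of)
  show "\<pi> \<in> space (F s) \<rightarrow> space path_space"
    using space_\<pi> by (auto simp: space_natural_filtration)
  fix A assume "A \<in> {(\<lambda>w. w r) -` A \<inter> space (path_space :: 'a path measure) | r A. 0 \<le> r \<and> ennreal r \<le> s \<and> A \<in> sets borel}"
  then obtain r B where A: "A = (\<lambda>w. w r) -` B \<inter> space path_space" and r: "0 \<le> r" "ennreal r \<le> s" and B: "B \<in> sets borel"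
    by blast
  have "\<pi> -` A \<inter> space (F s) = (\<lambda>\<omega>. \<pi> \<omega> r) -` B \<inter> space M"
    unfolding A space_natural_filtration using space_\<pi> by auto
  also have "\<dots> \<in> sets (F s)"
    unfolding sets_natural_filtration using r B by (intro sigma_sets.Basic) blast
  finally show "\<pi> -` A \<inter> space (F s) \<in> sets (F s)" .
qed auto

text \<open>Events of the filtration depend on the path only, so conditional expectations can be computed on path
space.\<close>

lemma F_sets_eq:
  assumes "A \<in> sets (F s)"
  obtains B where "B \<in> sets (path_filtration s)" "A = \<pi> -` B \<inter> space M"
proof -
  let ?V = "vimage_algebra (space M) \<pi> (path_filtration s)"
  have V: "sets ?V = {\<pi> -` B \<inter> space M | B. B \<in> sets (path_filtration s)}"
    by (rule sets_vimage_algebra2) (use space_\<pi> in auto)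
  have "sets (F s) \<subseteq> sets ?V"
    unfolding sets_natural_filtration[of M]
  proof (rule sets.sigma_sets_subset[of _ ?V, unfolded space_vimage_algebra], safe)
    fix r and B :: "'a set" assume r: "0 \<le> r" "ennreal r \<le> s" and B: "B \<in> sets borel"
    have "(\<lambda>w. w r) -` B \<inter> space path_space \<in> sets (path_filtration s :: 'a path measure)"
      unfolding sets_natural_filtration using r B by (intro sigma_sets.Basic) blast
    moreover have "(\<lambda>\<omega>. \<pi> \<omega> r) -` B \<inter> space M = \<pi> -` ((\<lambda>w. w r) -` B \<inter> space path_space) \<inter> space M"
      using space_\<pi> by auto
    ultimately show "(\<lambda>\<omega>. \<pi> \<omega> r) -` B \<inter> space M \<in> sets ?V"
      unfolding V by blast
  qed
  with assms that show ?thesis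
    unfolding V by blast
qed

lemma integral_\<pi>:
  fixes g :: "'a path \<Rightarrow> real"
  shows "g \<in> borel_measurable path_space \<Longrightarrow> (LINT \<omega>|M. g (\<pi> \<omega>)) = (LINT w|P x0. g w)"
  unfolding distr_\<pi>[symmetric] by (rule integral_distr[OF \<pi>, symmetric])

text \<open>The optimal martingale, stopped at the horizon because martingales are indexed by all times.\<close>

definition optimizer :: "real \<Rightarrow> real \<Rightarrow> 'w \<Rightarrow> real" where
  "optimizer t s \<omega> = optimal_martingale t (\<pi> \<omega>) (min s t)"

lemma optimizer_martingale:
  assumes t: "0 \<le> t"
  shows "optimizer t \<in> nonneg_martingales M F"
  unfolding nonneg_martingales_def mem_Collect_eq
proof (intro conjI allI impI ballI)
  interpret M: prob_space M by (rule prob)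
  have jm: "(\<lambda>z. optimal_martingale t (\<pi> (snd z)) (min (fst z) t)) \<in> borel_measurable (restrict_space borel {0..} \<Otimes>\<^sub>M M)"
  proof (rule measurable_optimal_martingale)
    have "(\<lambda>s. s) \<in> borel_measurable (restrict_space borel {0::real..})"
      by (rule measurable_restrict_space1) simp
    from measurable_compose[OF measurable_fst this] 
    show "(\<lambda>z. min (fst z) t) \<in> borel_measurable (restrict_space borel {0..} \<Otimes>\<^sub>M M)"
      by measurable
  qed measurable
  then show "(\<lambda>(s, \<omega>). optimizer t s \<omega>) \<in> borel_measurable (restrict_space borel {0..} \<Otimes>\<^sub>M M)"
    by (simp add: optimizer_def case_prod_beta')
  have adapted: "(\<lambda>w. optimal_martingale t w (min s t)) \<in> borel_measurable (path_filtration (ennreal s))" if s: "0 \<le> s" for s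
  proof (rule measurable_from_subalg)
    show "subalgebra (path_filtration (ennreal s)) (path_filtration (ennreal (min s t)) :: 'a path measure)"
      using sets_natural_filtration_mono[of "ennreal (min s t)" "ennreal s" path_space "\<lambda>s w. w s"]
      by (auto simp: subalgebra_def ennreal_leI)
    show "(\<lambda>w. optimal_martingale t w (min s t)) \<in> borel_measurable (path_filtration (ennreal (min s t)))"
      by (rule optimal_martingale_adapted) (use s t in simp)
  qed
  have meas: "(\<lambda>w. optimal_martingale t w (min s t)) \<in> borel_measurable path_space" if "0 \<le> s" for s
    by (rule measurable_from_path_filtration[OF adapted[OF that]])
  have b: "0 \<le> optimizer t s \<omega>" "optimizer t s \<omega> \<le> exp (C * t)" if "0 \<le> s" "\<omega> \<in> space M" for s \<omega>
    unfolding optimizer_def using optimal_martingale_bounds[OF space_\<pi>[OF that(2)], of "min s t" t] that t by auto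
  have ad: "optimizer t s \<in> borel_measurable (F (ennreal s))" if "0 \<le> s" for s
    using measurable_compose[OF \<pi>_filtration adapted[OF that]] by (simp add: optimizer_def[abs_def])
  have int: "integrable M (optimizer t s)" if "0 \<le> s" for s
    using b[OF that] measurable_from_subalg[OF subalgebra_F ad[OF that]]
    by (intro M.integrable_const_bound[where B="exp (C * t)"]) auto
  fix s :: real assume s: "0 \<le> s"
  show "optimizer t s \<in> borel_measurable (F (ennreal s))" "integrable M (optimizer t s)"
    by (rule ad[OF s], rule int[OF s])
  show "0 \<le> optimizer t s \<omega>" if "\<omega> \<in> space M" for \<omega>
    by (rule b[OF s that])
  fix s' :: real assume s': "s \<le> s'"
  interpret finite_measure_subalgebra M "F (ennreal s)"
    using subalgebra_F by unfold_locales
  show "AE \<omega> in M. real_cond_exp M (F (ennreal s)) (optimizer t s') \<omega> = optimizer t s \<omega>"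
  proof (rule real_cond_exp_charact[OF _ int int[OF s] ad[OF s]])
    show "0 \<le> s'" using s s' by simp
    fix A assume "A \<in> sets (F (ennreal s))"
    then obtain B where B: "B \<in> sets (path_filtration (ennreal s))" and A: "A = \<pi> -` B \<inter> space M"
      by (rule F_sets_eq)
    have Bp[measurable]: "B \<in> sets path_space"
      using B sets_path_filtration_subset by auto
    have transfer: "(LINT \<omega>:A|M. optimizer t q \<omega>) = (LINT w|P x0. indicator B w * optimal_martingale t w (min q t))" if q: "0 \<le> q" for q
    proof -
      have "(LINT \<omega>:A|M. optimizer t q \<omega>) = (LINT \<omega>|M. indicator B (\<pi> \<omega>) * optimal_martingale t (\<pi> \<omega>) (min q t))"
        unfolding set_lebesgue_integral_def
        by (rule Bochner_Integration.integral_cong) (auto simp: A optimizer_def indicator_def)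
      also have "\<dots> = (LINT w|P x0. indicator B w * optimal_martingale t w (min q t))"
        by (rule integral_\<pi>) (use meas[OF q] in measurable)
      finally show ?thesis .
    qed
    have terminal: "(LINT w|P x0. indicator B w * optimal_martingale t w (min q t)) = (LINT w|P x0. indicator B w * optimal_martingale t w t)"
      if q: "s \<le> q" for q
    proof (cases "t \<le> q")
      case False
      then have "min q t = q" "0 \<le> q" "q \<le> t" using s q by auto
      moreover have "(indicator B :: 'a path \<Rightarrow> real) \<in> borel_measurable (path_filtration (ennreal q))"
        using B q sets_natural_filtration_mono[of "ennreal s" "ennreal q" path_space "\<lambda>s w. w s"]
        by (intro borel_measurable_indicator) (auto simp: ennreal_leI)
      ultimately show ?thesis
        using optimal_martingale_property[of q t "indicator B" 1 x0] by (simp add: indicator_def)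
    qed (simp add: min_def)
    show "(LINT \<omega>:A|M. optimizer t s' \<omega>) = (LINT \<omega>:A|M. optimizer t s \<omega>)"
      using s s' by (simp only: transfer terminal order_trans[OF s s'] order_refl)
  qed
qed

lemma functional_eq: "functional M (\<lambda>s \<omega>. \<pi> \<omega> s) lam f t \<zeta> = (LINT \<omega>|M. path_quotient t (\<pi> \<omega>) (\<lambda>s. \<zeta> s \<omega>))"
  by (simp add: functional_def path_quotient_def)

lemma expectation_optimal:
  assumes t: "0 \<le> t"
  shows "(LINT \<omega>|M. optimal_martingale t (\<pi> \<omega>) t) = mean_defect t x0"
proof -
  interpret P: prob_space "P x0" by (rule prob_space_kernel[OF P])
  have m: "(\<lambda>w. optimal_martingale t w s) \<in> borel_measurable path_space" for s
    by (rule measurable_optimal_martingale) measurable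
  have mP: "(\<lambda>w. optimal_martingale t w s) \<in> borel_measurable (P x0)" for s
    using m by (simp add: measurable_kernel[OF P])
  have "(LINT \<omega>|M. optimal_martingale t (\<pi> \<omega>) t) = (LINT w|P x0. 1 * optimal_martingale t w t)"
    using integral_\<pi>[OF m] by simp
  also have "\<dots> = (LINT w|P x0. 1 * optimal_martingale t w 0)"
    by (rule optimal_martingale_property[OF order_refl t, of _ 1]) auto
  also have "\<dots> = (LINT w|P x0. mean_defect t x0)"
  proof (rule integral_cong_AE)
    have "AE w in P x0. w 0 = x0" using markov by (simp add: strong_markov_def)
    then show "AE w in P x0. 1 * optimal_martingale t w 0 = mean_defect t x0"
      using AE_space
    proof eventually_elim
      case (elim w)
      then have "w \<in> space path_space" by (simp add: prob_space_kernel(3)[OF P])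
      then show ?case
        using optimal_martingale_eq[of w 0 t] elim by (simp add: path_integral_0 thinned_hazard_def)
    qed
  qed (use mP in simp_all)
  finally show ?thesis by (simp add: P.prob_space)
qed

lemma functional_optimizer:
  assumes t: "0 \<le> t"
  shows "functional M (\<lambda>s \<omega>. \<pi> \<omega> s) lam f t (optimizer t) = mean_defect t x0"
proof -
  have "functional M (\<lambda>s \<omega>. \<pi> \<omega> s) lam f t (optimizer t) = (LINT \<omega>|M. optimal_martingale t (\<pi> \<omega>) t)"
    unfolding functional_eq
    by (rule Bochner_Integration.integral_cong[OF refl])
       (rule path_quotient_optimal[OF space_\<pi> t], simp_all add: optimizer_def)
  then show ?thesis
    by (simp add: expectation_optimal[OF t])
qed

context
  fixes t :: real and \<zeta> :: "real \<Rightarrow> 'w \<Rightarrow> real"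
  assumes t: "0 \<le> t" and \<zeta>: "\<zeta> \<in> nonneg_martingales M F"
begin

lemma \<zeta>_joint: "(\<lambda>(s, \<omega>). \<zeta> s \<omega>) \<in> borel_measurable (restrict_space borel {0..} \<Otimes>\<^sub>M M)"
  and \<zeta>_adapted: "\<And>s. 0 \<le> s \<Longrightarrow> \<zeta> s \<in> borel_measurable (F (ennreal s))"
  and \<zeta>_integrable: "\<And>s. 0 \<le> s \<Longrightarrow> integrable M (\<zeta> s)"
  and \<zeta>_nonneg: "\<And>s \<omega>. 0 \<le> s \<Longrightarrow> \<omega> \<in> space M \<Longrightarrow> 0 \<le> \<zeta> s \<omega>"
  and \<zeta>_cond_exp: "\<And>s s'. 0 \<le> s \<Longrightarrow> s \<le> s' \<Longrightarrow> AE \<omega> in M. real_cond_exp M (F (ennreal s)) (\<zeta> s') \<omega> = \<zeta> s \<omega>"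
  using \<zeta> by (auto simp: nonneg_martingales_def)

lemma \<zeta>_expectation:
  assumes "0 \<le> s"
  shows "(\<integral>\<^sup>+\<omega>. ennreal (\<zeta> s \<omega>) \<partial>M) = (\<integral>\<^sup>+\<omega>. ennreal (\<zeta> 0 \<omega>) \<partial>M)"
  using nn_integral_mult_cond_exp[OF prob subalgebra_F \<zeta>_integrable[OF assms] \<zeta>_nonneg[OF assms]
      \<zeta>_integrable[OF order_refl] \<zeta>_nonneg[OF order_refl] \<zeta>_cond_exp[OF order_refl assms], of "\<lambda>_. 1"]
  by simp

lemma measurable_\<zeta>: "(\<lambda>z. \<zeta> (max 0 (snd z)) (fst z)) \<in> borel_measurable (M \<Otimes>\<^sub>M lborel)"
proof (rule measurable_Pair_compose_split[OF \<zeta>_joint])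
  show "(\<lambda>z. max 0 (snd z)) \<in> M \<Otimes>\<^sub>M lborel \<rightarrow>\<^sub>M restrict_space borel {0::real..}"
    by (rule measurable_restrict_space2) auto
qed measurable

text \<open>A nonnegative martingale has constant mean, so Tonelli's theorem bounds the expected integral by
\<open>C t E \<zeta>\<^sub>0\<close>.\<close>

lemma AE_integrable_path:
  "AE \<omega> in M. set_integrable lborel {0..t} (\<lambda>s. \<zeta> s \<omega> * (lam (\<pi> \<omega> s) * exp (- hazard lam (\<pi> \<omega>) s)))"
proof -
  interpret M: prob_space M by (rule prob)
  interpret M_lborel: pair_sigma_finite M lborel ..
  note [measurable] = measurable_\<zeta>
  let ?y = "\<lambda>\<omega> s. indicator {0..t} s * (\<zeta> (max 0 s) \<omega> * lifetime_density lam (\<pi> \<omega>) s)"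
  have [measurable]: "(\<lambda>z. \<pi> (fst z) (max 0 (snd z))) \<in> borel_measurable (M \<Otimes>\<^sub>M lborel)"
    by (rule measurable_path_eval_compose) measurable
  have ym: "(\<lambda>z. ?y (fst z) (snd z)) \<in> borel_measurable (M \<Otimes>\<^sub>M lborel)"
    by measurable
  then have ym': "(\<lambda>(\<omega>, s). ennreal (?y \<omega> s)) \<in> borel_measurable (M \<Otimes>\<^sub>M lborel)"
    by (simp add: case_prod_beta')
  have "(\<integral>\<^sup>+\<omega>. (\<integral>\<^sup>+s. ?y \<omega> s \<partial>lborel) \<partial>M) = (\<integral>\<^sup>+s. (\<integral>\<^sup>+\<omega>. ?y \<omega> s \<partial>M) \<partial>lborel)"
    by (rule M_lborel.Fubini'[OF ym', symmetric])
  also have "\<dots> \<le> (\<integral>\<^sup>+s. (ennreal C * (\<integral>\<^sup>+\<omega>. ennreal (\<zeta> 0 \<omega>) \<partial>M)) * indicator {0..t} s \<partial>lborel)"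
  proof (rule nn_integral_mono)
    fix s :: real
    show "(\<integral>\<^sup>+\<omega>. ?y \<omega> s \<partial>M) \<le> (ennreal C * (\<integral>\<^sup>+\<omega>. ennreal (\<zeta> 0 \<omega>) \<partial>M)) * indicator {0..t} s"
    proof (cases "s \<in> {0..t}")
      case True
      have "(\<integral>\<^sup>+\<omega>. ?y \<omega> s \<partial>M) \<le> (\<integral>\<^sup>+\<omega>. ennreal C * ennreal (\<zeta> s \<omega>) \<partial>M)"
      proof (rule nn_integral_mono)
        fix \<omega> assume \<omega>: "\<omega> \<in> space M"
        have "lifetime_density lam (\<pi> \<omega>) s \<le> C * 1"
          using lam_le lam_nonneg C_nonneg hazard_nonneg by (intro mult_mono) auto
        then have "\<zeta> s \<omega> * lifetime_density lam (\<pi> \<omega>) s \<le> \<zeta> s \<omega> * C"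
          using True \<zeta>_nonneg[OF _ \<omega>] by (intro mult_left_mono) auto
        then show "ennreal (?y \<omega> s) \<le> ennreal C * ennreal (\<zeta> s \<omega>)"
          using True C_nonneg \<zeta>_nonneg[OF _ \<omega>, of s] by (simp add: ennreal_mult[symmetric] mult.commute ennreal_leI)
      qed
      also have "\<dots> = ennreal C * (\<integral>\<^sup>+\<omega>. ennreal (\<zeta> 0 \<omega>) \<partial>M)"
      proof (subst nn_integral_cmult)
        show "(\<lambda>\<omega>. ennreal (\<zeta> s \<omega>)) \<in> borel_measurable M"
          using True by (intro measurable_compose[OF borel_measurable_integrable[OF \<zeta>_integrable] measurable_ennreal]) simp
        show "ennreal C * (\<integral>\<^sup>+\<omega>. ennreal (\<zeta> s \<omega>) \<partial>M) = ennreal C * (\<integral>\<^sup>+\<omega>. ennreal (\<zeta> 0 \<omega>) \<partial>M)"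
          using True by (subst \<zeta>_expectation) auto
      qed
      finally show ?thesis using True by simp
    qed simp
  qed
  also have "\<dots> = (ennreal C * (\<integral>\<^sup>+\<omega>. ennreal (\<zeta> 0 \<omega>) \<partial>M)) * ennreal t"
    using t by (simp add: nn_integral_cmult_indicator)
  also have "\<dots> < \<infinity>"
    using \<zeta>_integrable[OF order_refl] \<zeta>_nonneg[OF order_refl]
    by (subst nn_integral_eq_integral) (auto simp: ennreal_mult_less_top intro!: AE_I2)
  finally have "AE \<omega> in M. (\<integral>\<^sup>+s. ?y \<omega> s \<partial>lborel) \<noteq> \<infinity>"
    using ym' by (intro nn_integral_PInf_AE lborel.borel_measurable_nn_integral) auto
  then show ?thesis
    using AE_space
  proof eventually_elim
    case (elim \<omega>)
    have eq: "(\<lambda>s. indicator {0..t} s *\<^sub>R (\<zeta> s \<omega> * (lam (\<pi> \<omega> s) * exp (- hazard lam (\<pi> \<omega>) s)))) = ?y \<omega>"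
      by (auto simp: indicator_def)
    have "?y \<omega> \<in> borel_measurable lborel"
      using measurable_compose[OF measurable_Pair1'[OF elim(2)] ym] by (simp only: fst_conv snd_conv)
    moreover have "(\<integral>\<^sup>+s. ennreal (norm (?y \<omega> s)) \<partial>lborel) = (\<integral>\<^sup>+s. ?y \<omega> s \<partial>lborel)"
      using \<zeta>_nonneg elim(2) lam_nonneg by (intro nn_integral_cong) (auto simp: indicator_def abs_mult)
    ultimately show ?case
      unfolding set_integrable_def eq using elim(1) by (intro integrableI_bounded) (auto simp: less_top)
  qed
qed

text \<open>Conditioning at time \<open>s\<close> turns \<open>\<zeta>\<^sub>t / \<zeta>\<^sub>s\<close> into \<open>\<zeta>\<^sub>s / \<zeta>\<^sub>s\<close>, which is at most 1; the inequality is strict only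
where \<open>\<zeta>\<^sub>s = 0\<close>, because \<open>\<infinity> \<cdot> 0 = 0\<close>. Then the martingale property of \<open>o\<close> moves \<open>o\<^sub>s\<close> to time \<open>t\<close>, the density at
time \<open>s\<close> being known at time \<open>s\<close>.\<close>

lemma expectation_ratio_le:
  assumes s: "0 \<le> s" "s \<le> t"
  shows "(\<integral>\<^sup>+\<omega>. ennreal (optimal_martingale t (\<pi> \<omega>) s * thinned_density t (\<pi> \<omega>) s) * inverse (ennreal (\<zeta> s \<omega>)) * ennreal (\<zeta> t \<omega>) \<partial>M)
    \<le> (\<integral>\<^sup>+\<omega>. ennreal (optimal_martingale t (\<pi> \<omega>) t * thinned_density t (\<pi> \<omega>) s) \<partial>M)"
proof -
  interpret M: prob_space M by (rule prob)
  let ?o = "optimal_martingale t" and ?a = "thinned_density t"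
  have adapted: "(\<lambda>\<omega>. ?o (\<pi> \<omega>) s) \<in> borel_measurable (F (ennreal s))" "(\<lambda>\<omega>. ?a (\<pi> \<omega>) s) \<in> borel_measurable (F (ennreal s))"
    by (rule measurable_compose[OF \<pi>_filtration optimal_martingale_adapted[OF s(1)]])
       (rule measurable_compose[OF \<pi>_filtration thinned_density_adapted[OF s(1)]])
  have meas: "(\<lambda>w. ?a w s * ?o w q) \<in> borel_measurable path_space" for q
    by (intro borel_measurable_times measurable_optimal_martingale measurable_thinned_density) measurable
  have oi: "integrable M (\<lambda>\<omega>. ?o (\<pi> \<omega>) q * ?a (\<pi> \<omega>) s)" if q: "0 \<le> q" "q \<le> t" for q
  proof (rule M.integrable_const_bound[where B="exp (C * t) * C"])
    show "AE \<omega> in M. norm (?o (\<pi> \<omega>) q * ?a (\<pi> \<omega>) s) \<le> exp (C * t) * C"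
      unfolding real_norm_def abs_mult using optimal_martingale_bounds[OF space_\<pi> q] thinned_density_bounds
      by (intro AE_I2 mult_mono) auto
    show "(\<lambda>\<omega>. ?o (\<pi> \<omega>) q * ?a (\<pi> \<omega>) s) \<in> borel_measurable M"
      using measurable_compose[OF \<pi> meas] by (simp add: mult.commute)
  qed
  have "(\<integral>\<^sup>+\<omega>. ennreal (?o (\<pi> \<omega>) s * ?a (\<pi> \<omega>) s) * inverse (ennreal (\<zeta> s \<omega>)) * ennreal (\<zeta> t \<omega>) \<partial>M)
      = (\<integral>\<^sup>+\<omega>. ennreal (?o (\<pi> \<omega>) s * ?a (\<pi> \<omega>) s) * inverse (ennreal (\<zeta> s \<omega>)) * ennreal (\<zeta> s \<omega>) \<partial>M)"
    by (rule nn_integral_mult_cond_exp[OF prob subalgebra_F \<zeta>_integrable[OF t] \<zeta>_nonneg[OF t]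
        \<zeta>_integrable[OF s(1)] \<zeta>_nonneg[OF s(1)] \<zeta>_cond_exp[OF s]])
       (use adapted \<zeta>_adapted[OF s(1)] in measurable)
  also have "\<dots> \<le> (\<integral>\<^sup>+\<omega>. ennreal (?o (\<pi> \<omega>) s * ?a (\<pi> \<omega>) s) \<partial>M)"
  proof (rule nn_integral_mono)
    fix \<omega>
    have "inverse e * e \<le> (1 :: ennreal)" for e
      by (cases "e = 0 \<or> e = top") (auto simp: less_top mult.commute[of "inverse e"] ennreal_divide_self simp flip: divide_ennreal_def)
    from mult_left_mono[OF this, of "ennreal (?o (\<pi> \<omega>) s * ?a (\<pi> \<omega>) s)"]
    show "ennreal (?o (\<pi> \<omega>) s * ?a (\<pi> \<omega>) s) * inverse (ennreal (\<zeta> s \<omega>)) * ennreal (\<zeta> s \<omega>) \<le> ennreal (?o (\<pi> \<omega>) s * ?a (\<pi> \<omega>) s)"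
      by (simp add: mult.assoc)
  qed
  also have "\<dots> = ennreal (LINT \<omega>|M. ?o (\<pi> \<omega>) s * ?a (\<pi> \<omega>) s)"
    using optimal_martingale_bounds(1)[OF space_\<pi> s] thinned_density_bounds(1)
    by (intro nn_integral_eq_integral oi s AE_I2) auto
  also have "(LINT \<omega>|M. ?o (\<pi> \<omega>) s * ?a (\<pi> \<omega>) s) = (LINT w|P x0. ?a w s * ?o w s)"
    using integral_\<pi>[OF meas] by (simp add: mult.commute)
  also have "\<dots> = (LINT w|P x0. ?a w s * ?o w t)"
    by (rule optimal_martingale_property[OF s thinned_density_adapted[OF s(1)], of _ C, symmetric])
       (simp add: thinned_density_bounds)
  also have "\<dots> = (LINT \<omega>|M. ?o (\<pi> \<omega>) t * ?a (\<pi> \<omega>) s)"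
    using integral_\<pi>[OF meas] by (simp add: mult.commute)
  also have "ennreal \<dots> = (\<integral>\<^sup>+\<omega>. ennreal (?o (\<pi> \<omega>) t * ?a (\<pi> \<omega>) s) \<partial>M)"
    using optimal_martingale_bounds(1)[OF space_\<pi> t order_refl] thinned_density_bounds(1)
    by (intro nn_integral_eq_integral[symmetric] oi t order_refl AE_I2) auto
  finally show ?thesis .
qed

text \<open>Integrating \<open>path_quotient_le\<close> and exchanging the integrals, the total weight of \<open>\<beta>\<close> remains as a factor of \<open>o\<^sub>t\<close>.\<close>

lemma functional_le: "functional M (\<lambda>s \<omega>. \<pi> \<omega> s) lam f t \<zeta> \<le> mean_defect t x0"
proof -
  interpret M: prob_space M by (rule prob)
  interpret M_lborel: pair_sigma_finite M lborel ..
  let ?o = "\<lambda>\<omega>. optimal_martingale t (\<pi> \<omega>)" and ?a = "\<lambda>\<omega>. thinned_density t (\<pi> \<omega>)"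
  let ?c = "\<lambda>\<omega>. exp (- thinned_hazard t (\<pi> \<omega>) t)"
  let ?R = "\<lambda>\<omega> s. indicator {0..t} s * (ennreal (?o \<omega> s * ?a \<omega> s) * inverse (ennreal (\<zeta> (max 0 s) \<omega>)) * ennreal (\<zeta> t \<omega>))"
  let ?R' = "\<lambda>\<omega> s. indicator {0..t} s * ennreal (?o \<omega> t * ?a \<omega> s)"
  note [measurable] = measurable_\<zeta> borel_measurable_integrable[OF \<zeta>_integrable[OF t]]
  have [measurable]: "(\<lambda>z. ?o (fst z) (snd z)) \<in> borel_measurable (M \<Otimes>\<^sub>M lborel)"
    by (rule measurable_optimal_martingale) measurable
  have [measurable]: "(\<lambda>z. ?a (fst z) (snd z)) \<in> borel_measurable (M \<Otimes>\<^sub>M lborel)"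
    by (rule measurable_thinned_density) measurable
  have otm[measurable]: "(\<lambda>\<omega>. ?o \<omega> t) \<in> borel_measurable M"
    by (rule measurable_optimal_martingale) measurable
  have cm: "?c \<in> borel_measurable M"
    using measurable_path_integral[OF measurable_thinned_rate[of t], of "\<lambda>_. t" M \<pi>] unfolding thinned_hazard_def by measurable
  have com: "(\<lambda>\<omega>. ennreal (?c \<omega> * ?o \<omega> t)) \<in> borel_measurable M"
    by (rule measurable_compose[OF borel_measurable_times[OF cm otm] measurable_ennreal])
  have Rm: "case_prod ?R \<in> borel_measurable (M \<Otimes>\<^sub>M lborel)" and R'm: "case_prod ?R' \<in> borel_measurable (M \<Otimes>\<^sub>M lborel)"
    unfolding case_prod_beta' by measurable
  have R_le: "(\<integral>\<^sup>+\<omega>. ?R \<omega> s \<partial>M) \<le> (\<integral>\<^sup>+\<omega>. ?R' \<omega> s \<partial>M)" for s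
    using expectation_ratio_le[of s] by (cases "s \<in> {0..t}") auto
  have "(\<integral>\<^sup>+\<omega>. ennreal (path_quotient t (\<pi> \<omega>) (\<lambda>s. \<zeta> s \<omega>)) \<partial>M) \<le>
      (\<integral>\<^sup>+\<omega>. ennreal (?c \<omega> * ?o \<omega> t) + (\<integral>\<^sup>+s. ?R \<omega> s \<partial>lborel) \<partial>M)"
  proof (rule nn_integral_mono_AE)
    show "AE \<omega> in M. ennreal (path_quotient t (\<pi> \<omega>) (\<lambda>s. \<zeta> s \<omega>)) \<le> ennreal (?c \<omega> * ?o \<omega> t) + (\<integral>\<^sup>+s. ?R \<omega> s \<partial>lborel)"
      using AE_integrable_path AE_space
    proof eventually_elim
      case (elim \<omega>)
      show ?case
        by (rule path_quotient_le[OF space_\<pi>[OF elim(2)] t \<zeta>_nonneg[OF _ elim(2)] elim(1)])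
    qed
  qed
  also have "\<dots> = (\<integral>\<^sup>+\<omega>. ennreal (?c \<omega> * ?o \<omega> t) \<partial>M) + (\<integral>\<^sup>+\<omega>. (\<integral>\<^sup>+s. ?R \<omega> s \<partial>lborel) \<partial>M)"
    by (rule nn_integral_add) (rule com, rule lborel.borel_measurable_nn_integral[OF Rm])
  also have "(\<integral>\<^sup>+\<omega>. (\<integral>\<^sup>+s. ?R \<omega> s \<partial>lborel) \<partial>M) = (\<integral>\<^sup>+s. (\<integral>\<^sup>+\<omega>. ?R \<omega> s \<partial>M) \<partial>lborel)"
    by (rule M_lborel.Fubini'[OF Rm, symmetric])
  also have "\<dots> \<le> (\<integral>\<^sup>+s. (\<integral>\<^sup>+\<omega>. ?R' \<omega> s \<partial>M) \<partial>lborel)"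
    by (rule nn_integral_mono) (rule R_le)
  also have "(\<integral>\<^sup>+s. (\<integral>\<^sup>+\<omega>. ?R' \<omega> s \<partial>M) \<partial>lborel) = (\<integral>\<^sup>+\<omega>. (\<integral>\<^sup>+s. ?R' \<omega> s \<partial>lborel) \<partial>M)"
    by (rule M_lborel.Fubini'[OF R'm])
  also have "(\<integral>\<^sup>+\<omega>. ennreal (?c \<omega> * ?o \<omega> t) \<partial>M) + \<dots> = (\<integral>\<^sup>+\<omega>. ennreal (?c \<omega> * ?o \<omega> t) + (\<integral>\<^sup>+s. ?R' \<omega> s \<partial>lborel) \<partial>M)"
    by (rule nn_integral_add[symmetric]) (rule com, rule lborel.borel_measurable_nn_integral[OF R'm])
  also have "\<dots> = (\<integral>\<^sup>+\<omega>. ennreal (?o \<omega> t) \<partial>M)"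
  proof (rule nn_integral_cong)
    fix \<omega> assume \<omega>: "\<omega> \<in> space M"
    note w = space_\<pi>[OF \<omega>]
    have o0: "0 \<le> ?o \<omega> t" by (rule optimal_martingale_bounds(1)[OF w t order_refl])
    have "(\<integral>\<^sup>+s. ?R' \<omega> s \<partial>lborel) = (\<integral>\<^sup>+s. ennreal (indicator {0..t} s *\<^sub>R (?o \<omega> t * ?a \<omega> s)) \<partial>lborel)"
      by (intro nn_integral_cong) (auto simp: indicator_def)
    also have "\<dots> = ennreal (LINT s:{0..t}|lborel. ?o \<omega> t * ?a \<omega> s)"
      using set_integrable_mult_right[OF thinned_density_integral(1)[OF w t], of "?o \<omega> t"] o0 thinned_density_bounds(1)
      unfolding set_lebesgue_integral_def set_integrable_def
      by (intro nn_integral_eq_integral) (auto simp: indicator_def)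
    also have "(LINT s:{0..t}|lborel. ?o \<omega> t * ?a \<omega> s) = ?o \<omega> t * (1 - ?c \<omega>)"
      by (simp add: thinned_density_integral(2)[OF w t])
    finally have "(\<integral>\<^sup>+s. ?R' \<omega> s \<partial>lborel) = ennreal (?o \<omega> t * (1 - ?c \<omega>))" .
    then have "ennreal (?c \<omega> * ?o \<omega> t) + (\<integral>\<^sup>+s. ?R' \<omega> s \<partial>lborel) = ennreal (?c \<omega> * ?o \<omega> t + ?o \<omega> t * (1 - ?c \<omega>))"
      using o0 thinned_hazard_nonneg[of t "\<pi> \<omega>" t] by (subst ennreal_plus) auto
    also have "\<dots> = ennreal (?o \<omega> t)"
      by (simp add: algebra_simps)
    finally show "ennreal (?c \<omega> * ?o \<omega> t) + (\<integral>\<^sup>+s. ?R' \<omega> s \<partial>lborel) = ennreal (?o \<omega> t)" .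
  qed
  also have "\<dots> = ennreal (LINT \<omega>|M. ?o \<omega> t)"
    using optimal_martingale_bounds[OF space_\<pi> t order_refl]
    by (intro nn_integral_eq_integral M.integrable_const_bound[where B="exp (C * t)"] AE_I2) auto
  also have "\<dots> = ennreal (mean_defect t x0)"
    by (simp add: expectation_optimal[OF t])
  finally have bound: "(\<integral>\<^sup>+\<omega>. ennreal (path_quotient t (\<pi> \<omega>) (\<lambda>s. \<zeta> s \<omega>)) \<partial>M) \<le> ennreal (mean_defect t x0)"
    by (simp add: add_left_mono)
  show ?thesis
  proof (cases "integrable M (\<lambda>\<omega>. path_quotient t (\<pi> \<omega>) (\<lambda>s. \<zeta> s \<omega>))")
    case True
    then have "ennreal (LINT \<omega>|M. path_quotient t (\<pi> \<omega>) (\<lambda>s. \<zeta> s \<omega>)) \<le> ennreal (mean_defect t x0)"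
      by (rule order_trans[OF ennreal_integral_le_nn_integral[OF _ order_refl] bound])
    then show ?thesis
      unfolding functional_eq by (simp add: ennreal_le_iff mean_defect_bounds)
  next
    case False
    then show ?thesis
      unfolding functional_eq using mean_defect_bounds by (simp add: not_integrable_integral_eq)
  qed
qed

end

end

theorem corollary1p4:
  fixes P :: "'a::polish_space \<Rightarrow> 'a path measure"
    and lam :: "'a \<Rightarrow> real"
    and K :: "'a \<Rightarrow> 'a particle measure"
    and M :: "'w measure"
    and Y :: "'w \<Rightarrow> 'a tree"
    and x0 :: 'a
    and f :: "'a \<Rightarrow> real"
    and t :: real
  assumes "strong_markov P"
    and "lam \<in> borel_measurable borel" and "\<And>x. 0 \<le> lam x" and "\<exists>C. \<forall>x. lam x \<le> C"
    and "particle_law P lam K"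
    and "branching_process M K x0 Y"
    and "\<And>x. AE m in K x. offspring m = 2"
    and "f \<in> borel_measurable borel" and "\<And>x. 0 \<le> f x \<and> f x \<le> 1"
    and "0 \<le> t"
  defines "X \<equiv> initial_motion Y"
  defines "\<M> \<equiv> nonneg_martingales M (natural_filtration M X)"
  defines "u \<equiv> (LINT \<omega>|M. (\<Prod>i\<in>alive (Y \<omega>) t. f (position (Y \<omega>) t i)))"
  shows "\<exists>\<zeta>. is_arg_max (functional M X lam f t) (\<lambda>\<zeta>. \<zeta> \<in> \<M>) \<zeta> \<and>
             u = 1 - functional M X lam f t \<zeta>"
proof -
  obtain C where C: "\<And>x. lam x \<le> C" using assms(4) by blast
  obtain Q where QY: "branching_law K Q" "distr M tree_space Y = Q x0"
    and M: "prob_space M" and Y[measurable]: "Y \<in> M \<rightarrow>\<^sub>M tree_space"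
    using assms(6) unfolding branching_process_def by blast
  interpret binary_branching_markov P lam C K Q f
    by unfold_locales (use assms C QY in \<open>auto simp: strong_markov_def\<close>)
  let ?\<pi> = "\<lambda>\<omega>. path_of (Y \<omega> [])"
  note root = measurable_root_path[where 'a='a]
  interpret observed_motion P lam C K Q f M ?\<pi> x0
  proof (rule observed_motion.intro[OF binary_branching_markov_axioms observed_motion_axioms.intro])
    show "prob_space M" by fact
    show "?\<pi> \<in> M \<rightarrow>\<^sub>M path_space"
      by (rule measurable_compose[OF Y root])
    have "distr M path_space ?\<pi> = distr (distr M tree_space Y) path_space (\<lambda>y. path_of (y []))"
      by (simp add: distr_distr[OF root Y] comp_def)
    then show "distr M path_space ?\<pi> = P x0"
      by (simp add: QY(2) distr_initial_path)
  qed
  have X: "X = (\<lambda>s \<omega>. ?\<pi> \<omega> s)"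
    by (simp add: X_def initial_motion_def fun_eq_iff)
  have "u = (LINT y|distr M tree_space Y. population_product f y t)"
    unfolding u_def population_product_def[symmetric]
    by (rule integral_distr[OF Y measurable_population_product_Q(1)[OF \<open>0 \<le> t\<close>], symmetric])
  then have u: "u = 1 - mean_defect t x0"
    using \<open>0 \<le> t\<close> by (simp add: QY(2) mean_defect_def mean_product_def max_def)
  have opt: "optimizer t \<in> \<M>"
    unfolding \<M>_def X by (rule optimizer_martingale[OF \<open>0 \<le> t\<close>])
  have val: "functional M X lam f t (optimizer t) = mean_defect t x0"
    unfolding X by (rule functional_optimizer[OF \<open>0 \<le> t\<close>])
  have "functional M X lam f t \<zeta> \<le> mean_defect t x0" if "\<zeta> \<in> \<M>" for \<zeta>
    using that unfolding \<M>_def X by (rule functional_le[OF \<open>0 \<le> t\<close>])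
  then have "is_arg_max (functional M X lam f t) (\<lambda>\<zeta>. \<zeta> \<in> \<M>) (optimizer t)"
    using opt by (auto simp: is_arg_max_def val not_less)
  then show ?thesis
    using u val by auto
qed

end
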